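(* Consider any $\Delta \in (0,1)$, $M>5 l_f L_g$, integer $\tau>0$, and any sufficiently small $\epsilon >0$. Suppose the solver satisfies the solver assumption, the components $g_\xi$ satisfy assumptions (V) and (UL) of the context, $\inf_x \Phi(x) > -\infty$, the algorithm uses the estimator $\mathtt{estimator}_2$ of the context, and $\boldsymbol{\tau}$ is restricted to the form $\tau_0= \cdots= \tau_{K-1} = \tau$. There are constants $C_{\Sigma}, C_A, C_B, C_a, C_b$ (not depending on $\epsilon,\tau,\Delta$) such that, setting $K = \lceil \frac{C_{\Sigma} \epsilon^{-1}}{\tau} \rceil$, $A = \lceil C_A \epsilon^{-2} \log ( \frac{4(m+ 1) K \tau}{\Delta} ) \rceil$, $B = \lceil C_B \tau^2\epsilon^{-1} \log ( \frac{4(m+ n) K \tau}{\Delta} ) \rceil$, $a = \lceil C_a \tau^4 \log ( \frac{4(m+ 1) K \tau}{\Delta} ) \rceil$, $b = \lceil C_b \tau^2 \log ( \frac{4(m+ n) K \tau}{\Delta} ) \rceil$, $\overline{\delta} = \Delta/ (2K\tau)$, $\overline{\epsilon} = \epsilon/(5\cdot 30M)$, with probability at least $1-\Delta$: (i) the iterates of the algorithm satisfy $$\frac{1}{K \tau} \sum_{k=0}^{K-1} \sum_{i=0}^{\tau -1} \| \mathcal{G}_M(x_i^k) \|_2 ^2 \le \epsilon;$$ (ii) provided $\tau = O(\epsilon^{-1})$, the oracle complexities for evaluations $g_\xi(\cdot)$ and Jacobians $g'_\xi(\cdot)$ of the inner components are respectively at most $$\widetilde{\Theta} \left( (\epsilon^{-3}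 \tau^{-1} + \epsilon^{-1} \tau^4) \log(1/\Delta) \right)\quad\text{and}\quad \widetilde{\Theta} \left( (\epsilon^{-2} \tau + \epsilon^{-1} \tau^4) \log(1/\Delta) \right).$$
   Context: Problem. $f:\mathbb{R}^m\to\mathbb{R}$ is convex and $l_f$-Lipschitz; $g:\mathbb{R}^n\to\mathbb{R}^m$ is differentiable and $l_g$-Lipschitz, with $\|g'(x)-g'(y)\|_{\mathrm{op}}\le L_g\|x-y\|_2$ for all $x,y$ ($\|\cdot\|_{\mathrm{op}}$ is the spectral norm); $h:\mathbb{R}^n\to\mathbb{R}\cup\{+\infty\}$ is closed, convex and proper; $l_f,L_g>0$. $\Phi(x)=f(g(x))+h(x)$. Moreover $g(x)=\mathbb{E}_{\xi\sim D}[g_\xi(x)]$ and $g'(x)=\mathbb{E}_{\xi\sim D}[g'_\xi(x)]$ for differentiable components $g_\xi$. Stationarity measure. $\mathcal{G}_M(x)=M(x-x_+)$, $x_+=\operatorname{argmin}_{y}\{f(g(x)+g'(x)(y-x))+h(y)+\frac{M}{2}\|y-x\|_2^2\}$. Assumption (V): there are constants $\sigma_g,\sigma_{g'}$ with $\|g_\xi(x)-g(x)\|_2\le\sigma_g$ and $\|g'_\xi(x)-g'(x)\|_{\mathrm{op}}\le\sigma_{g'}$ for all $\xi\in\mathrm{supp}(D)$, $x\in\mathbb{R}^n$. Assumption (UL): there are constants $\widehat l_g,\widehat L_g$ with $\|g_\xi(x)-g_\xi(y)\|_2\le\widehat l_g\|x-y\|_2$ and $\|g'_\xi(x)-g'_\xi(y)\|_{\mathrm{op}}\le\widehat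 L_g\|x-y\|_2$ for all $\xi\in\mathrm{supp}(D)$, $x,y\in\mathbb{R}^n$. Algorithm. Inputs: $x_0^0\in\mathbb{R}^n$, $M>0$, $K\in\mathbb{N}_+$, $\boldsymbol{\tau}=(\tau_0,\dots,\tau_{K-1})\in\mathbb{N}_+^K$, an estimator, a solver, tolerances $\overline{\epsilon},\overline{\delta}>0$. For $k=0,\dots,K-1$: for $i=0,\dots,\tau_k-1$, (1) compute estimates $(\widetilde g_i^k,\widetilde J_i^k)$ of $g(x_i^k),g'(x_i^k)$ by the estimator; (2) with $s_i^k(x)=f(\widetilde g_i^k+\widetilde J_i^k(x-x_i^k))+h(x)+\frac{M}{2}\|x-x_i^k\|_2^2$, set $x_{i+1}^k=\mathtt{solver}(s_i^k,\overline{\epsilon},\overline{\delta})$. After the inner loop set $x_0^{k+1}=x_{\tau_k}^k$. $\mathtt{estimator}_2$, with parameters (batch sizes) $\theta=(A,B,a,b)\in\mathbb{N}_+^4$: at iteration $(k,i)$, draw batches $\mathcal{A}_i^k,\mathcal{B}_i^k$ of i.i.d. samples from $D$, independent of the past, of sizes $A,B$ if $i=0$ and $a,b$ if $i>0$. Set $\widetilde g_0^k=\frac1A\sum_{\xi\in\mathcal{A}_0^k}g_\xi(x_0^k)$, $\widetilde J_0^k=\frac1B\sum_{\xi\in\mathcal{B}_0^k}g'_\xi(x_0^k)$, and for $i>0$, $\widetilde g_i^k=\frac1a\sum_{\xi\in\mathcal{A}_i^k}(g_\xi(x_i^k)-g_\xi(x_0^k)-g'_\xi(x_0^k)(x_i^k-x_0^k))+\widetilde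 g_0^k+\widetilde J_0^k(x_i^k-x_0^k)$, $\widetilde J_i^k=\frac1b\sum_{\xi\in\mathcal{B}_i^k}(g'_\xi(x_i^k)-g'_\xi(x_0^k))+\widetilde J_0^k$. Solver assumption. For $\overline{\epsilon},\overline{\delta}>0$ and the problem $\min_x s(x)$, with probability at least $1-\overline{\delta}$, $\mathtt{solver}(s,\overline{\epsilon},\overline{\delta})$ returns $x_{\mathrm{sol}}$ with $s(x_{\mathrm{sol}})\le\inf_x s(x)+\overline{\epsilon}$; this applies to each subproblem $s=s_i^k$ generated by the algorithm. Conventions. The oracle complexity for evaluations (Jacobians) is the total number of evaluations of $g_\xi(\cdot)$ (of $g'_\xi(\cdot)$) made by the algorithm. $O,\Theta$ are with respect to $\epsilon\to0$ ($\tau$ may depend on $\epsilon$); $\widetilde\Theta$ omits multiplicative logarithmic terms in $\epsilon$; ``at most $\widetilde\Theta(\cdot)$'' means bounded above by a quantity of that order. The constants $C_\Sigma,C_A,C_B,C_a,C_b$ may depend on $M$ and the fixed problem data. *)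

theory Defs
  imports "HOL-Probability.Probability" "HOL-Library.Landau_Symbols"
begin

definition opnorm :: "real^'n^'m \<Rightarrow> real" where
  "opnorm A = onorm (\<lambda>v. A *v v)"

definition epi :: "('a \<Rightarrow> ereal) \<Rightarrow> ('a \<times> real) set" where
  "epi h = {(x, r). h x \<le> ereal r}"

definition closed_convex_proper :: "('a::real_normed_vector \<Rightarrow> ereal) \<Rightarrow> bool" where
  "closed_convex_proper h \<longleftrightarrow>
     closed (epi h) \<and> convex (epi h) \<and> (\<forall>x. h x \<noteq> - \<infinity>) \<and> (\<exists>x. h x \<noteq> \<infinity>)"

definition objective ::
  "(real^'m \<Rightarrow> real) \<Rightarrow> (real^'n \<Rightarrow> real^'m) \<Rightarrow> (real^'n \<Rightarrow> ereal) \<Rightarrow> real^'n \<Rightarrow> ereal" where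
  "objective f g h x = ereal (f (g x)) + h x"

text \<open>The regularised prox-linear model at \<open>x\<close>, for a value \<open>G\<close> and a Jacobian \<open>J\<close> that are either
  exact or estimated.\<close>

definition prox_model ::
  "(real^'m \<Rightarrow> real) \<Rightarrow> (real^'n \<Rightarrow> ereal) \<Rightarrow> real \<Rightarrow> real^'m \<Rightarrow> real^'n^'m \<Rightarrow> real^'n \<Rightarrow> real^'n \<Rightarrow> ereal"
where
  "prox_model f h M G J x y =
     ereal (f (G + J *v (y - x))) + h y + ereal (M / 2 * (norm (y - x))\<^sup>2)"

text \<open>For a closed convex proper \<open>h\<close>, a convex Lipschitz \<open>f\<close> and \<open>M > 0\<close> the model is strongly convex and
  lower semicontinuous, so its minimiser exists and is unique and \<open>arg_min\<close> picks it.\<close>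

definition grad_map ::
  "(real^'m \<Rightarrow> real) \<Rightarrow> (real^'n \<Rightarrow> real^'m) \<Rightarrow> (real^'n \<Rightarrow> real^'n^'m) \<Rightarrow> (real^'n \<Rightarrow> ereal) \<Rightarrow> real
    \<Rightarrow> real^'n \<Rightarrow> real^'n" where
  "grad_map f g g' h M x =
     M *\<^sub>R (x - arg_min (prox_model f h M (g x) (g' x) x) (\<lambda>_. True))"

text \<open>\<open>est k i x0 x\<close> is the pair of estimates of value and Jacobian at \<open>x = x\<^sub>i\<^sup>k\<close> when \<open>x0 = x\<^sub>0\<^sup>k\<close>;
  \<open>slv k i s \<epsilon> \<delta>\<close> is what the solver call of iteration \<open>(k, i)\<close> returns on the problem \<open>s\<close> with
  tolerances \<open>\<epsilon>\<close>, \<open>\<delta>\<close>. Both may be indexed by the iteration because the calls are randomised.\<close>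

definition subproblem ::
  "(real^'m \<Rightarrow> real) \<Rightarrow> (real^'n \<Rightarrow> ereal) \<Rightarrow> real
    \<Rightarrow> (nat \<Rightarrow> nat \<Rightarrow> real^'n \<Rightarrow> real^'n \<Rightarrow> (real^'m) \<times> (real^'n^'m))
    \<Rightarrow> nat \<Rightarrow> nat \<Rightarrow> real^'n \<Rightarrow> real^'n \<Rightarrow> real^'n \<Rightarrow> ereal" where
  "subproblem f h M est k i x0 x =
     prox_model f h M (fst (est k i x0 x)) (snd (est k i x0 x)) x"

primrec inner_iterate ::
  "(real^'m \<Rightarrow> real) \<Rightarrow> (real^'n \<Rightarrow> ereal) \<Rightarrow> real
    \<Rightarrow> (nat \<Rightarrow> nat \<Rightarrow> real^'n \<Rightarrow> real^'n \<Rightarrow> (real^'m) \<times> (real^'n^'m))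
    \<Rightarrow> (nat \<Rightarrow> nat \<Rightarrow> (real^'n \<Rightarrow> ereal) \<Rightarrow> real \<Rightarrow> real \<Rightarrow> real^'n) \<Rightarrow> real \<Rightarrow> real
    \<Rightarrow> nat \<Rightarrow> real^'n \<Rightarrow> nat \<Rightarrow> real^'n" where
  "inner_iterate f h M est slv \<epsilon>b \<delta>b k x0 0 = x0"
| "inner_iterate f h M est slv \<epsilon>b \<delta>b k x0 (Suc i) =
     slv k i (subproblem f h M est k i x0 (inner_iterate f h M est slv \<epsilon>b \<delta>b k x0 i)) \<epsilon>b \<delta>b"

primrec outer_iterate ::
  "(real^'m \<Rightarrow> real) \<Rightarrow> (real^'n \<Rightarrow> ereal) \<Rightarrow> real
    \<Rightarrow> (nat \<Rightarrow> nat \<Rightarrow> real^'n \<Rightarrow> real^'n \<Rightarrow> (real^'m) \<times> (real^'n^'m))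
    \<Rightarrow> (nat \<Rightarrow> nat \<Rightarrow> (real^'n \<Rightarrow> ereal) \<Rightarrow> real \<Rightarrow> real \<Rightarrow> real^'n) \<Rightarrow> real \<Rightarrow> real
    \<Rightarrow> (nat \<Rightarrow> nat) \<Rightarrow> real^'n \<Rightarrow> nat \<Rightarrow> real^'n" where
  "outer_iterate f h M est slv \<epsilon>b \<delta>b tau x00 0 = x00"
| "outer_iterate f h M est slv \<epsilon>b \<delta>b tau x00 (Suc k) =
     inner_iterate f h M est slv \<epsilon>b \<delta>b k (outer_iterate f h M est slv \<epsilon>b \<delta>b tau x00 k) (tau k)"

definition iterate ::
  "(real^'m \<Rightarrow> real) \<Rightarrow> (real^'n \<Rightarrow> ereal) \<Rightarrow> real
    \<Rightarrow> (nat \<Rightarrow> nat \<Rightarrow> real^'n \<Rightarrow> real^'n \<Rightarrow> (real^'m) \<times> (real^'n^'m))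
    \<Rightarrow> (nat \<Rightarrow> nat \<Rightarrow> (real^'n \<Rightarrow> ereal) \<Rightarrow> real \<Rightarrow> real \<Rightarrow> real^'n) \<Rightarrow> real \<Rightarrow> real
    \<Rightarrow> (nat \<Rightarrow> nat) \<Rightarrow> real^'n \<Rightarrow> nat \<Rightarrow> nat \<Rightarrow> real^'n" where
  "iterate f h M est slv \<epsilon>b \<delta>b tau x00 k i =
     inner_iterate f h M est slv \<epsilon>b \<delta>b k (outer_iterate f h M est slv \<epsilon>b \<delta>b tau x00 k) i"

text \<open>\<open>gc \<xi>\<close> and \<open>Jc \<xi>\<close> are the component maps and their Jacobians; \<open>SA k i j\<close> is the \<open>j\<close>-th sample of
  the batch \<open>\<A>\<^sub>i\<^sup>k\<close>, and \<open>SB\<close> likewise for \<open>\<B>\<^sub>i\<^sup>k\<close>. Batches are indexed families, so repeated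
  samples count with multiplicity.\<close>

definition estimator2 ::
  "('x \<Rightarrow> real^'n \<Rightarrow> real^'m) \<Rightarrow> ('x \<Rightarrow> real^'n \<Rightarrow> real^'n^'m) \<Rightarrow> nat \<Rightarrow> nat \<Rightarrow> nat \<Rightarrow> nat
    \<Rightarrow> (nat \<Rightarrow> nat \<Rightarrow> nat \<Rightarrow> 'x) \<Rightarrow> (nat \<Rightarrow> nat \<Rightarrow> nat \<Rightarrow> 'x)
    \<Rightarrow> nat \<Rightarrow> nat \<Rightarrow> real^'n \<Rightarrow> real^'n \<Rightarrow> (real^'m) \<times> (real^'n^'m)" where
  "estimator2 gc Jc A B a b SA SB k i x0 x =
     (let G0 = (1 / real A) *\<^sub>R (\<Sum>j<A. gc (SA k 0 j) x0);
          J0 = (1 / real B) *\<^sub>R (\<Sum>j<B. Jc (SB k 0 j) x0)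
      in if i = 0 then (G0, J0)
         else ((1 / real a) *\<^sub>R
                 (\<Sum>j<a. gc (SA k i j) x - gc (SA k i j) x0 - Jc (SA k i j) x0 *v (x - x0))
                 + G0 + J0 *v (x - x0),
               (1 / real b) *\<^sub>R (\<Sum>j<b. Jc (SB k i j) x - Jc (SB k i j) x0) + J0))"

text \<open>Numbers of component evaluations. For \<open>i > 0\<close> each sample of \<open>\<A>\<^sub>i\<^sup>k\<close> costs two values (at
  \<open>x\<^sub>i\<^sup>k\<close> and \<open>x\<^sub>0\<^sup>k\<close>) and one Jacobian (at \<open>x\<^sub>0\<^sup>k\<close>), each sample of \<open>\<B>\<^sub>i\<^sup>k\<close> two Jacobians.\<close>

definition value_evals :: "nat \<Rightarrow> (nat \<Rightarrow> nat) \<Rightarrow> nat \<Rightarrow> nat \<Rightarrow> nat" where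
  "value_evals K tau A a = (\<Sum>k<K. \<Sum>i<tau k. if i = 0 then A else 2 * a)"

definition jacobian_evals :: "nat \<Rightarrow> (nat \<Rightarrow> nat) \<Rightarrow> nat \<Rightarrow> nat \<Rightarrow> nat \<Rightarrow> nat" where
  "jacobian_evals K tau B a b = (\<Sum>k<K. \<Sum>i<tau k. if i = 0 then B else a + 2 * b)"

text \<open>\<open>S 0, \<dots>, S (N - 1)\<close> have law \<open>D\<close> and are, together with the \<open>\<sigma>\<close>-algebra of \<open>H\<close> (the index
  \<open>None\<close>), mutually independent: i.i.d. samples that are independent of \<open>H\<close>.\<close>

definition fresh_batch ::
  "'w measure \<Rightarrow> 'w measure \<Rightarrow> 'x measure \<Rightarrow> nat \<Rightarrow> (nat \<Rightarrow> 'w \<Rightarrow> 'x) \<Rightarrow> bool" where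
  "fresh_batch P H D N S \<longleftrightarrow>
     (\<forall>j<N. S j \<in> measurable P D \<and> distr P D (S j) = D) \<and>
     prob_space.indep_sets P
       (\<lambda>t. case t of None \<Rightarrow> sets H | Some j \<Rightarrow> {S j -` E \<inter> space P | E. E \<in> sets D})
       (insert None (Some ` {..<N}))"

text \<open>The \<open>\<sigma>\<close>-algebra of everything the algorithm has seen when iteration \<open>(k, i)\<close> starts: the samples
  of all earlier iterations and the iterates up to and including \<open>x\<^sub>i\<^sup>k\<close>. \<open>NA i\<close>, \<open>NB i\<close> are the batch
  sizes.\<close>

definition past ::
  "'w measure \<Rightarrow> 'x measure \<Rightarrow> (nat \<Rightarrow> nat) \<Rightarrow> (nat \<Rightarrow> nat) \<Rightarrow> (nat \<Rightarrow> nat)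
    \<Rightarrow> (nat \<Rightarrow> nat \<Rightarrow> nat \<Rightarrow> 'w \<Rightarrow> 'x) \<Rightarrow> (nat \<Rightarrow> nat \<Rightarrow> nat \<Rightarrow> 'w \<Rightarrow> 'x)
    \<Rightarrow> (nat \<Rightarrow> nat \<Rightarrow> 'w \<Rightarrow> real^'n) \<Rightarrow> nat \<Rightarrow> nat \<Rightarrow> 'w measure" where
  "past P D tau NA NB SA SB X k i = sigma (space P)
     ({SA k' i' j -` E \<inter> space P | k' i' j E.
         (k' < k \<and> i' < tau k' \<or> k' = k \<and> i' < i) \<and> j < NA i' \<and> E \<in> sets D} \<union>
      {SB k' i' j -` E \<inter> space P | k' i' j E.
         (k' < k \<and> i' < tau k' \<or> k' = k \<and> i' < i) \<and> j < NB i' \<and> E \<in> sets D} \<union>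
      {X k' i' -` E \<inter> space P | k' i' E.
         (k' < k \<and> i' \<le> tau k' \<or> k' = k \<and> i' \<le> i) \<and> E \<in> sets borel})"

context
  fixes f :: "real^'m \<Rightarrow> real" and h :: "real^'n \<Rightarrow> ereal"
    and gc :: "'x \<Rightarrow> real^'n \<Rightarrow> real^'m" and Jc :: "'x \<Rightarrow> real^'n \<Rightarrow> real^'n^'m"
    and D :: "'x measure"
    and x00 :: "real^'n" and M :: real and K :: nat and tau :: "nat \<Rightarrow> nat"
    and A B a b :: nat and \<epsilon>b \<delta>b :: real
    and P :: "'w measure" and SA SB :: "nat \<Rightarrow> nat \<Rightarrow> nat \<Rightarrow> 'w \<Rightarrow> 'x"
    and slv :: "nat \<Rightarrow> nat \<Rightarrow> 'w \<Rightarrow> (real^'n \<Rightarrow> ereal) \<Rightarrow> real \<Rightarrow> real \<Rightarrow> real^'n"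
begin

definition estimator2_at ::
  "'w \<Rightarrow> nat \<Rightarrow> nat \<Rightarrow> real^'n \<Rightarrow> real^'n \<Rightarrow> (real^'m) \<times> (real^'n^'m)" where
  "estimator2_at \<omega> =
     estimator2 gc Jc A B a b (\<lambda>k i j. SA k i j \<omega>) (\<lambda>k i j. SB k i j \<omega>)"

definition run_iterate :: "nat \<Rightarrow> nat \<Rightarrow> 'w \<Rightarrow> real^'n" where
  "run_iterate k i \<omega> =
     iterate f h M (estimator2_at \<omega>) (\<lambda>k i. slv k i \<omega>) \<epsilon>b \<delta>b tau x00 k i"

definition run_subproblem :: "nat \<Rightarrow> nat \<Rightarrow> 'w \<Rightarrow> real^'n \<Rightarrow> ereal" where
  "run_subproblem k i \<omega> =
     subproblem f h M (estimator2_at \<omega>) k i (run_iterate k 0 \<omega>) (run_iterate k i \<omega>)"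

definition is_run :: bool where
  "is_run \<longleftrightarrow> prob_space P \<and>
     (\<forall>k<K. \<forall>i\<le>tau k. run_iterate k i \<in> borel_measurable P) \<and>
     (\<forall>k<K. \<forall>i<tau k.
        let NA = (\<lambda>i. if i = 0 then A else a);
            NB = (\<lambda>i. if i = 0 then B else b);
            H = past P D tau NA NB SA SB run_iterate k i
        in fresh_batch P H D (NA i) (SA k i) \<and> fresh_batch P H D (NB i) (SB k i))"

text \<open>The probability is over all the randomness of the run. A non-measurable event would have measure
  \<open>0\<close>, so the inequality includes measurability whenever \<open>\<delta>b < 1\<close>.\<close>

definition solver_succeeds :: bool where
  "solver_succeeds \<longleftrightarrow>
     (\<forall>k<K. \<forall>i<tau k.
        measure P {\<omega> \<in> space P.
          run_subproblem k i \<omega> (slv k i \<omega> (run_subproblem k i \<omega>) \<epsilon>b \<delta>b)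
            \<le> (INF y. run_subproblem k i \<omega> y) + ereal \<epsilon>b} \<ge> 1 - \<delta>b)"

end

definition soft_theta :: "(real \<Rightarrow> real) \<Rightarrow> (real \<Rightarrow> real) set" where
  "soft_theta Q = {q. \<exists>p::nat. q \<in> \<Theta>[at_right 0](\<lambda>\<epsilon>. Q \<epsilon> * ln (1 / \<epsilon>) ^ p)}"

definition at_most_soft_theta :: "(real \<Rightarrow> real) \<Rightarrow> (real \<Rightarrow> real) \<Rightarrow> bool" where
  "at_most_soft_theta N Q \<longleftrightarrow>
     (\<exists>q \<in> soft_theta Q. eventually (\<lambda>\<epsilon>. N \<epsilon> \<le> q \<epsilon>) (at_right 0))"

end

(*
One step of the algorithm decreases the objective by a multiple of |x - x_+|^2 + |x' - x|^2, up to
terms in the errors of the value and Jacobian estimates. Within an inner loop these errors consist of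
a part fixed by the two large batches at x_0 and a part of order D^2 / tau^2 (value) and D / tau
(Jacobian) with D = |x_i - x_0|. By Cauchy-Schwarz the sum of D^2 / tau^2 over an inner loop is at
most the sum of the squared steps |x_{j+1} - x_j|^2, so the decrease pays for it and the descent
telescopes over the whole run.

The error bounds hold with high probability by Hoeffding's inequality applied to every entry. Since
the constants may depend on the dimensions, the entrywise union bound can replace a matrix
concentration inequality. The remainder terms of the small batches scale with D^2 and D because
g_xi has Lipschitz Jacobian.
*)

theory Submission
  imports Defs "HOL-Real_Asymp.Real_Asymp"
begin

section \<open>Proximal minimisers\<close>

text \<open>Three obstacles shape the proof. The starting point may have
  \<open>h = \<infinity>\<close>, so the objective cannot serve as a potential. It is replaced by
  \<open>level\<close>, a bound on the linearised objective at \<open>prox x\<close> plus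
  \<open>M\<close> times the squared distance to \<open>prox x\<close>. A bound on the objective
  implies this one by strong convexity, it still dominates the infimum, and its full factor
  \<open>M\<close>, against the \<open>M / 2\<close> of the regulariser, is what leaves a negative
  multiple of the squared stationarity measure after a step. Next, batches are evaluated at random
  iterates, so Hoeffding's inequality does not apply to them directly. The iterate is measurable
  with respect to the past, the batch is independent of the past, and deviations are continuous in
  the point; this transfers the tail bound from fixed points without any covering argument. To fit
  errors that shrink with the distance to \<open>x_0\<close>, a deviation is always a number
  \<open>u\<close> times a radius that may depend on the point. Finally, the event of the conclusion
  has to be measurable before inclusion of events says anything about its probability. This is why
  continuity of the proximal map is proved.\<close>

lemma norm_matrix_vector_le_opnorm: "norm (A *v v) \<le> opnorm A * norm v"
  for A :: "real^'n^'m"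
  unfolding opnorm_def by (rule onorm[OF matrix_vector_mul_bounded_linear])

lemma opnorm_nonneg: "0 \<le> opnorm A"
  for A :: "real^'n^'m"
  unfolding opnorm_def by (rule onorm_pos_le[OF matrix_vector_mul_bounded_linear])

lemma entry_le_opnorm: "\<bar>A $ i $ j\<bar> \<le> opnorm A"
  for A :: "real^'n^'m"
  unfolding opnorm_def by (rule matrix_component_le_onorm)

text \<open>The dimensional factor is the price of estimating a matrix entry by entry; it ends up in
  the constants of the batch sizes.\<close>

lemma opnorm_le_of_entries:
  fixes A :: "real^'n^'m"
  assumes "\<And>i j. \<bar>A $ i $ j\<bar> \<le> B"
  shows "opnorm A \<le> real CARD('m) * real CARD('n) * B"
  unfolding opnorm_def by (rule onorm_le_matrix_component) (use assms in auto)

lemma opnorm_triangle: "opnorm (A + B) \<le> opnorm A + opnorm B"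
  for A B :: "real^'n^'m"
  using onorm_triangle[OF matrix_vector_mul_bounded_linear matrix_vector_mul_bounded_linear, of A B]
  by (simp add: opnorm_def matrix_vector_mult_add_rdistrib)

lemma norm_le_of_entries:
  fixes v :: "real^'m"
  assumes "\<And>i. \<bar>v $ i\<bar> \<le> B"
  shows "norm v \<le> real CARD('m) * B"
proof -
  have "norm v \<le> (\<Sum>i\<in>UNIV. \<bar>v $ i\<bar>)" by (rule norm_le_l1_cart)
  also have "\<dots> \<le> (\<Sum>i\<in>(UNIV::'m set). B)" by (intro sum_mono assms)
  finally show ?thesis by simp
qed

text \<open>Mean value inequality for \<open>F\<close> minus its linear part at \<open>x\<close>,
  whose derivative is at most \<open>L * norm (y - x)\<close> on the segment. The constant is
  \<open>L\<close> instead of the sharp \<open>L / 2\<close>; the lower bound on \<open>M\<close> is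
  large enough to absorb it.\<close>

lemma lipschitz_jacobian_Taylor:
  fixes F :: "real^'n \<Rightarrow> real^'m"
  assumes der: "\<And>x. (F has_derivative (\<lambda>v. J x *v v)) (at x)"
    and lip: "\<And>x y. opnorm (J x - J y) \<le> L * norm (x - y)"
  shows "norm (F y - F x - J x *v (y - x)) \<le> L * (norm (y - x))\<^sup>2"
proof (cases "y = x")
  case False
  \<comment> \<open>Only two distinct points force the sign of \<open>L\<close>, hence the case
    split.\<close>
  have L: "L \<ge> 0"
    using opnorm_nonneg[of "J y - J x"] lip[of y x] False
    by (smt (verit) mult_neg_pos zero_less_norm_iff right_minus_eq)
  let ?H = "\<lambda>z. F z - J x *v z"
  have "norm (?H y - ?H x) \<le> (L * norm (y - x)) * norm (y - x)"
  proof (rule differentiable_bound[where S = "closed_segment x y" and f' = "\<lambda>z v. J z *v v - J x *v v"])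
    fix z assume z: "z \<in> closed_segment x y"
    show "(?H has_derivative (\<lambda>v. J z *v v - J x *v v)) (at z within closed_segment x y)"
      by (intro derivative_intros has_derivative_at_withinI[OF der]
          bounded_linear_imp_has_derivative matrix_vector_mul_bounded_linear)
    have "onorm (\<lambda>v. J z *v v - J x *v v) = opnorm (J z - J x)"
      by (simp add: opnorm_def matrix_vector_mult_diff_rdistrib)
    also have "\<dots> \<le> L * norm (z - x)" by (rule lip)
    also have "\<dots> \<le> L * norm (y - x)"
      using segment_bound1[OF z] L by (simp add: mult_left_mono norm_minus_commute)
    finally show "onorm (\<lambda>v. J z *v v - J x *v v) \<le> L * norm (y - x)" .
  qed auto
  then show ?thesis
    by (simp add: matrix_vector_mult_diff_distrib algebra_simps power2_eq_square)
qed simp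

section \<open>Existence and quadratic growth of regularised minimisers\<close>

lemma closed_convex_proper_convexD:
  assumes h: "closed_convex_proper h" and t: "0 \<le> t" "t \<le> 1"
    and x: "h x \<le> ereal r" and y: "h y \<le> ereal s"
  shows "h ((1 - t) *\<^sub>R x + t *\<^sub>R y) \<le> ereal ((1 - t) * r + t * s)"
proof -
  have "convex (epi h)" using h by (simp add: closed_convex_proper_def)
  from convexD_alt[OF this, of "(x, r)" "(y, s)" t] x y t show ?thesis
    by (simp add: epi_def)
qed

lemma closed_convex_proper_finite:
  assumes "closed_convex_proper h" "h x \<noteq> \<infinity>"
  obtains r where "h x = ereal r"
  using assms by (cases "h x") (auto simp: closed_convex_proper_def)

text \<open>Lower semicontinuity enters through closedness of the epigraph: a minimising sequence is
  bounded by coercivity, and the limit of its epigraph points lies in the epigraph.\<close>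

lemma exists_minimiser:
  fixes h :: "'a::euclidean_space \<Rightarrow> ereal"
  assumes h: "closed_convex_proper h" and q: "continuous_on UNIV q"
    and \<kappa>: "\<kappa> > 0"
    and coercive: "\<And>y r. h y = ereal r \<Longrightarrow> \<kappa> * (norm (y - x))\<^sup>2 - b * norm (y - x) - a \<le> q y + r"
  shows "\<exists>p. \<forall>y. ereal (q p) + h p \<le> ereal (q y) + h y"
proof -
  let ?F = "\<lambda>y. ereal (q y) + h y"
  obtain y0 where "h y0 \<noteq> \<infinity>" using h by (auto simp: closed_convex_proper_def)
  then obtain r0 where r0: "h y0 = ereal r0" using closed_convex_proper_finite[OF h] by blast
  define \<mu> where "\<mu> = (INF y. ?F y)"
  \<comment> \<open>Completing the square in \<open>norm (y - x)\<close> removes the dependence on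
    \<open>y\<close>, so the infimum is finite.\<close>
  have low: "ereal (- (b\<^sup>2 / (4 * \<kappa>)) - a) \<le> ?F y" for y
  proof (cases "h y = \<infinity>")
    case False
    then obtain r where r: "h y = ereal r" using closed_convex_proper_finite[OF h] by blast
    have "0 \<le> \<kappa> * (norm (y - x) - b / (2 * \<kappa>))\<^sup>2" using \<kappa> by simp
    also have "\<dots> = \<kappa> * (norm (y - x))\<^sup>2 - b * norm (y - x) + b\<^sup>2 / (4 * \<kappa>)"
      using \<kappa> by (simp add: power2_eq_square field_simps)
    finally show ?thesis using coercive[OF r] r by simp
  qed simp
  have "\<mu> \<le> ?F y0" unfolding \<mu>_def by (rule INF_lower) simp
  moreover have "ereal (- (b\<^sup>2 / (4 * \<kappa>)) - a) \<le> \<mu>" unfolding \<mu>_def by (intro INF_greatest low)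
  ultimately obtain u where u: "\<mu> = ereal u" using r0 by (cases \<mu>) auto
  have "\<exists>y. ?F y < ereal (u + 1 / real (Suc n))" for n
  proof -
    have "\<mu> < ereal (u + 1 / real (Suc n))" by (simp add: u)
    then show ?thesis unfolding \<mu>_def by (simp add: INF_less_iff)
  qed
  then obtain Y where Y: "\<And>n. ?F (Y n) < ereal (u + 1 / real (Suc n))" by metis
  \<comment> \<open>For \<open>t > 1\<close> a nonnegative constant is at most \<open>t\<close>
    times itself, so the quadratic inequality for \<open>t\<close> can be divided by
    \<open>t\<close>.\<close>
  have bnd: "norm (Y n - x) \<le> 1 + (\<bar>b\<bar> + \<bar>a\<bar> + \<bar>u\<bar> + 1) / \<kappa>" for n
  proof (cases "norm (Y n - x) \<le> 1")
    case True
    moreover have "0 \<le> (\<bar>b\<bar> + \<bar>a\<bar> + \<bar>u\<bar> + 1) / \<kappa>" using \<kappa> by (intro divide_nonneg_pos) auto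
    ultimately show ?thesis by linarith
  next
    case False
    define t where "t = norm (Y n - x)"
    have t: "t > 1" using False t_def by simp
    have "h (Y n) \<noteq> \<infinity>" using Y[of n] by auto
    then obtain r where r: "h (Y n) = ereal r" using closed_convex_proper_finite[OF h] by blast
    have "q (Y n) + r < u + 1 / real (Suc n)" using Y[of n] r by simp
    moreover have "1 / real (Suc n) \<le> 1" by simp
    ultimately have "q (Y n) + r < u + 1" by linarith
    then have "\<kappa> * t\<^sup>2 - b * t - a < u + 1" using coercive[OF r] by (simp add: t_def)
    then have "\<kappa> * t\<^sup>2 \<le> \<bar>b\<bar> * t + (\<bar>a\<bar> + \<bar>u\<bar> + 1)"
      using t by (smt (verit) mult_right_mono)
    also have "\<dots> \<le> (\<bar>b\<bar> + \<bar>a\<bar> + \<bar>u\<bar> + 1) * t"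
      using t mult_left_mono[of 1 t "\<bar>a\<bar> + \<bar>u\<bar> + 1"] by (simp add: algebra_simps)
    finally have "(\<kappa> * t) * t \<le> (\<bar>b\<bar> + \<bar>a\<bar> + \<bar>u\<bar> + 1) * t" by (simp add: power2_eq_square mult.assoc)
    then have "\<kappa> * t \<le> \<bar>b\<bar> + \<bar>a\<bar> + \<bar>u\<bar> + 1" using t by simp
    then have "t \<le> (\<bar>b\<bar> + \<bar>a\<bar> + \<bar>u\<bar> + 1) / \<kappa>" using \<kappa> by (simp add: field_simps)
    then show ?thesis by (simp add: t_def)
  qed
  have "bounded (range Y)"
    unfolding bounded_any_center[where a = x] using bnd by (auto simp: dist_norm norm_minus_commute)
  then obtain l \<rho> where \<rho>: "strict_mono \<rho>" and l: "(Y \<circ> \<rho>) \<longlonglongrightarrow> l"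
    using bounded_imp_convergent_subsequence by blast
  \<comment> \<open>The values of \<open>h\<close> along the sequence need not converge; the upper
    bound for them that remains after subtracting \<open>q\<close> does.\<close>
  have "(\<lambda>n. (Y (\<rho> n), u + 1 / real (Suc (\<rho> n)) - q (Y (\<rho> n)))) \<longlonglongrightarrow> (l, u + 0 - q l)"
  proof (intro tendsto_intros)
    show l': "(\<lambda>n. Y (\<rho> n)) \<longlonglongrightarrow> l" using l by (simp add: o_def)
    show "(\<lambda>n. 1 / real (Suc (\<rho> n))) \<longlonglongrightarrow> 0"
      using LIMSEQ_subseq_LIMSEQ[OF LIMSEQ_inverse_real_of_nat \<rho>] by (simp add: o_def inverse_eq_divide)
    show "(\<lambda>n. q (Y (\<rho> n))) \<longlonglongrightarrow> q l"
      using q l' by (metis continuous_on_tendsto_compose UNIV_I eventually_sequentiallyI)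
  qed
  moreover have "(Y n, u + 1 / real (Suc n) - q (Y n)) \<in> epi h" for n
    using Y[of n] by (cases "h (Y n)") (auto simp: epi_def)
  moreover have "closed (epi h)" using h by (simp add: closed_convex_proper_def)
  ultimately have "(l, u + 0 - q l) \<in> epi h"
    by (metis (no_types, lifting) closed_sequentially)
  then have "?F l \<le> ereal u" by (cases "h l") (auto simp: epi_def)
  moreover have "ereal u \<le> ?F y" for y unfolding u[symmetric] \<mu>_def by (rule INF_lower) simp
  ultimately show ?thesis by (metis order_trans)
qed

lemma power2_norm_convex_combination:
  fixes u v :: "'a::real_inner"
  shows "(norm ((1 - t) *\<^sub>R u + t *\<^sub>R v))\<^sup>2
    = (1 - t) * (norm u)\<^sup>2 + t * (norm v)\<^sup>2 - t * (1 - t) * (norm (v - u))\<^sup>2"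
  by (simp add: power2_norm_eq_inner inner_simps inner_commute) algebra

text \<open>Compare \<open>p\<close> with the point at fraction \<open>t\<close> towards
  \<open>y\<close>. The bounds for \<open>c\<close> and \<open>h\<close> are affine in
  \<open>t\<close>, while the squared norm gains a term \<open>t * (1 - t)\<close>. Dividing by
  \<open>t\<close> and letting \<open>t\<close> tend to 0 leaves the quadratic growth term.\<close>

lemma prox_minimiser_strong:
  fixes h :: "'a::euclidean_space \<Rightarrow> ereal"
  assumes h: "closed_convex_proper h" and c: "convex_on UNIV c"
    and min: "\<And>y. ereal (c p + M / 2 * (norm (p - x))\<^sup>2) + h p \<le> ereal (c y + M / 2 * (norm (y - x))\<^sup>2) + h y"
    and hp: "h p = ereal hp" and hy: "h y \<le> ereal hy"
  shows "c p + M / 2 * (norm (p - x))\<^sup>2 + hp + M / 2 * (norm (y - p))\<^sup>2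
    \<le> c y + M / 2 * (norm (y - x))\<^sup>2 + hy" (is "?l + ?b \<le> ?r")
proof -
  have *: "?l + ?b * (1 - t) \<le> ?r" if t: "0 < t" "t < 1" for t
  proof -
    let ?z = "(1 - t) *\<^sub>R p + t *\<^sub>R y"
    have hz: "h ?z \<le> ereal ((1 - t) * hp + t * hy)"
      by (rule closed_convex_proper_convexD[OF h]) (use t hp hy in auto)
    have "ereal ?l \<le> ereal (c ?z + M / 2 * (norm (?z - x))\<^sup>2) + h ?z" using min[of ?z] hp by simp
    also have "\<dots> \<le> ereal (c ?z + M / 2 * (norm (?z - x))\<^sup>2) + ereal ((1 - t) * hp + t * hy)"
      by (intro add_left_mono hz)
    finally have 1: "?l \<le> c ?z + M / 2 * (norm (?z - x))\<^sup>2 + ((1 - t) * hp + t * hy)" by simp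
    have 2: "c ?z \<le> (1 - t) * c p + t * c y" using convex_onD[OF c, of t p y] t by simp
    have "?z - x = (1 - t) *\<^sub>R (p - x) + t *\<^sub>R (y - x)" by (simp add: algebra_simps)
    then have 3: "(norm (?z - x))\<^sup>2 =
        (1 - t) * (norm (p - x))\<^sup>2 + t * (norm (y - x))\<^sup>2 - t * (1 - t) * (norm (y - p))\<^sup>2"
      using power2_norm_convex_combination[of t "p - x" "y - x"] by simp
    have "t * (?l + ?b * (1 - t)) \<le> t * ?r"
      using 1 2 unfolding 3 by (simp add: algebra_simps add_divide_distrib diff_divide_distrib)
    then show ?thesis using t by simp
  qed
  \<comment> \<open>The choice \<open>t = 1 / (n + 2)\<close> stays inside the open unit interval
    for every \<open>n\<close>.\<close>
  have "(\<lambda>n. ?l + ?b * (1 - 1 / real (n + 2))) \<longlonglongrightarrow> ?l + ?b * (1 - 0)"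
    by (intro tendsto_intros) real_asymp
  then have "?l + ?b * (1 - 0) \<le> ?r"
    by (rule LIMSEQ_le_const2) (intro exI allI impI *; simp)
  then show ?thesis by simp
qed

section \<open>Descent of the inexact prox-linear method\<close>

lemma young_ineq: "c * s \<le> k * s\<^sup>2 + c\<^sup>2 / (4 * k)" if "k > 0" for c s k :: real
proof -
  have "0 \<le> k * (s - c / (2 * k))\<^sup>2" using that by simp
  also have "\<dots> = k * s\<^sup>2 - c * s + c\<^sup>2 / (4 * k)"
    using that by (simp add: power2_eq_square field_simps)
  finally show ?thesis by simp
qed

locale composite_problem =
  fixes f :: "real^'m \<Rightarrow> real" and g :: "real^'n \<Rightarrow> real^'m" and g' :: "real^'n \<Rightarrow> real^'n^'m"
    and h :: "real^'n \<Rightarrow> ereal" and l\<^sub>f L\<^sub>g M :: real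
  assumes f_convex: "convex_on UNIV f"
    and f_lipschitz: "l\<^sub>f-lipschitz_on UNIV f"
    and g_deriv: "\<And>x. (g has_derivative (\<lambda>v. g' x *v v)) (at x)"
    and g_smooth: "\<And>x y. opnorm (g' x - g' y) \<le> L\<^sub>g * norm (x - y)"
    and lf_pos: "l\<^sub>f > 0" and Lg_pos: "L\<^sub>g > 0"
    and h: "closed_convex_proper h"
    and bounded_below: "(INF x. objective f g h x) > - \<infinity>"
    and M: "M > 5 * l\<^sub>f * L\<^sub>g"
begin

definition lin :: "real^'n \<Rightarrow> real^'n \<Rightarrow> real" where
  "lin x y = f (g x + g' x *v (y - x))"

definition prox :: "real^'n \<Rightarrow> real^'n" where
  "prox x = arg_min (prox_model f h M (g x) (g' x) x) (\<lambda>_. True)"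

text \<open>\<open>real_of_ereal\<close> would send infinite values to 0, but
  \<open>bounded_below\<close> excludes one of them and a point with finite \<open>h\<close> the
  other, so this is the true infimum.\<close>

definition inf_value :: real where
  "inf_value = real_of_ereal (INF x. objective f g h x)"

text \<open>If \<open>h x\<close> is finite, the objective value at \<open>x\<close> is an admissible \<open>\<phi>\<close>. The weaker condition
  keeps the descent argument valid at a starting point where \<open>h\<close> is infinite.\<close>

definition level :: "real^'n \<Rightarrow> real \<Rightarrow> bool" where
  "level x \<phi> \<longleftrightarrow> (\<exists>r. h (prox x) = ereal r \<and> lin x (prox x) + r + M * (norm (x - prox x))\<^sup>2 \<le> \<phi>)"

lemma M_pos: "M > 0"
  using M lf_pos Lg_pos by (smt (verit) mult_pos_pos)

lemma f_diff_le: "\<bar>f u - f v\<bar> \<le> l\<^sub>f * norm (u - v)"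
  using lipschitz_onD[OF f_lipschitz, of u v] by (simp add: dist_norm)

lemma inf_value_le:
  assumes "h y = ereal r"
  shows "inf_value \<le> f (g y) + r"
proof -
  have "(INF x. objective f g h x) \<le> ereal (f (g y) + r)"
    using INF_lower[of y UNIV "objective f g h"] assms by (simp add: objective_def)
  with bounded_below show ?thesis
    unfolding inf_value_def by (cases "INF x. objective f g h x") auto
qed

lemma lin_error: "\<bar>f (g y) - lin x y\<bar> \<le> l\<^sub>f * L\<^sub>g * (norm (y - x))\<^sup>2"
proof -
  have "\<bar>f (g y) - lin x y\<bar> \<le> l\<^sub>f * norm (g y - (g x + g' x *v (y - x)))"
    unfolding lin_def by (rule f_diff_le)
  also have "g y - (g x + g' x *v (y - x)) = g y - g x - g' x *v (y - x)" by simp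
  also have "l\<^sub>f * norm \<dots> \<le> l\<^sub>f * (L\<^sub>g * (norm (y - x))\<^sup>2)"
    using lf_pos lipschitz_jacobian_Taylor[OF g_deriv g_smooth] by simp
  finally show ?thesis by (simp add: mult.assoc)
qed

lemma estimate_error:
  "\<bar>f (G + J *v (y - x)) - lin x y\<bar> \<le> l\<^sub>f * (norm (G - g x) + opnorm (J - g' x) * norm (y - x))"
proof -
  have "\<bar>f (G + J *v (y - x)) - lin x y\<bar> \<le> l\<^sub>f * norm (G + J *v (y - x) - (g x + g' x *v (y - x)))"
    unfolding lin_def by (rule f_diff_le)
  also have "G + J *v (y - x) - (g x + g' x *v (y - x)) = (G - g x) + (J - g' x) *v (y - x)"
    by (simp add: matrix_vector_mult_diff_rdistrib)
  also have "norm \<dots> \<le> norm (G - g x) + opnorm (J - g' x) * norm (y - x)"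
    by (intro order_trans[OF norm_triangle_ineq] add_left_mono norm_matrix_vector_le_opnorm)
  finally show ?thesis using lf_pos by simp
qed

lemma convex_lin: "convex_on UNIV (lin x)"
proof (rule convex_onI)
  fix t :: real and y z :: "real^'n" assume t: "0 < t" "t < 1"
  have "g x + g' x *v ((1 - t) *\<^sub>R y + t *\<^sub>R z - x) =
      (1 - t) *\<^sub>R (g x + g' x *v (y - x)) + t *\<^sub>R (g x + g' x *v (z - x))"
    by (simp add: matrix_vector_mult_diff_distrib matrix_vector_right_distrib
        matrix_vector_mult_scaleR algebra_simps)
  then show "lin x ((1 - t) *\<^sub>R y + t *\<^sub>R z) \<le> (1 - t) * lin x y + t * lin x z"
    unfolding lin_def using convex_onD[OF f_convex, of t] t by simp
qed simp

lemma prox_model_eq: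
  "prox_model f h M (g x) (g' x) x y = ereal (lin x y + M / 2 * (norm (y - x))\<^sup>2) + h y"
  unfolding prox_model_def lin_def by (cases "h y") (auto simp: ac_simps)

lemma continuous_on_lin: "continuous_on UNIV (lin x)"
  using convex_lin by (intro convex_on_continuous) auto

lemma prox_minimises:
  "prox_model f h M (g x) (g' x) x (prox x) \<le> prox_model f h M (g x) (g' x) x y"
proof -
  have "\<exists>p. \<forall>y. ereal (lin x p + M / 2 * (norm (p - x))\<^sup>2) + h p
      \<le> ereal (lin x y + M / 2 * (norm (y - x))\<^sup>2) + h y"
  \<comment> \<open>The model of the objective differs from the objective by at most
    \<open>l\<^sub>f * L\<^sub>g\<close> times the squared distance, and the objective is at least
    \<open>inf_value\<close>. Coercivity thus needs only that \<open>M / 2\<close> exceeds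
    \<open>l\<^sub>f * L\<^sub>g\<close>.\<close>
  proof (rule exists_minimiser[OF h, where \<kappa> = "M / 2 - l\<^sub>f * L\<^sub>g" and b = 0 and a = "- inf_value" and x = x])
    show "continuous_on UNIV (\<lambda>y. lin x y + M / 2 * (norm (y - x))\<^sup>2)"
      by (intro continuous_intros continuous_on_lin)
    show "M / 2 - l\<^sub>f * L\<^sub>g > 0" using M mult_pos_pos[OF lf_pos Lg_pos] by (simp add: mult.assoc)
    show "(M / 2 - l\<^sub>f * L\<^sub>g) * (norm (y - x))\<^sup>2 - 0 * norm (y - x) - - inf_value
        \<le> lin x y + M / 2 * (norm (y - x))\<^sup>2 + r" if "h y = ereal r" for y r
      using lin_error[of y x] inf_value_le[OF that] by (simp add: algebra_simps)
  qed
  then obtain p where "\<And>y. prox_model f h M (g x) (g' x) x p \<le> prox_model f h M (g x) (g' x) x y"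
    by (auto simp: prox_model_eq)
  then have "is_arg_min (prox_model f h M (g x) (g' x) x) (\<lambda>_. True) p"
    by (auto simp: is_arg_min_linorder)
  then have "is_arg_min (prox_model f h M (g x) (g' x) x) (\<lambda>_. True) (prox x)"
    unfolding prox_def arg_min_def by (rule someI)
  then show ?thesis by (simp add: is_arg_min_linorder)
qed

lemma h_prox_finite: obtains r where "h (prox x) = ereal r"
proof -
  obtain y where y: "h y \<noteq> \<infinity>" using h by (auto simp: closed_convex_proper_def)
  then have "h (prox x) \<noteq> \<infinity>" using prox_minimises[of x y] by (auto simp: prox_model_eq)
  then show ?thesis using that closed_convex_proper_finite[OF h] by blast
qed

lemma prox_strong:
  assumes "h (prox x) = ereal r" "h y \<le> ereal s"
  shows "lin x (prox x) + M / 2 * (norm (prox x - x))\<^sup>2 + r + M / 2 * (norm (y - prox x))\<^sup>2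
    \<le> lin x y + M / 2 * (norm (y - x))\<^sup>2 + s"
  by (rule prox_minimiser_strong[OF h convex_lin _ assms])
     (use prox_minimises[of x] in \<open>simp add: prox_model_eq\<close>)

lemma level_exists: "\<exists>\<phi>. level x \<phi>"
  using h_prox_finite[of x] unfolding level_def by (metis order_refl)

text \<open>Quadratic growth at \<open>y = x\<close>, where the model equals the objective. The
  regulariser and the growth term contribute \<open>M / 2\<close> each, which is the factor
  \<open>M\<close> in \<open>level\<close>.\<close>

lemma level_of_objective:
  assumes "h x = ereal r"
  shows "level x (f (g x) + r)"
proof -
  obtain s where s: "h (prox x) = ereal s" by (rule h_prox_finite)
  have "lin x x = f (g x)" by (simp add: lin_def)
  with prox_strong[OF s, of x r] assms s show ?thesis
    unfolding level_def by (auto simp: norm_minus_commute)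
qed

lemma level_mono: "level x \<phi> \<Longrightarrow> \<phi> \<le> \<psi> \<Longrightarrow> level x \<psi>"
  unfolding level_def by force

text \<open>The objective at \<open>prox x\<close> exceeds its linearisation by at most
  \<open>l\<^sub>f * L\<^sub>g\<close> times the squared distance, which the \<open>M\<close> term
  of \<open>level\<close> covers.\<close>

lemma inf_value_le_level:
  assumes "level x \<phi>"
  shows "inf_value \<le> \<phi>"
proof -
  obtain r where r: "h (prox x) = ereal r" "lin x (prox x) + r + M * (norm (x - prox x))\<^sup>2 \<le> \<phi>"
    using assms by (auto simp: level_def)
  have "l\<^sub>f * L\<^sub>g \<le> M" using M mult_pos_pos[OF lf_pos Lg_pos] by (simp add: mult.assoc)
  then have "l\<^sub>f * L\<^sub>g * (norm (x - prox x))\<^sup>2 \<le> M * (norm (x - prox x))\<^sup>2" by (rule mult_right_mono) simp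
  then show ?thesis
    using inf_value_le[OF r(1)] lin_error[of "prox x" x] r(2) by (simp add: norm_minus_commute)
qed

text \<open>The approximate minimiser \<open>x'\<close> of the inexact model is compared with the
  exact proximal point \<open>prox x\<close>, with the estimation error paid once at each of the two
  points. The result holds for the objective at \<open>x'\<close> and is then weakened to
  \<open>level\<close>.\<close>

lemma descent_step:
  assumes level: "level x \<phi>"
    and near: "prox_model f h M G J x x' \<le> (INF y. prox_model f h M G J x y) + ereal e"
    and G: "norm (G - g x) \<le> e\<^sub>g" and J: "opnorm (J - g' x) \<le> e\<^sub>J"
  shows "level x' (\<phi> - M / 4 * (norm (x - prox x))\<^sup>2 - M / 4 * (norm (x' - x))\<^sup>2
    + 2 * l\<^sub>f * e\<^sub>g + 6 * l\<^sub>f\<^sup>2 * e\<^sub>J\<^sup>2 / M + e)"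
proof -
  obtain r where r: "h (prox x) = ereal r" "lin x (prox x) + r + M * (norm (x - prox x))\<^sup>2 \<le> \<phi>"
    using level by (auto simp: level_def)
  define p where "p = norm (x - prox x)"
  define d where "d = norm (x' - x)"
  define fp where "fp = f (G + J *v (prox x - x))"
  define fx where "fx = f (G + J *v (x' - x))"
  have "prox_model f h M G J x x' \<le> prox_model f h M G J x (prox x) + ereal e"
    using near INF_lower[of "prox x" UNIV "prox_model f h M G J x"] by (metis UNIV_I add_right_mono order_trans)
  then have le: "ereal fx + h x' + ereal (M / 2 * d\<^sup>2) \<le> ereal (fp + r + M / 2 * p\<^sup>2 + e)"
    by (simp add: prox_model_def r fp_def fx_def p_def d_def norm_minus_commute)
  then have "h x' \<noteq> \<infinity>" by auto
  then obtain r' where r': "h x' = ereal r'" using closed_convex_proper_finite[OF h] by blast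
  have 1: "fx + r' + M / 2 * d\<^sup>2 \<le> fp + r + M / 2 * p\<^sup>2 + e" using le r' by simp
  have pd: "0 \<le> p" "0 \<le> d" by (auto simp: p_def d_def)
  have "l\<^sub>f * (norm (G - g x) + opnorm (J - g' x) * s) \<le> l\<^sub>f * (e\<^sub>g + e\<^sub>J * s)" if "s \<ge> 0" for s
    using lf_pos G J that by (intro mult_left_mono add_mono mult_right_mono) auto
  then have 2: "fp \<le> lin x (prox x) + l\<^sub>f * (e\<^sub>g + e\<^sub>J * p)" "lin x x' \<le> fx + l\<^sub>f * (e\<^sub>g + e\<^sub>J * d)"
    using estimate_error[of G J "prox x" x] estimate_error[of G J x' x] pd
    unfolding fp_def fx_def p_def d_def norm_minus_commute[of x "prox x"] by (smt (verit) norm_ge_zero)+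
  have 3: "f (g x') \<le> lin x x' + l\<^sub>f * L\<^sub>g * d\<^sup>2" using lin_error[of x' x] by (simp add: d_def)
  \<comment> \<open>Of the coefficient \<open>M / 2\<close> of \<open>d^2\<close>, linearisation
    takes \<open>M / 5\<close> and Young's inequality \<open>M / 20\<close>, which leaves
    \<open>M / 4\<close>. For \<open>p^2\<close> the surplus \<open>M - M / 2\<close> loses
    \<open>M / 4\<close>. The two Young remainders have factors \<open>1 / M\<close> and
    \<open>5 / M\<close>, hence the 6.\<close>
  have 4: "l\<^sub>f * L\<^sub>g * d\<^sup>2 \<le> M / 5 * d\<^sup>2" using M by (intro mult_right_mono) auto
  have 5: "(l\<^sub>f * e\<^sub>J) * p \<le> M / 4 * p\<^sup>2 + (l\<^sub>f * e\<^sub>J)\<^sup>2 / (4 * (M / 4))"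
    using M_pos by (intro young_ineq) simp
  have 6: "(l\<^sub>f * e\<^sub>J) * d \<le> M / 20 * d\<^sup>2 + (l\<^sub>f * e\<^sub>J)\<^sup>2 / (4 * (M / 20))"
    using M_pos by (intro young_ineq) simp
  have 7: "(l\<^sub>f * e\<^sub>J)\<^sup>2 / (4 * (M / 4)) + (l\<^sub>f * e\<^sub>J)\<^sup>2 / (4 * (M / 20)) = 6 * l\<^sub>f\<^sup>2 * e\<^sub>J\<^sup>2 / M"
    using M_pos by (simp add: field_simps)
  have "f (g x') + r' \<le> \<phi> - M / 4 * p\<^sup>2 - M / 4 * d\<^sup>2 + 2 * l\<^sub>f * e\<^sub>g + 6 * l\<^sub>f\<^sup>2 * e\<^sub>J\<^sup>2 / M + e"
    using 1 2 3 4 5 6 7 r(2) unfolding p_def[symmetric] by (simp add: algebra_simps)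
  then show ?thesis
    using level_mono[OF level_of_objective[OF r']] by (simp add: p_def d_def)
qed

section \<open>Continuity of the proximal map\<close>

text \<open>Changing the base point produces a Taylor remainder and a difference of Jacobians.
  Within distance 1 the quadratic remainder is bounded by a linear term.\<close>

lemma lin_stability:
  assumes "norm (z - x) \<le> 1"
  shows "\<bar>lin x y - lin z y\<bar> \<le> l\<^sub>f * L\<^sub>g * (norm (z - x) * (1 + norm (y - x)))"
proof -
  let ?\<delta> = "norm (z - x)"
  have "\<bar>lin x y - lin z y\<bar> \<le> l\<^sub>f * norm (g x + g' x *v (y - x) - (g z + g' z *v (y - z)))"
    unfolding lin_def by (rule f_diff_le)
  also have "g x + g' x *v (y - x) - (g z + g' z *v (y - z))
      = (g x - g z - g' z *v (x - z)) + (g' x - g' z) *v (y - x)"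
    by (simp add: matrix_vector_mult_diff_rdistrib matrix_vector_mult_diff_distrib)
  also have "norm \<dots> \<le> L\<^sub>g * (norm (x - z))\<^sup>2 + L\<^sub>g * norm (x - z) * norm (y - x)"
    by (intro order_trans[OF norm_triangle_ineq] add_mono lipschitz_jacobian_Taylor[OF g_deriv g_smooth]
        order_trans[OF norm_matrix_vector_le_opnorm] mult_right_mono g_smooth) simp
  also have "\<dots> = L\<^sub>g * (?\<delta> * (?\<delta> + norm (y - x)))"
    by (simp add: norm_minus_commute[of x z] power2_eq_square algebra_simps)
  also have "\<dots> \<le> L\<^sub>g * (?\<delta> * (1 + norm (y - x)))"
    using assms Lg_pos by (intro mult_left_mono add_right_mono) auto
  finally show ?thesis using lf_pos by (simp add: mult.assoc)
qed

text \<open>Quadratic growth is applied at both minimisers, each tested against the other, and the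
  two inequalities are added. This gives a local Hoelder bound with exponent 1/2, which is enough
  for continuity.\<close>

lemma prox_stability:
  "\<exists>b. \<forall>z. norm (z - x) \<le> 1 \<longrightarrow> (norm (prox z - prox x))\<^sup>2 \<le> b * norm (z - x)"
proof (intro exI allI impI)
  fix z assume z: "norm (z - x) \<le> 1"
  define \<delta> where "\<delta> = norm (z - x)"
  define s where "s = norm (prox z - prox x)"
  define w where "w = norm (prox x - x)"
  define L where "L = l\<^sub>f * L\<^sub>g"
  have L: "L > 0" using lf_pos Lg_pos by (simp add: L_def)
  obtain r where r: "h (prox x) = ereal r" by (rule h_prox_finite)
  obtain r' where r': "h (prox z) = ereal r'" by (rule h_prox_finite)
  have 1: "lin x (prox x) + M / 2 * (norm (prox x - x))\<^sup>2 + r + M / 2 * s\<^sup>2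
      \<le> lin x (prox z) + M / 2 * (norm (prox z - x))\<^sup>2 + r'"
    unfolding s_def by (rule prox_strong[OF r]) (simp add: r')
  have 2: "lin z (prox z) + M / 2 * (norm (prox z - z))\<^sup>2 + r' + M / 2 * s\<^sup>2
      \<le> lin z (prox x) + M / 2 * (norm (prox x - z))\<^sup>2 + r"
    unfolding s_def norm_minus_commute[of "prox z" "prox x"] by (rule prox_strong[OF r']) (simp add: r)
  \<comment> \<open>In this combination of the four regularisers all squares cancel, so that only a
    term linear in \<open>\<delta>\<close> remains.\<close>
  have "(norm (prox z - x))\<^sup>2 - (norm (prox x - x))\<^sup>2 + (norm (prox x - z))\<^sup>2 - (norm (prox z - z))\<^sup>2
      = 2 * inner (prox z - prox x) (z - x)"
    unfolding power2_norm_eq_inner by (simp add: inner_simps inner_commute)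
  also have "\<dots> \<le> 2 * (s * \<delta>)"
    unfolding s_def \<delta>_def using norm_cauchy_schwarz by simp
  finally have 3: "M / 2 * ((norm (prox z - x))\<^sup>2 - (norm (prox x - x))\<^sup>2 + (norm (prox x - z))\<^sup>2 - (norm (prox z - z))\<^sup>2)
      \<le> M / 2 * (2 * (s * \<delta>))"
    using M_pos by (intro mult_left_mono) auto
  have "norm (prox z - x) \<le> s + w"
    unfolding s_def w_def by (metis norm_triangle_ineq diff_add_cancel add_diff_eq)
  then have "L * (\<delta> * (1 + norm (prox z - x))) \<le> L * (\<delta> * (1 + (s + w)))"
    using L by (intro mult_left_mono) (auto simp: \<delta>_def)
  with lin_stability[OF z, of "prox z"] have 4: "lin x (prox z) - lin z (prox z) \<le> L * (\<delta> * (1 + (s + w)))"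
    by (simp add: L_def \<delta>_def)
  have 5: "lin z (prox x) - lin x (prox x) \<le> L * (\<delta> * (1 + w))"
    using lin_stability[OF z, of "prox x"] by (simp add: L_def \<delta>_def w_def)
  have "M * s\<^sup>2 \<le> ((L + M) * \<delta>) * s + L * (\<delta> * (2 + 2 * w))"
    using 1 2 3 4 5 by (simp add: algebra_simps)
  \<comment> \<open>The unknown \<open>s\<close> also occurs on the right, because the distance from
    \<open>prox z\<close> to \<open>x\<close> is estimated by \<open>s + w\<close>; Young's
    inequality returns half of \<open>M * s^2\<close> to the left.\<close>
  also have "((L + M) * \<delta>) * s \<le> M / 2 * s\<^sup>2 + ((L + M) * \<delta>)\<^sup>2 / (4 * (M / 2))"
    using M_pos by (intro young_ineq) simp
  also have "((L + M) * \<delta>)\<^sup>2 / (4 * (M / 2)) \<le> (L + M)\<^sup>2 / (2 * M) * \<delta>"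
  proof -
    have "\<delta>\<^sup>2 \<le> \<delta>" using z by (simp add: \<delta>_def power2_eq_square mult_left_le)
    then have "(L + M)\<^sup>2 / (2 * M) * \<delta>\<^sup>2 \<le> (L + M)\<^sup>2 / (2 * M) * \<delta>"
      using M_pos by (intro mult_left_mono) auto
    then show ?thesis by (simp add: power_mult_distrib)
  qed
  finally have "M / 2 * s\<^sup>2 \<le> ((L + M)\<^sup>2 / (2 * M) + L * (2 + 2 * w)) * \<delta>"
    by (simp add: algebra_simps)
  then have "2 / M * (M / 2 * s\<^sup>2) \<le> 2 / M * (((L + M)\<^sup>2 / (2 * M) + L * (2 + 2 * w)) * \<delta>)"
    using M_pos by (intro mult_left_mono) auto
  moreover have "2 / M * (M / 2 * s\<^sup>2) = s\<^sup>2" using M_pos by simp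
  ultimately have "s\<^sup>2 \<le> (2 / M * ((L + M)\<^sup>2 / (2 * M) + L * (2 + 2 * w))) * \<delta>"
    by (simp only: mult.assoc)
  then show "(norm (prox z - prox x))\<^sup>2 \<le>
      (2 / M * ((l\<^sub>f * L\<^sub>g + M)\<^sup>2 / (2 * M) + l\<^sub>f * L\<^sub>g * (2 + 2 * norm (prox x - x)))) * norm (z - x)"
    by (simp only: s_def \<delta>_def w_def L_def)
qed

text \<open>Serves measurability: it makes the stationarity measure a Borel function of the
  iterate.\<close>

lemma continuous_on_prox: "continuous_on UNIV prox"
proof (intro continuous_at_imp_continuous_on ballI)
  fix x
  obtain b where b: "\<And>z. norm (z - x) \<le> 1 \<Longrightarrow> (norm (prox z - prox x))\<^sup>2 \<le> b * norm (z - x)"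
    using prox_stability by blast
  have "(prox \<longlongrightarrow> prox x) (at x)"
  proof (rule Lim_null[THEN iffD2], rule Lim_null_comparison)
    show "\<forall>\<^sub>F z in at x. norm (prox z - prox x) \<le> sqrt (b * norm (z - x))"
      unfolding eventually_at
      by (rule exI[of _ 1]) (auto simp: dist_norm intro!: real_le_rsqrt b)
    have "((\<lambda>z. sqrt (b * norm (z - x))) \<longlongrightarrow> sqrt (b * norm (x - x))) (at x)"
      by (intro tendsto_intros)
    then show "((\<lambda>z. sqrt (b * norm (z - x))) \<longlongrightarrow> 0) (at x)" by simp
  qed
  then show "isCont prox x" by (simp add: isCont_def)
qed

lemma grad_map_eq: "grad_map f g g' h M x = M *\<^sub>R (x - prox x)"
  by (simp add: grad_map_def prox_def)

lemma borel_measurable_grad_map [measurable]: "grad_map f g g' h M \<in> borel_measurable borel"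
  unfolding grad_map_eq[abs_def]
  by (intro borel_measurable_continuous_onI continuous_intros continuous_on_prox)

section \<open>Descent over an inner loop and over the whole run\<close>

text \<open>The error scales are such that everything becomes quadratic in
  \<open>sqrt \<epsilon>\<close> and \<open>t = D i / \<tau>\<close>: after Young's inequality each
  term is a multiple of \<open>\<epsilon>\<close> or of \<open>t^2\<close>. Assumption
  \<open>small\<close> keeps the total coefficient of \<open>t^2\<close> at \<open>M / 4\<close>,
  exactly what the squared steps can pay for.\<close>

lemma inner_loop_descent:
  fixes x :: "nat \<Rightarrow> real^'n"
  defines "D \<equiv> \<lambda>i. norm (x i - x 0)"
  assumes level: "level (x 0) \<phi>"
    and near: "\<And>i. i < \<tau> \<Longrightarrow> prox_model f h M (G i) (J i) (x i) (x (Suc i))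
        \<le> (INF y. prox_model f h M (G i) (J i) (x i) y) + ereal e"
    and G: "\<And>i. i < \<tau> \<Longrightarrow> norm (G i - g (x i)) \<le> \<alpha> * \<epsilon> + \<beta> * sqrt \<epsilon> / \<tau> * D i + \<gamma> * (D i)\<^sup>2 / (real \<tau>)\<^sup>2"
    and J: "\<And>i. i < \<tau> \<Longrightarrow> opnorm (J i - g' (x i)) \<le> \<beta> * sqrt \<epsilon> / \<tau> + \<eta> * D i / \<tau>"
    and nonneg: "\<epsilon> \<ge> 0" "\<beta> \<ge> 0"
    and small: "l\<^sub>f * \<beta> + 2 * l\<^sub>f * \<gamma> + 12 * l\<^sub>f\<^sup>2 * \<eta>\<^sup>2 / M \<le> M / 4"
  shows "level (x \<tau>) (\<phi> - M / 4 * (\<Sum>i<\<tau>. (norm (x i - prox (x i)))\<^sup>2)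
    + \<tau> * ((2 * l\<^sub>f * \<alpha> + l\<^sub>f * \<beta> + 12 * l\<^sub>f\<^sup>2 * \<beta>\<^sup>2 / M) * \<epsilon> + e))"
proof (cases "\<tau> = 0")
  case False
  define p where "p i = norm (x i - prox (x i))" for i
  define d where "d i = norm (x (Suc i) - x i)" for i
  define c where "c = (2 * l\<^sub>f * \<alpha> + l\<^sub>f * \<beta> + 12 * l\<^sub>f\<^sup>2 * \<beta>\<^sup>2 / M) * \<epsilon> + e"
  have \<tau>: "real \<tau> \<ge> 1" using False by linarith
  have step: "level (x (Suc i)) (\<psi> - M / 4 * (p i)\<^sup>2 - M / 4 * (d i)\<^sup>2 + c + M / 4 * ((D i)\<^sup>2 / (real \<tau>)\<^sup>2))"
    if i: "i < \<tau>" and \<psi>: "level (x i) \<psi>" for i \<psi>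
  proof (rule level_mono[OF descent_step[OF \<psi> near[OF i] G[OF i] J[OF i]]])
    define t where "t = D i / \<tau>"
    have t: "t \<ge> 0" using \<tau> by (simp add: t_def D_def)
    define s where "s = sqrt \<epsilon>"
    have s: "s\<^sup>2 = \<epsilon>" "s \<ge> 0" using nonneg by (auto simp: s_def)
    have "2 * (s * t) \<le> s\<^sup>2 + t\<^sup>2" by (rule order_trans[OF _ sum_squares_bound]) simp
    then have 1: "l\<^sub>f * \<beta> * (2 * (s * t)) \<le> l\<^sub>f * \<beta> * (\<epsilon> + t\<^sup>2)"
      unfolding s using lf_pos nonneg by (intro mult_left_mono) auto
    have "s / \<tau> \<le> s" using \<tau> s by (simp add: divide_le_eq mult_le_cancel_left1)
    then have "\<beta> * (s / \<tau>) \<le> \<beta> * s" using nonneg by (intro mult_left_mono)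
    moreover have "0 \<le> \<beta> * (s / \<tau>)" using nonneg s \<tau> by simp
    ultimately have "(\<beta> * (s / \<tau>))\<^sup>2 \<le> (\<beta> * s)\<^sup>2" by (rule power_mono)
    moreover have "(\<beta> * (s / \<tau>) + \<eta> * t)\<^sup>2 \<le> 2 * (\<beta> * (s / \<tau>))\<^sup>2 + 2 * (\<eta> * t)\<^sup>2"
      using sum_squares_bound[of "\<beta> * (s / \<tau>)" "\<eta> * t"] by (simp add: power2_sum)
    ultimately have "(\<beta> * (s / \<tau>) + \<eta> * t)\<^sup>2 \<le> 2 * \<beta>\<^sup>2 * \<epsilon> + 2 * \<eta>\<^sup>2 * t\<^sup>2"
      unfolding power_mult_distrib s by simp
    moreover define X where "X = (\<beta> * (s / \<tau>) + \<eta> * t)\<^sup>2"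
    moreover define W where "W = l\<^sub>f\<^sup>2 / M"
    ultimately have 2: "6 * W * X \<le> 6 * W * (2 * \<beta>\<^sup>2 * \<epsilon> + 2 * \<eta>\<^sup>2 * t\<^sup>2)"
      using M_pos by (intro mult_left_mono) auto
    have "(l\<^sub>f * \<beta> + 2 * l\<^sub>f * \<gamma> + 12 * W * \<eta>\<^sup>2) * t\<^sup>2 \<le> M / 4 * t\<^sup>2"
      using small by (intro mult_right_mono) (auto simp: W_def)
    with 1 2 have "2 * l\<^sub>f * (\<alpha> * \<epsilon> + \<beta> * s * t + \<gamma> * t\<^sup>2) + 6 * W * X
        \<le> (2 * l\<^sub>f * \<alpha> + l\<^sub>f * \<beta> + 12 * W * \<beta>\<^sup>2) * \<epsilon> + M / 4 * t\<^sup>2"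
      by (simp add: algebra_simps)
    then have 3: "2 * l\<^sub>f * (\<alpha> * \<epsilon> + \<beta> * s * t + \<gamma> * t\<^sup>2) + 6 * l\<^sub>f\<^sup>2 * (\<beta> * (s / \<tau>) + \<eta> * t)\<^sup>2 / M
        \<le> (2 * l\<^sub>f * \<alpha> + l\<^sub>f * \<beta> + 12 * l\<^sub>f\<^sup>2 * \<beta>\<^sup>2 / M) * \<epsilon> + M / 4 * t\<^sup>2"
      by (simp add: X_def W_def)
    have eqs: "\<alpha> * \<epsilon> + \<beta> * sqrt \<epsilon> / \<tau> * D i + \<gamma> * (D i)\<^sup>2 / (real \<tau>)\<^sup>2 = \<alpha> * \<epsilon> + \<beta> * s * t + \<gamma> * t\<^sup>2"
      "\<beta> * sqrt \<epsilon> / \<tau> + \<eta> * D i / \<tau> = \<beta> * (s / \<tau>) + \<eta> * t" "(D i)\<^sup>2 / (real \<tau>)\<^sup>2 = t\<^sup>2"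
      by (auto simp: s_def t_def power_divide)
    show "\<psi> - M / 4 * (norm (x i - prox (x i)))\<^sup>2 - M / 4 * (norm (x (Suc i) - x i))\<^sup>2
        + 2 * l\<^sub>f * (\<alpha> * \<epsilon> + \<beta> * sqrt \<epsilon> / \<tau> * D i + \<gamma> * (D i)\<^sup>2 / (real \<tau>)\<^sup>2)
        + 6 * l\<^sub>f\<^sup>2 * (\<beta> * sqrt \<epsilon> / \<tau> + \<eta> * D i / \<tau>)\<^sup>2 / M + e
        \<le> \<psi> - M / 4 * (p i)\<^sup>2 - M / 4 * (d i)\<^sup>2 + c + M / 4 * ((D i)\<^sup>2 / (real \<tau>)\<^sup>2)"
      unfolding eqs using 3 by (simp add: p_def d_def c_def)
  qed
  have "level (x n) (\<phi> - (\<Sum>i<n. M / 4 * (p i)\<^sup>2 + M / 4 * (d i)\<^sup>2 - c - M / 4 * ((D i)\<^sup>2 / (real \<tau>)\<^sup>2)))"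
    if "n \<le> \<tau>" for n
    using that
  proof (induction n)
    case (Suc n)
    from step[OF _ Suc.IH] Suc.prems show ?case by (simp add: algebra_simps)
  qed (use level in simp)
  from this[of \<tau>] have lev: "level (x \<tau>) (\<phi> - (\<Sum>i<\<tau>. M / 4 * (p i)\<^sup>2 + M / 4 * (d i)\<^sup>2 - c - M / 4 * ((D i)\<^sup>2 / (real \<tau>)\<^sup>2)))"
    by simp
  have D: "(D i)\<^sup>2 \<le> \<tau> * (\<Sum>j<\<tau>. (d j)\<^sup>2)" if "i < \<tau>" for i
  proof -
    have "D i = norm (\<Sum>j<i. x (Suc j) - x j)" unfolding D_def by (subst sum_lessThan_telescope) simp
    also have "\<dots> \<le> (\<Sum>j<i. d j)" unfolding d_def by (rule norm_sum)
    also have "\<dots> \<le> (\<Sum>j<\<tau>. d j)" using that by (intro sum_mono2) (auto simp: d_def)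
    finally have "(D i)\<^sup>2 \<le> (\<Sum>j<\<tau>. d j)\<^sup>2" by (intro power_mono) (auto simp: D_def)
    also have "\<dots> \<le> real (card {..<\<tau>}) * (\<Sum>j<\<tau>. (d j)\<^sup>2)"
      using Cauchy_Schwarz_ineq_sum[of "\<lambda>_. 1" d "{..<\<tau>}"] by simp
    finally show ?thesis by simp
  qed
  have "(\<Sum>i<\<tau>. (D i)\<^sup>2 / (real \<tau>)\<^sup>2) \<le> (\<Sum>i<\<tau>. \<tau> * (\<Sum>j<\<tau>. (d j)\<^sup>2) / (real \<tau>)\<^sup>2)"
    using \<tau> by (intro sum_mono divide_right_mono D) auto
  also have "\<dots> = (\<Sum>j<\<tau>. (d j)\<^sup>2)" using \<tau> by (simp add: power2_eq_square)
  finally have "M / 4 * (\<Sum>i<\<tau>. (D i)\<^sup>2 / (real \<tau>)\<^sup>2) \<le> M / 4 * (\<Sum>j<\<tau>. (d j)\<^sup>2)"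
    using M_pos by (intro mult_left_mono) auto
  moreover have "(\<Sum>i<\<tau>. M / 4 * (p i)\<^sup>2 + M / 4 * (d i)\<^sup>2 - c - M / 4 * ((D i)\<^sup>2 / (real \<tau>)\<^sup>2))
      = M / 4 * (\<Sum>i<\<tau>. (p i)\<^sup>2) + M / 4 * (\<Sum>i<\<tau>. (d i)\<^sup>2) - \<tau> * c
        - M / 4 * (\<Sum>i<\<tau>. (D i)\<^sup>2 / (real \<tau>)\<^sup>2)"
    by (simp only: sum.distrib sum_subtractf sum_distrib_left sum_constant card_lessThan)
  ultimately have "\<phi> - (\<Sum>i<\<tau>. M / 4 * (p i)\<^sup>2 + M / 4 * (d i)\<^sup>2 - c - M / 4 * ((D i)\<^sup>2 / (real \<tau>)\<^sup>2))
      \<le> \<phi> - M / 4 * (\<Sum>i<\<tau>. (p i)\<^sup>2) + \<tau> * c"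
    by linarith
  with level_mono[OF lev] show ?thesis unfolding p_def c_def by blast
qed (use level in simp)

text \<open>Telescoping \<open>level\<close> down to \<open>inf_value\<close>. After multiplication
  by \<open>4 * M\<close>, the errors cost \<open>\<epsilon> / 2 + 4 * \<epsilon> / 150\<close> per
  iteration, at most three quarters of \<open>\<epsilon>\<close>. The initial gap may use the
  remaining quarter, which is the origin of the 16 in the lower bound for \<open>C\<close>.\<close>

lemma average_grad_map_bound:
  fixes x :: "nat \<Rightarrow> nat \<Rightarrow> real^'n" and K \<tau> :: nat
  assumes level: "level (x 0 0) \<phi>"
    and link: "\<And>k. x (Suc k) 0 = x k \<tau>"
    and near: "\<And>k i. k < K \<Longrightarrow> i < \<tau> \<Longrightarrow> prox_model f h M (G k i) (J k i) (x k i) (x k (Suc i))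
        \<le> (INF y. prox_model f h M (G k i) (J k i) (x k i) y) + ereal (\<epsilon> / (5 * 30 * M))"
    and G: "\<And>k i. k < K \<Longrightarrow> i < \<tau> \<Longrightarrow> norm (G k i - g (x k i)) \<le> \<alpha> * \<epsilon>
        + \<beta> * sqrt \<epsilon> / \<tau> * norm (x k i - x k 0) + \<gamma> * (norm (x k i - x k 0))\<^sup>2 / (real \<tau>)\<^sup>2"
    and J: "\<And>k i. k < K \<Longrightarrow> i < \<tau> \<Longrightarrow> opnorm (J k i - g' (x k i))
        \<le> \<beta> * sqrt \<epsilon> / \<tau> + \<eta> * norm (x k i - x k 0) / \<tau>"
    and nonneg: "\<epsilon> > 0" "\<beta> \<ge> 0"
    and small: "l\<^sub>f * \<beta> + 2 * l\<^sub>f * \<gamma> + 12 * l\<^sub>f\<^sup>2 * \<eta>\<^sup>2 / M \<le> M / 4"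
    and small': "2 * l\<^sub>f * \<alpha> + l\<^sub>f * \<beta> + 12 * l\<^sub>f\<^sup>2 * \<beta>\<^sup>2 / M \<le> 1 / (8 * M)"
    and K\<tau>: "real K * real \<tau> \<ge> C / \<epsilon>" and C: "C \<ge> 16 * M * (\<phi> - inf_value)" "C > 0"
  shows "1 / (real K * real \<tau>) * (\<Sum>k<K. \<Sum>i<\<tau>. (norm (grad_map f g g' h M (x k i)))\<^sup>2) \<le> \<epsilon>"
proof -
  define c where "c = 1 / (8 * M) * \<epsilon> + \<epsilon> / (5 * 30 * M)"
  define S where "S k = (\<Sum>i<\<tau>. (norm (x k i - prox (x k i)))\<^sup>2)" for k
  have "level (x k 0) (\<phi> - M / 4 * (\<Sum>j<k. S j) + k * (\<tau> * c))" if "k \<le> K" for k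
    using that
  proof (induction k)
    case (Suc k)
    from Suc have "level (x k 0) (\<phi> - M / 4 * (\<Sum>j<k. S j) + k * (\<tau> * c))" by simp
    from inner_loop_descent[OF this near G J _ nonneg(2) small] Suc.prems nonneg
    have "level (x k \<tau>) (\<phi> - M / 4 * (\<Sum>j<k. S j) + k * (\<tau> * c) - M / 4 * S k
       + \<tau> * ((2 * l\<^sub>f * \<alpha> + l\<^sub>f * \<beta> + 12 * l\<^sub>f\<^sup>2 * \<beta>\<^sup>2 / M) * \<epsilon> + \<epsilon> / (5 * 30 * M)))"
      by (simp add: S_def)
    moreover have "\<tau> * ((2 * l\<^sub>f * \<alpha> + l\<^sub>f * \<beta> + 12 * l\<^sub>f\<^sup>2 * \<beta>\<^sup>2 / M) * \<epsilon> + \<epsilon> / (5 * 30 * M)) \<le> \<tau> * c"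
      unfolding c_def using nonneg small' by (intro mult_left_mono add_right_mono mult_right_mono) auto
    ultimately show ?case unfolding link by (elim level_mono) (simp add: algebra_simps)
  qed (use level in simp)
  from this[of K] inf_value_le_level have "inf_value \<le> \<phi> - M / 4 * (\<Sum>k<K. S k) + K * (\<tau> * c)" by blast
  then have "(4 * M) * (M / 4 * (\<Sum>k<K. S k)) \<le> (4 * M) * (\<phi> - inf_value + K * (\<tau> * c))"
    using M_pos by (intro mult_left_mono) auto
  then have 1: "M\<^sup>2 * (\<Sum>k<K. S k) \<le> 4 * M * (\<phi> - inf_value) + (K * \<tau>) * (4 * M * c)"
    by (simp add: power2_eq_square algebra_simps)
  have "4 * M * c = \<epsilon> / 2 + 4 * \<epsilon> / 150" using M_pos by (simp add: c_def field_simps)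
  then have 2: "(K * \<tau>) * (4 * M * c) \<le> (K * \<tau>) * (3 / 4 * \<epsilon>)"
    using nonneg by (intro mult_left_mono) auto
  have "C \<le> (K * \<tau>) * \<epsilon>" using K\<tau> nonneg by (simp add: field_simps)
  then have 3: "4 * M * (\<phi> - inf_value) \<le> (K * \<tau>) * (1 / 4 * \<epsilon>)" using C by simp
  have pos: "real K * real \<tau> > 0" using K\<tau> C nonneg by (smt (verit) divide_pos_pos)
  have "(\<Sum>k<K. \<Sum>i<\<tau>. (norm (grad_map f g g' h M (x k i)))\<^sup>2) = M\<^sup>2 * (\<Sum>k<K. S k)"
    unfolding S_def grad_map_eq by (simp add: power_mult_distrib sum_distrib_left)
  also have "\<dots> \<le> (real K * real \<tau>) * \<epsilon>" using 1 2 3 by simp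
  finally show ?thesis using pos by (simp add: field_simps)
qed

end

section \<open>Concentration of batch averages\<close>

context prob_space
begin

text \<open>Forgets the index \<open>None\<close> of the past and renames \<open>Some j\<close> to
  \<open>j\<close>.\<close>

lemma fresh_batch_indep_vars:
  assumes fresh: "fresh_batch M H D N S"
  shows "indep_vars (\<lambda>_. D) S {..<N}"
proof -
  let ?F = "\<lambda>t. case t of None \<Rightarrow> sets H | Some j \<Rightarrow> {S j -` E \<inter> space M | E. E \<in> sets D}"
  have F: "indep_sets ?F (insert None (Some ` {..<N}))" using fresh by (simp add: fresh_batch_def)
  have "indep_sets (\<lambda>j. ?F (Some j)) {..<N}"
  proof (rule indep_setsI)
    show "?F (Some j) \<subseteq> events" if "j \<in> {..<N}" for j
      using F that unfolding indep_sets_def by blast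
    fix A J assume J: "J \<noteq> {}" "J \<subseteq> {..<N}" "finite J" "\<forall>j\<in>J. A j \<in> ?F (Some j)"
    have "prob (\<Inter>t\<in>Some ` J. A (the t)) = (\<Prod>t\<in>Some ` J. prob (A (the t)))"
      by (rule indep_setsD[OF F]) (use J in auto)
    then show "prob (\<Inter>j\<in>J. A j) = (\<Prod>j\<in>J. prob (A j))"
      by (simp add: prod.reindex)
  qed
  then show ?thesis
    using fresh by (simp add: indep_vars_def2 fresh_batch_def)
qed

lemma fresh_batch_AE:
  assumes fresh: "fresh_batch M H D N S" and AE: "AE \<xi> in D. Q \<xi>"
  shows "AE \<omega> in M. \<forall>j<N. Q (S j \<omega>)"
proof -
  have "AE \<omega> in M. Q (S j \<omega>)" if "j < N" for j
  proof (rule AE_distrD[where f = "S j" and M' = D and P = Q])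
    show "S j \<in> measurable M D" using fresh that by (simp add: fresh_batch_def)
    have "distr M D (S j) = D" using fresh that by (simp add: fresh_batch_def)
    with AE show "AE \<xi> in distr M D (S j). Q \<xi>" by (simp only:)
  qed
  then have "AE \<omega> in M. \<forall>j\<in>{..<N}. Q (S j \<omega>)" by (intro AE_finite_allI) auto
  then show ?thesis by auto
qed

text \<open>Hoeffding's inequality on the range from \<open>-R\<close> to \<open>R\<close>: the
  radius cancels from the exponent. The event is strict because a strict inequality persists under
  small changes of the point, as the transfer to random points requires.\<close>

lemma fresh_batch_average_tail:
  fixes \<phi> :: "'x \<Rightarrow> real"
  assumes fresh: "fresh_batch M H D N S"
    and \<phi> [measurable]: "\<phi> \<in> borel_measurable D" and mean: "(\<integral>\<xi>. \<phi> \<xi> \<partial>D) = 0"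
    and bound: "AE \<xi> in D. \<bar>\<phi> \<xi>\<bar> \<le> R" and R: "R \<ge> 0" and u: "u \<ge> 0" and N: "N > 0"
  shows "prob {\<omega>\<in>space M. R * u < \<bar>1 / real N * (\<Sum>j<N. \<phi> (S j \<omega>))\<bar>} \<le> 2 * exp (- (real N * u\<^sup>2 / 2))"
proof -
  have S [measurable]: "S j \<in> measurable M D" if "j < N" for j
    using fresh that by (simp add: fresh_batch_def)
  have bound': "AE \<omega> in M. \<forall>j<N. \<bar>\<phi> (S j \<omega>)\<bar> \<le> R"
    by (rule fresh_batch_AE[OF fresh bound])
  show ?thesis
  proof (cases "R = 0")
    \<comment> \<open>For \<open>R = 0\<close> the sum of squared ranges, the denominator of
      Hoeffding's exponent, vanishes; the strict event is then a null set.\<close>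
    case True
    have "AE \<omega> in M. \<omega> \<notin> {\<omega>\<in>space M. R * u < \<bar>1 / real N * (\<Sum>j<N. \<phi> (S j \<omega>))\<bar>}"
      using bound' by eventually_elim (simp add: True)
    then have "prob {\<omega>\<in>space M. R * u < \<bar>1 / real N * (\<Sum>j<N. \<phi> (S j \<omega>))\<bar>} = 0"
      by (subst prob_eq_0) auto
    then show ?thesis by simp
  next
    case False
    with R have R: "R > 0" by simp
    have E: "expectation (\<lambda>\<omega>. \<phi> (S j \<omega>)) = 0" if "j < N" for j
    proof -
      have "expectation (\<lambda>\<omega>. \<phi> (S j \<omega>)) = (\<integral>\<xi>. \<phi> \<xi> \<partial>distr M D (S j))"
        using that by (subst integral_distr) auto
      then show ?thesis using fresh that mean by (simp add: fresh_batch_def)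
    qed
    interpret Hoeffding_ineq M "{..<N}" "\<lambda>j \<omega>. \<phi> (S j \<omega>)" "\<lambda>_. - R" "\<lambda>_. R" 0
    proof unfold_locales
      show "indep_vars (\<lambda>_. borel) (\<lambda>j \<omega>. \<phi> (S j \<omega>)) {..<N}"
        by (rule indep_vars_compose2[OF fresh_batch_indep_vars[OF fresh]]) simp
      show "AE \<omega> in M. \<phi> (S j \<omega>) \<in> {- R..R}" if "j \<in> {..<N}" for j
        using bound' by eventually_elim (use that in \<open>auto simp: abs_le_iff\<close>)
      show "(0::real) \<equiv> \<Sum>j<N. expectation (\<lambda>\<omega>. \<phi> (S j \<omega>))"
        by (rule eq_reflection) (simp add: E)
    qed simp
    have "prob {\<omega>\<in>space M. R * u < \<bar>1 / real N * (\<Sum>j<N. \<phi> (S j \<omega>))\<bar>}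
        \<le> prob {\<omega>\<in>space M. \<bar>(\<Sum>j<N. \<phi> (S j \<omega>)) - 0\<bar> \<ge> real N * R * u}"
      by (rule finite_measure_mono) (use N in \<open>auto simp: abs_mult field_simps\<close>)
    also have "\<dots> \<le> 2 * exp (- 2 * (real N * R * u)\<^sup>2 / (\<Sum>j<N. (R - - R)\<^sup>2))"
      by (rule Hoeffding_ineq_abs_ge) (use N R u in auto)
    also have "- 2 * (real N * R * u)\<^sup>2 / (\<Sum>j<N. (R - - R)\<^sup>2) = - (real N * u\<^sup>2 / 2)"
      using N R by (simp add: power2_eq_square field_simps)
    finally show ?thesis .
  qed
qed

text \<open>The index set is split into the past and the samples. The generating families are closed
  under intersection, so independence passes to the sigma-algebras generated by the two
  groups.\<close>

lemma fresh_batch_indep_average: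
  fixes \<phi> :: "'x \<Rightarrow> real"
  assumes fresh: "fresh_batch M H D N S" and \<phi>: "\<phi> \<in> borel_measurable D" and A: "A \<in> sets H"
  shows "prob (A \<inter> {\<omega>\<in>space M. c < \<bar>1 / real N * (\<Sum>j<N. \<phi> (S j \<omega>))\<bar>})
    = prob A * prob {\<omega>\<in>space M. c < \<bar>1 / real N * (\<Sum>j<N. \<phi> (S j \<omega>))\<bar>}" (is "prob (A \<inter> ?B) = _")
proof -
  let ?F = "\<lambda>t. case t of None \<Rightarrow> sets H | Some j \<Rightarrow> {S j -` E \<inter> space M | E. E \<in> sets D}"
  let ?I = "\<lambda>b. if b then {None} else Some ` {..<N}"
  have S: "S j \<in> measurable M D" if "j < N" for j
    using fresh that by (simp add: fresh_batch_def)
  have I: "(\<Union>b\<in>UNIV. ?I b) = insert None (Some ` {..<N})" by (auto simp: UNIV_bool)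
  have "indep_sets (\<lambda>b. sigma_sets (space M) (\<Union>t\<in>?I b. ?F t)) UNIV"
  proof (rule indep_sets_collect_sigma)
    show "indep_sets ?F (\<Union>b\<in>UNIV. ?I b)" using fresh unfolding I by (simp add: fresh_batch_def)
    show "Int_stable (?F t)" if "t \<in> ?I b" for b t
    proof (cases t)
      case (Some j)
      have "\<exists>E. S j -` E1 \<inter> space M \<inter> (S j -` E2 \<inter> space M) = S j -` E \<inter> space M \<and> E \<in> sets D"
        if "E1 \<in> sets D" "E2 \<in> sets D" for E1 E2
        using that by (intro exI[of _ "E1 \<inter> E2"]) auto
      then show ?thesis by (auto simp: Int_stable_def Some)
    qed (simp add: sets.Int_stable)
    show "disjoint_family_on ?I UNIV" by (auto simp: disjoint_family_on_def)
  qed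
  then have indep: "prob (\<Inter>b\<in>UNIV. if b then A else B) = (\<Prod>b\<in>UNIV. prob (if b then A else B))"
    if "B \<in> sigma_sets (space M) (\<Union>t\<in>Some ` {..<N}. ?F t)" for B
    by (rule indep_setsD) (use A that in \<open>auto simp: UNIV_bool intro!: sigma_sets.Basic\<close>)
  \<comment> \<open>The event has to lie in the sigma-algebra generated by the batch alone;
    measurability of the samples with respect to \<open>G\<close>, not \<open>M\<close>, gives
    this.\<close>
  define G where "G = sigma (space M) (\<Union>t\<in>Some ` {..<N}. ?F t)"
  have sub: "(\<Union>t\<in>Some ` {..<N}. ?F t) \<subseteq> Pow (space M)" by auto
  have spaceG: "space G = space M" unfolding G_def by (rule space_measure_of[OF sub])
  have setsG: "sets G = sigma_sets (space M) (\<Union>t\<in>Some ` {..<N}. ?F t)"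
    unfolding G_def by (rule sets_measure_of[OF sub])
  have [measurable]: "S j \<in> measurable G D" if "j < N" for j
  proof (rule measurableI)
    show "S j \<omega> \<in> space D" if "\<omega> \<in> space G" for \<omega>
      using measurable_space[OF S[OF \<open>j < N\<close>]] that by (simp add: spaceG)
    show "S j -` E \<inter> space G \<in> sets G" if "E \<in> sets D" for E
      using that \<open>j < N\<close> unfolding spaceG setsG by (auto intro!: sigma_sets.Basic)
  qed
  note \<phi> [measurable]
  have "{\<omega>\<in>space G. c < \<bar>1 / real N * (\<Sum>j<N. \<phi> (S j \<omega>))\<bar>} \<in> sets G" by measurable
  then have "?B \<in> sigma_sets (space M) (\<Union>t\<in>Some ` {..<N}. ?F t)"
    unfolding spaceG setsG .
  from indep[OF this] show ?thesis by (simp add: UNIV_bool Int_commute mult.commute)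
qed

text \<open>The point \<open>X\<close> is approximated by simple functions. On each level set of an approximation the
  point is a constant, and the tail bound at constants applies by independence. The strict
  deviation event at the limit is contained in the limit inferior of the approximate events.\<close>

lemma fresh_batch_tail_at_random_point:
  fixes X :: "'a \<Rightarrow> 'z::{metric_space, second_countable_topology}" and \<phi> :: "'x \<Rightarrow> 'z \<Rightarrow> real"
  assumes fresh: "fresh_batch M H D N S"
    and spaceH: "space H = space M" and X: "X \<in> borel_measurable H"
    and \<phi>: "\<And>z. (\<lambda>\<xi>. \<phi> \<xi> z) \<in> borel_measurable D" and mean: "\<And>z. (\<integral>\<xi>. \<phi> \<xi> z \<partial>D) = 0"
    and cont: "AE \<xi> in D. continuous_on UNIV (\<phi> \<xi>)"
    and bound: "\<And>z. AE \<xi> in D. \<bar>\<phi> \<xi> z\<bar> \<le> R z"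
    and R: "\<And>z. R z \<ge> 0" "continuous_on UNIV R" and u: "u \<ge> 0" and N: "N > 0"
  shows "\<exists>B\<in>sets M. prob B \<le> 2 * exp (- (real N * u\<^sup>2 / 2)) \<and>
    (\<forall>\<omega>\<in>space M - B. \<bar>1 / real N * (\<Sum>j<N. \<phi> (S j \<omega>) (X \<omega>))\<bar> \<le> R (X \<omega>) * u)"
proof -
  define \<delta> where "\<delta> = 2 * exp (- (real N * u\<^sup>2 / 2))"
  define dev where "dev z = {\<omega>\<in>space M. R z * u < \<bar>1 / real N * (\<Sum>j<N. \<phi> (S j \<omega>) z)\<bar>}" for z
  have S: "S j \<in> measurable M D" if "j < N" for j
    using fresh that by (simp add: fresh_batch_def)
  have dev: "dev z \<in> events" for z
  proof -
    note \<phi> [measurable] S [measurable]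
    show ?thesis unfolding dev_def by measurable
  qed
  have dev_le: "prob (dev z) \<le> \<delta>" for z
    unfolding dev_def \<delta>_def by (rule fresh_batch_average_tail[OF fresh \<phi> mean bound R(1) u N])
  \<comment> \<open>Independence of a family of sets of events includes that all its members are
    events, so the past is coarser than \<open>M\<close>.\<close>
  have H: "sets H \<subseteq> events"
    using fresh by (auto simp: fresh_batch_def indep_sets_def)
  obtain F where F: "\<And>n. simple_function H (F n)" "\<And>\<omega>. \<omega> \<in> space H \<Longrightarrow> (\<lambda>n. F n \<omega>) \<longlonglongrightarrow> X \<omega>"
    using borel_measurable_implies_sequence_metric[OF X] by metis
  have FH: "F n -` {z} \<inter> space M \<in> sets H" for n z
    using simple_functionD(2)[OF F(1)] spaceH by metis
  have FM: "F n -` {z} \<inter> space M \<in> events" for n z using FH H by blast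
  define W where "W n = (\<Union>z\<in>F n ` space M. (F n -` {z} \<inter> space M) \<inter> dev z)" for n
  have fin: "finite (F n ` space M)" for n
    using simple_functionD(1)[OF F(1)] spaceH by metis
  have W: "W n \<in> events" for n
    unfolding W_def by (intro sets.finite_UN sets.Int FM dev fin)
  have W_le: "prob (W n) \<le> \<delta>" for n
  proof -
    have "prob (W n) \<le> (\<Sum>z\<in>F n ` space M. prob ((F n -` {z} \<inter> space M) \<inter> dev z))"
      unfolding W_def using FM dev fin by (intro finite_measure_subadditive_finite) auto
    also have "\<dots> = (\<Sum>z\<in>F n ` space M. prob (F n -` {z} \<inter> space M) * prob (dev z))"
      unfolding dev_def by (intro sum.cong refl fresh_batch_indep_average[OF fresh \<phi> FH])
    also have "\<dots> \<le> (\<Sum>z\<in>F n ` space M. prob (F n -` {z} \<inter> space M) * \<delta>)"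
      by (intro sum_mono mult_left_mono dev_le) simp
    also have "\<dots> = \<delta> * (\<Sum>z\<in>F n ` space M. prob (F n -` {z} \<inter> space M))"
      by (simp add: sum_distrib_left mult.commute)
    also have "(\<Sum>z\<in>F n ` space M. prob (F n -` {z} \<inter> space M)) = prob (\<Union>z\<in>F n ` space M. F n -` {z} \<inter> space M)"
      using FM fin by (intro finite_measure_finite_Union[symmetric]) (auto simp: disjoint_family_on_def)
    also have "\<delta> * \<dots> \<le> \<delta> * 1" by (intro mult_left_mono prob_le_1) (simp add: \<delta>_def)
    finally show ?thesis by simp
  qed
  define V where "V n = (\<Inter>k\<in>{n..}. W k)" for n
  have V: "V n \<in> events" for n unfolding V_def using W by (intro sets.countable_INT) auto
  have "incseq V" by (auto simp: incseq_def V_def)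
  then have lim: "(\<lambda>n. prob (V n)) \<longlonglongrightarrow> prob (\<Union>n. V n)"
    using V by (intro finite_Lim_measure_incseq) auto
  have "V n \<subseteq> W n" for n by (auto simp: V_def)
  then have "prob (V n) \<le> \<delta>" for n using finite_measure_mono[OF _ W] W_le by (metis order_trans)
  then have V_le: "prob (\<Union>n. V n) \<le> \<delta>" by (intro LIMSEQ_le_const2[OF lim]) auto
  \<comment> \<open>Continuity in the point holds only for almost every sample; the exceptional
    outcomes are added to the bad event as a null set.\<close>
  from fresh_batch_AE[OF fresh cont] obtain Z where Z: "Z \<in> null_sets M"
    "{\<omega>\<in>space M. \<not> (\<forall>j<N. continuous_on UNIV (\<phi> (S j \<omega>)))} \<subseteq> Z"
    by (auto simp: eventually_ae_filter)
  have "prob ((\<Union>n. V n) \<union> Z) \<le> \<delta>"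
    using V_le measure_Un_null_set[OF _ Z(1), of "\<Union>n. V n"] V by auto
  moreover have "(\<Union>n. V n) \<union> Z \<in> events" using V Z(1) by auto
  moreover have "\<bar>1 / real N * (\<Sum>j<N. \<phi> (S j \<omega>) (X \<omega>))\<bar> \<le> R (X \<omega>) * u"
    if \<omega>: "\<omega> \<in> space M" "\<omega> \<notin> (\<Union>n. V n) \<union> Z" for \<omega>
  proof (rule ccontr)
    let ?d = "\<lambda>z. \<bar>1 / real N * (\<Sum>j<N. \<phi> (S j \<omega>) z)\<bar> - R z * u"
    assume "\<not> ?thesis"
    then have pos: "0 < ?d (X \<omega>)" by simp
    have "continuous_on UNIV (\<phi> (S j \<omega>))" if "j < N" for j using Z(2) \<omega> that by blast
    then have "continuous_on UNIV ?d" by (intro continuous_intros R(2)) auto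
    moreover have "(\<lambda>n. F n \<omega>) \<longlonglongrightarrow> X \<omega>" using F(2) \<omega> spaceH by simp
    ultimately have "(\<lambda>n. ?d (F n \<omega>)) \<longlonglongrightarrow> ?d (X \<omega>)"
      by (rule continuous_on_tendsto_compose) auto
    from order_tendstoD(1)[OF this pos] obtain n where n: "\<And>k. k \<ge> n \<Longrightarrow> 0 < ?d (F k \<omega>)"
      by (auto simp: eventually_sequentially)
    have "\<omega> \<in> W k" if "k \<ge> n" for k
      unfolding W_def dev_def using n[OF that] \<omega>(1) by auto
    then have "\<omega> \<in> V n" by (simp add: V_def)
    with \<omega> show False by blast
  qed
  ultimately show ?thesis unfolding \<delta>_def by blast
qed

end

section \<open>Deviations of vectors and matrices\<close>

text \<open>Continuity of matrix-valued maps refers to the Euclidean norm of the entries, whereas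
  the smoothness hypotheses are stated in \<open>opnorm\<close>.\<close>

lemma norm_le_opnorm: "norm A \<le> real CARD('m) * real CARD('n) * opnorm A"
  for A :: "real^'n^'m"
proof -
  have "norm A \<le> (\<Sum>i\<in>UNIV. norm (A $ i))" unfolding norm_vec_def by (rule L2_set_le_sum) simp
  also have "\<dots> \<le> (\<Sum>i\<in>(UNIV::'m set). real CARD('n) * opnorm A)"
    by (intro sum_mono norm_le_of_entries entry_le_opnorm)
  finally show ?thesis by (simp add: mult.assoc)
qed

lemma continuous_on_opnorm_lipschitz:
  fixes J :: "real^'k \<Rightarrow> real^'n^'m"
  assumes "\<And>x y. opnorm (J x - J y) \<le> L * norm (x - y)"
  shows "continuous_on S J"
proof (intro continuous_at_imp_continuous_on ballI)
  fix x
  have "(J \<longlongrightarrow> J x) (at x)"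
  proof (rule Lim_null[THEN iffD2], rule Lim_null_comparison)
    let ?b = "\<lambda>z. real CARD('m) * real CARD('n) * (L * norm (z - x))"
    show "\<forall>\<^sub>F z in at x. norm (J z - J x) \<le> ?b z"
      by (intro always_eventually allI order_trans[OF norm_le_opnorm] mult_left_mono assms) auto
    have "(?b \<longlongrightarrow> ?b x) (at x)" by (intro tendsto_intros)
    then show "(?b \<longlongrightarrow> 0) (at x)" by simp
  qed
  then show "isCont J x" by (simp add: isCont_def)
qed

lemma bounded_linear_matrix_vector_mult_left: "bounded_linear (\<lambda>A::real^'n^'m. A *v v)"
  unfolding linear_conv_bounded_linear[symmetric]
  by (intro linearI) (auto simp: matrix_vector_mult_add_rdistrib scaleR_matrix_vector_assoc)

lemma continuous_on_matrix_vector_mult: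
  fixes A :: "'a::topological_space \<Rightarrow> real^'n^'m"
  assumes "continuous_on S A" "continuous_on S v"
  shows "continuous_on S (\<lambda>z. A z *v v z)"
  unfolding matrix_vector_mult_def
  by (intro continuous_intros assms)

context prob_space
begin

text \<open>All coordinates share one radius \<open>R\<close> and one deviation \<open>u\<close>, so
  the union bound costs exactly the number of coordinates.\<close>

lemma fresh_batch_tail_family:
  fixes X :: "'a \<Rightarrow> 'z::{metric_space, second_countable_topology}" and \<phi> :: "'i \<Rightarrow> 'x \<Rightarrow> 'z \<Rightarrow> real"
  assumes I: "finite I" and fresh: "fresh_batch M H D N S"
    and "space H = space M" "X \<in> borel_measurable H"
    and "\<And>r z. r \<in> I \<Longrightarrow> (\<lambda>\<xi>. \<phi> r \<xi> z) \<in> borel_measurable D"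
    and "\<And>r z. r \<in> I \<Longrightarrow> (\<integral>\<xi>. \<phi> r \<xi> z \<partial>D) = 0"
    and "\<And>r. r \<in> I \<Longrightarrow> AE \<xi> in D. continuous_on UNIV (\<phi> r \<xi>)"
    and "\<And>r z. r \<in> I \<Longrightarrow> AE \<xi> in D. \<bar>\<phi> r \<xi> z\<bar> \<le> R z"
    and "\<And>z. R z \<ge> 0" "continuous_on UNIV R" and "u \<ge> 0" "N > 0"
  shows "\<exists>B\<in>sets M. prob B \<le> real (card I) * (2 * exp (- (real N * u\<^sup>2 / 2))) \<and>
    (\<forall>\<omega>\<in>space M - B. \<forall>r\<in>I. \<bar>1 / real N * (\<Sum>j<N. \<phi> r (S j \<omega>) (X \<omega>))\<bar> \<le> R (X \<omega>) * u)"
proof -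
  have "\<forall>r\<in>I. \<exists>B\<in>sets M. prob B \<le> 2 * exp (- (real N * u\<^sup>2 / 2)) \<and>
    (\<forall>\<omega>\<in>space M - B. \<bar>1 / real N * (\<Sum>j<N. \<phi> r (S j \<omega>) (X \<omega>))\<bar> \<le> R (X \<omega>) * u)"
    by (intro ballI fresh_batch_tail_at_random_point[OF fresh]) (use assms in auto)
  then obtain B where B: "\<And>r. r \<in> I \<Longrightarrow> B r \<in> events"
    "\<And>r. r \<in> I \<Longrightarrow> prob (B r) \<le> 2 * exp (- (real N * u\<^sup>2 / 2))"
    "\<And>r \<omega>. r \<in> I \<Longrightarrow> \<omega> \<in> space M - B r \<Longrightarrow> \<bar>1 / real N * (\<Sum>j<N. \<phi> r (S j \<omega>) (X \<omega>))\<bar> \<le> R (X \<omega>) * u"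
    by (subst (asm) Bex_def, subst (asm) bchoice_iff) blast
  have "prob (\<Union>r\<in>I. B r) \<le> (\<Sum>r\<in>I. prob (B r))"
    using B(1) I by (intro finite_measure_subadditive_finite) auto
  also have "\<dots> \<le> (\<Sum>r\<in>I. 2 * exp (- (real N * u\<^sup>2 / 2)))" by (intro sum_mono B(2))
  finally have "prob (\<Union>r\<in>I. B r) \<le> real (card I) * (2 * exp (- (real N * u\<^sup>2 / 2)))" by simp
  moreover have "(\<Union>r\<in>I. B r) \<in> events" using B(1) I by auto
  ultimately show ?thesis using B(3) by (intro bexI[of _ "\<Union>r\<in>I. B r"]) auto
qed

lemma fresh_batch_tail_vector:
  fixes X :: "'a \<Rightarrow> 'z::{metric_space, second_countable_topology}" and \<Phi> :: "'x \<Rightarrow> 'z \<Rightarrow> real^'m"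
  assumes fresh: "fresh_batch M H D N S"
    and H: "space H = space M" "X \<in> borel_measurable H"
    and int: "\<And>z. integrable D (\<lambda>\<xi>. \<Phi> \<xi> z)" and mean: "\<And>z. (\<integral>\<xi>. \<Phi> \<xi> z \<partial>D) = 0"
    and cont: "AE \<xi> in D. continuous_on UNIV (\<Phi> \<xi>)"
    and bound: "\<And>z. AE \<xi> in D. norm (\<Phi> \<xi> z) \<le> R z"
    and R: "\<And>z. R z \<ge> 0" "continuous_on UNIV R" "u \<ge> 0" "N > 0"
  shows "\<exists>B\<in>sets M. prob B \<le> real CARD('m) * (2 * exp (- (real N * u\<^sup>2 / 2))) \<and>
    (\<forall>\<omega>\<in>space M - B. norm ((1 / real N) *\<^sub>R (\<Sum>j<N. \<Phi> (S j \<omega>) (X \<omega>))) \<le> real CARD('m) * (R (X \<omega>) * u))"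
proof -
  have bl: "bounded_linear (\<lambda>v::real^'m. v $ r)" for r by (rule bounded_linear_vec_nth)
  have "\<exists>B\<in>sets M. prob B \<le> real CARD('m) * (2 * exp (- (real N * u\<^sup>2 / 2))) \<and>
    (\<forall>\<omega>\<in>space M - B. \<forall>r\<in>UNIV. \<bar>1 / real N * (\<Sum>j<N. \<Phi> (S j \<omega>) (X \<omega>) $ r)\<bar> \<le> R (X \<omega>) * u)"
  proof (rule fresh_batch_tail_family[OF _ fresh H, where \<phi> = "\<lambda>r \<xi> z. \<Phi> \<xi> z $ r"])
    fix r :: 'm and z
    show "(\<lambda>\<xi>. \<Phi> \<xi> z $ r) \<in> borel_measurable D"
      using integrable_bounded_linear[OF bl int] by (rule borel_measurable_integrable)
    show "(\<integral>\<xi>. \<Phi> \<xi> z $ r \<partial>D) = 0"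
      using integral_bounded_linear[OF bl[of r] int[of z]] mean by simp
    show "AE \<xi> in D. continuous_on UNIV (\<lambda>z. \<Phi> \<xi> z $ r)"
      using cont by eventually_elim (intro continuous_intros)
    show "AE \<xi> in D. \<bar>\<Phi> \<xi> z $ r\<bar> \<le> R z"
      using bound[of z] by eventually_elim (rule order_trans[OF component_le_norm_cart])
  qed (use R in auto)
  then obtain B where "B \<in> sets M" "prob B \<le> real CARD('m) * (2 * exp (- (real N * u\<^sup>2 / 2)))"
    and *: "\<And>\<omega> r. \<omega> \<in> space M - B \<Longrightarrow> \<bar>1 / real N * (\<Sum>j<N. \<Phi> (S j \<omega>) (X \<omega>) $ r)\<bar> \<le> R (X \<omega>) * u"
    by auto
  moreover have "norm ((1 / real N) *\<^sub>R (\<Sum>j<N. \<Phi> (S j \<omega>) (X \<omega>))) \<le> real CARD('m) * (R (X \<omega>) * u)"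
    if "\<omega> \<in> space M - B" for \<omega>
    using *[OF that] by (intro norm_le_of_entries) simp
  ultimately show ?thesis by blast
qed

lemma fresh_batch_tail_matrix:
  fixes X :: "'a \<Rightarrow> 'z::{metric_space, second_countable_topology}" and \<Phi> :: "'x \<Rightarrow> 'z \<Rightarrow> real^'n^'m"
  assumes fresh: "fresh_batch M H D N S"
    and H: "space H = space M" "X \<in> borel_measurable H"
    and int: "\<And>z. integrable D (\<lambda>\<xi>. \<Phi> \<xi> z)" and mean: "\<And>z. (\<integral>\<xi>. \<Phi> \<xi> z \<partial>D) = 0"
    and cont: "AE \<xi> in D. continuous_on UNIV (\<Phi> \<xi>)"
    and bound: "\<And>z. AE \<xi> in D. opnorm (\<Phi> \<xi> z) \<le> R z"
    and R: "\<And>z. R z \<ge> 0" "continuous_on UNIV R" "u \<ge> 0" "N > 0"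
  shows "\<exists>B\<in>sets M. prob B \<le> real CARD('m) * real CARD('n) * (2 * exp (- (real N * u\<^sup>2 / 2))) \<and>
    (\<forall>\<omega>\<in>space M - B. opnorm ((1 / real N) *\<^sub>R (\<Sum>j<N. \<Phi> (S j \<omega>) (X \<omega>)))
      \<le> real CARD('m) * real CARD('n) * (R (X \<omega>) * u))"
proof -
  have bl: "bounded_linear (\<lambda>A::real^'n^'m. A $ r $ s)" for r s
    by (rule bounded_linear_compose[OF bounded_linear_vec_nth bounded_linear_vec_nth])
  have "\<exists>B\<in>sets M. prob B \<le> real CARD('m \<times> 'n) * (2 * exp (- (real N * u\<^sup>2 / 2))) \<and>
    (\<forall>\<omega>\<in>space M - B. \<forall>r\<in>UNIV. \<bar>1 / real N * (\<Sum>j<N. \<Phi> (S j \<omega>) (X \<omega>) $ fst r $ snd r)\<bar> \<le> R (X \<omega>) * u)"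
  proof (rule fresh_batch_tail_family[OF _ fresh H, where \<phi> = "\<lambda>r \<xi> z. \<Phi> \<xi> z $ fst r $ snd r"])
    fix r :: "'m \<times> 'n" and z
    show "(\<lambda>\<xi>. \<Phi> \<xi> z $ fst r $ snd r) \<in> borel_measurable D"
      using integrable_bounded_linear[OF bl int] by (rule borel_measurable_integrable)
    show "(\<integral>\<xi>. \<Phi> \<xi> z $ fst r $ snd r \<partial>D) = 0"
      using integral_bounded_linear[OF bl[of "fst r" "snd r"] int[of z]] mean by simp
    show "AE \<xi> in D. continuous_on UNIV (\<lambda>z. \<Phi> \<xi> z $ fst r $ snd r)"
      using cont by eventually_elim (intro continuous_intros)
    show "AE \<xi> in D. \<bar>\<Phi> \<xi> z $ fst r $ snd r\<bar> \<le> R z"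
      using bound[of z] by eventually_elim (rule order_trans[OF entry_le_opnorm])
  qed (use R in auto)
  then obtain B where "B \<in> sets M" "prob B \<le> real CARD('m) * real CARD('n) * (2 * exp (- (real N * u\<^sup>2 / 2)))"
    and *: "\<And>\<omega> r s. \<omega> \<in> space M - B \<Longrightarrow> \<bar>1 / real N * (\<Sum>j<N. \<Phi> (S j \<omega>) (X \<omega>) $ r $ s)\<bar> \<le> R (X \<omega>) * u"
    by auto
  moreover have "opnorm ((1 / real N) *\<^sub>R (\<Sum>j<N. \<Phi> (S j \<omega>) (X \<omega>))) \<le> real CARD('m) * real CARD('n) * (R (X \<omega>) * u)"
    if "\<omega> \<in> space M - B" for \<omega>
    using *[OF that] by (intro opnorm_le_of_entries) simp
  ultimately show ?thesis by blast
qed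

end

section \<open>Estimation errors along a run\<close>

lemma average_diff_const:
  fixes v :: "nat \<Rightarrow> 'a::real_vector"
  assumes "N > 0"
  shows "(1 / real N) *\<^sub>R (\<Sum>j<N. v j - w) = (1 / real N) *\<^sub>R (\<Sum>j<N. v j) - w"
  using assms by (simp add: sum_subtractf scaleR_diff_right sum_constant_scaleR del: sum_constant)

lemma space_past: "space (past P D tau NA NB SA SB X k i) = space P"
  unfolding past_def by (rule space_measure_of) auto

text \<open>The generators of \<open>past\<close> include the iterates up to the current one, so
  nothing has to be known about how a randomised solver produced them.\<close>

lemma borel_measurable_past:
  fixes X :: "nat \<Rightarrow> nat \<Rightarrow> 'w \<Rightarrow> real^'n"
  assumes "i' \<le> i"
  shows "X k i' \<in> borel_measurable (past P D tau NA NB SA SB X k i)"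
proof (rule measurableI)
  fix E :: "(real^'n) set" assume "E \<in> sets borel"
  then show "X k i' -` E \<inter> space (past P D tau NA NB SA SB X k i) \<in> sets (past P D tau NA NB SA SB X k i)"
    unfolding space_past unfolding past_def
    by (subst sets_measure_of, blast, intro sigma_sets.Basic UnI2) (use assms in blast)
qed simp

locale stochastic_composite_problem =
  composite_problem f g g' h l\<^sub>f L\<^sub>g M
  for f :: "real^'m \<Rightarrow> real" and g :: "real^'n \<Rightarrow> real^'m" and g' :: "real^'n \<Rightarrow> real^'n^'m"
    and h :: "real^'n \<Rightarrow> ereal" and l\<^sub>f L\<^sub>g M :: real +
  fixes D :: "'x measure" and gc :: "'x \<Rightarrow> real^'n \<Rightarrow> real^'m" and Jc :: "'x \<Rightarrow> real^'n \<Rightarrow> real^'n^'m"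
    and \<sigma>\<^sub>g \<sigma>\<^sub>J L\<^sub>c :: real
  assumes D: "prob_space D"
    and gc_deriv: "\<And>\<xi> x. \<xi> \<in> space D \<Longrightarrow> (gc \<xi> has_derivative (\<lambda>v. Jc \<xi> x *v v)) (at x)"
    and g_mean: "\<And>x. integrable D (\<lambda>\<xi>. gc \<xi> x)" "\<And>x. g x = (\<integral>\<xi>. gc \<xi> x \<partial>D)"
    and g'_mean: "\<And>x. integrable D (\<lambda>\<xi>. Jc \<xi> x)" "\<And>x. g' x = (\<integral>\<xi>. Jc \<xi> x \<partial>D)"
    and value_dev: "AE \<xi> in D. \<forall>x. norm (gc \<xi> x - g x) \<le> \<sigma>\<^sub>g"
    and jacobian_dev: "AE \<xi> in D. \<forall>x. opnorm (Jc \<xi> x - g' x) \<le> \<sigma>\<^sub>J"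
    and Jc_lipschitz: "AE \<xi> in D. \<forall>x y. opnorm (Jc \<xi> x - Jc \<xi> y) \<le> L\<^sub>c * norm (x - y)"
begin

interpretation D: prob_space D by (rule D)

lemma sigma_nonneg: "\<sigma>\<^sub>g \<ge> 0" "\<sigma>\<^sub>J \<ge> 0"
proof -
  have "AE \<xi> in D. \<sigma>\<^sub>g \<ge> 0"
    using value_dev by eventually_elim (meson norm_ge_zero order_trans)
  then show "\<sigma>\<^sub>g \<ge> 0" by simp
  have "AE \<xi> in D. \<sigma>\<^sub>J \<ge> 0"
    using jacobian_dev by eventually_elim (meson opnorm_nonneg order_trans)
  then show "\<sigma>\<^sub>J \<ge> 0" by simp
qed

lemma Lc_nonneg: "L\<^sub>c \<ge> 0"
proof -
  obtain x :: "real^'n" where "norm x = 1" using vector_choose_size[of 1] by auto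
  have "AE \<xi> in D. L\<^sub>c \<ge> 0"
    using Jc_lipschitz
  proof eventually_elim
    case (elim \<xi>)
    then have "opnorm (Jc \<xi> x - Jc \<xi> 0) \<le> L\<^sub>c * norm (x - 0)" by blast
    then show ?case using opnorm_nonneg[of "Jc \<xi> x - Jc \<xi> 0"] \<open>norm x = 1\<close> by simp
  qed
  then show ?thesis by simp
qed

lemma continuous_on_g: "continuous_on S g"
  by (intro continuous_at_imp_continuous_on ballI has_derivative_continuous[OF g_deriv])

lemma continuous_on_g': "continuous_on S g'"
  by (rule continuous_on_opnorm_lipschitz[OF g_smooth])

lemma AE_continuous_on_gc: "AE \<xi> in D. continuous_on UNIV (gc \<xi>)"
  by (rule AE_I2) (intro continuous_at_imp_continuous_on ballI has_derivative_continuous[OF gc_deriv])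

lemma AE_continuous_on_Jc: "AE \<xi> in D. continuous_on UNIV (Jc \<xi>)"
  using Jc_lipschitz by eventually_elim (rule continuous_on_opnorm_lipschitz, blast)

text \<open>The summand of the small value batch minus its mean. It takes a pair because the tail
  bounds are stated for a single random point, while here both \<open>x_0\<close> and
  \<open>x_i\<close> are random.\<close>

definition linearisation_dev :: "'x \<Rightarrow> (real^'n) \<times> (real^'n) \<Rightarrow> real^'m" where
  "linearisation_dev \<xi> = (\<lambda>(x0, x). (gc \<xi> x - gc \<xi> x0 - Jc \<xi> x0 *v (x - x0)) - (g x - g x0 - g' x0 *v (x - x0)))"

definition jacobian_diff_dev :: "'x \<Rightarrow> (real^'n) \<times> (real^'n) \<Rightarrow> real^'n^'m" where
  "jacobian_diff_dev \<xi> = (\<lambda>(x0, x). (Jc \<xi> x - Jc \<xi> x0) - (g' x - g' x0))"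

text \<open>The bound adds the Taylor remainders of the component and of \<open>g\<close>. That it
  is quadratic in the distance lets the small batches have a size without a power of
  \<open>\<epsilon>\<close>.\<close>

lemma linearisation_dev:
  shows "integrable D (\<lambda>\<xi>. linearisation_dev \<xi> z)" (is ?int)
    and "(\<integral>\<xi>. linearisation_dev \<xi> z \<partial>D) = 0" (is ?mean)
    and "AE \<xi> in D. continuous_on UNIV (linearisation_dev \<xi>)" (is ?cont)
    and "AE \<xi> in D. norm (linearisation_dev \<xi> z) \<le> (L\<^sub>c + L\<^sub>g) * (norm (snd z - fst z))\<^sup>2" (is ?bound)
proof -
  obtain x0 x where z: "z = (x0, x)" by fastforce
  note J = integrable_bounded_linear[OF bounded_linear_matrix_vector_mult_left g'_mean(1)]
    integral_bounded_linear[OF bounded_linear_matrix_vector_mult_left g'_mean(1)]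
  show ?int by (simp add: z linearisation_dev_def J(1) g_mean(1))
  show ?mean by (simp add: z linearisation_dev_def J g_mean(1) g_mean(2)[symmetric] g'_mean(2)[symmetric] D.prob_space)
  show ?cont
    using AE_continuous_on_gc AE_continuous_on_Jc
  proof eventually_elim
    case (elim \<xi>)
    note c = this continuous_on_g[of UNIV] continuous_on_g'[of UNIV]
    show ?case unfolding linearisation_dev_def case_prod_beta
      by (intro continuous_intros continuous_on_matrix_vector_mult
          c[THEN continuous_on_compose2]) auto
  qed
  show ?bound
    using Jc_lipschitz AE_space
  proof eventually_elim
    case (elim \<xi>)
    have "norm (linearisation_dev \<xi> z) \<le> norm (gc \<xi> x - gc \<xi> x0 - Jc \<xi> x0 *v (x - x0))
        + norm (g x - g x0 - g' x0 *v (x - x0))"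
      unfolding z linearisation_dev_def split by (rule norm_triangle_ineq4)
    also have "\<dots> \<le> L\<^sub>c * (norm (x - x0))\<^sup>2 + L\<^sub>g * (norm (x - x0))\<^sup>2"
      by (intro add_mono lipschitz_jacobian_Taylor g_deriv g_smooth gc_deriv) (use elim in blast)+
    finally show ?case by (simp add: z algebra_simps)
  qed
qed

lemma jacobian_diff_dev:
  shows "integrable D (\<lambda>\<xi>. jacobian_diff_dev \<xi> z)" (is ?int)
    and "(\<integral>\<xi>. jacobian_diff_dev \<xi> z \<partial>D) = 0" (is ?mean)
    and "AE \<xi> in D. continuous_on UNIV (jacobian_diff_dev \<xi>)" (is ?cont)
    and "AE \<xi> in D. opnorm (jacobian_diff_dev \<xi> z) \<le> (L\<^sub>c + L\<^sub>g) * norm (snd z - fst z)" (is ?bound)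
proof -
  obtain x0 x where z: "z = (x0, x)" by fastforce
  show ?int by (simp add: z jacobian_diff_dev_def g'_mean(1))
  show ?mean by (simp add: z jacobian_diff_dev_def g'_mean(1) g'_mean(2)[symmetric] D.prob_space)
  show ?cont
    using AE_continuous_on_Jc
  proof eventually_elim
    case (elim \<xi>)
    note c = this continuous_on_g'[of UNIV]
    show ?case unfolding jacobian_diff_dev_def case_prod_beta
      by (intro continuous_intros c[THEN continuous_on_compose2]) auto
  qed
  show ?bound
    using Jc_lipschitz
  proof eventually_elim
    case (elim \<xi>)
    have "opnorm (jacobian_diff_dev \<xi> z) = opnorm ((Jc \<xi> x - Jc \<xi> x0) + (g' x0 - g' x))"
      by (simp add: z jacobian_diff_dev_def algebra_simps)
    also have "\<dots> \<le> L\<^sub>c * norm (x - x0) + L\<^sub>g * norm (x0 - x)"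
      by (intro order_trans[OF opnorm_triangle] add_mono g_smooth) (use elim in blast)
    finally show ?case by (simp add: z norm_minus_commute[of x0] algebra_simps)
  qed
qed

lemma value_batch_dev:
  fixes P :: "'w measure"
  assumes "prob_space P" and fresh: "fresh_batch P H D N S" and H: "space H = space P" "X \<in> borel_measurable H"
    and u: "u \<ge> 0" "N > 0"
  shows "\<exists>B\<in>sets P. measure P B \<le> real CARD('m) * (2 * exp (- (real N * u\<^sup>2 / 2))) \<and>
    (\<forall>\<omega>\<in>space P - B. norm ((1 / real N) *\<^sub>R (\<Sum>j<N. gc (S j \<omega>) (X \<omega>)) - g (X \<omega>)) \<le> real CARD('m) * (\<sigma>\<^sub>g * u))"
proof -
  interpret prob_space P by fact
  have "\<exists>B\<in>sets P. prob B \<le> real CARD('m) * (2 * exp (- (real N * u\<^sup>2 / 2))) \<and>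
    (\<forall>\<omega>\<in>space P - B. norm ((1 / real N) *\<^sub>R (\<Sum>j<N. gc (S j \<omega>) (X \<omega>) - g (X \<omega>))) \<le> real CARD('m) * (\<sigma>\<^sub>g * u))"
  proof (rule fresh_batch_tail_vector[OF fresh H, where \<Phi> = "\<lambda>\<xi> x. gc \<xi> x - g x"])
    show "integrable D (\<lambda>\<xi>. gc \<xi> x - g x)" "(\<integral>\<xi>. gc \<xi> x - g x \<partial>D) = 0" for x
      by (simp_all add: g_mean(1) g_mean(2)[symmetric] D.prob_space)
    show "AE \<xi> in D. continuous_on UNIV (\<lambda>x. gc \<xi> x - g x)"
      using AE_continuous_on_gc by eventually_elim (intro continuous_intros continuous_on_g)
    show "AE \<xi> in D. norm (gc \<xi> x - g x) \<le> \<sigma>\<^sub>g" for x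
      using value_dev by eventually_elim blast
  qed (use u sigma_nonneg in auto)
  then show ?thesis unfolding average_diff_const[OF u(2)] .
qed

lemma jacobian_batch_dev:
  fixes P :: "'w measure"
  assumes "prob_space P" and fresh: "fresh_batch P H D N S" and H: "space H = space P" "X \<in> borel_measurable H"
    and u: "u \<ge> 0" "N > 0"
  shows "\<exists>B\<in>sets P. measure P B \<le> real CARD('m) * real CARD('n) * (2 * exp (- (real N * u\<^sup>2 / 2))) \<and>
    (\<forall>\<omega>\<in>space P - B. opnorm ((1 / real N) *\<^sub>R (\<Sum>j<N. Jc (S j \<omega>) (X \<omega>)) - g' (X \<omega>))
      \<le> real CARD('m) * real CARD('n) * (\<sigma>\<^sub>J * u))"
proof -
  interpret prob_space P by fact
  have "\<exists>B\<in>sets P. prob B \<le> real CARD('m) * real CARD('n) * (2 * exp (- (real N * u\<^sup>2 / 2))) \<and>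
    (\<forall>\<omega>\<in>space P - B. opnorm ((1 / real N) *\<^sub>R (\<Sum>j<N. Jc (S j \<omega>) (X \<omega>) - g' (X \<omega>)))
      \<le> real CARD('m) * real CARD('n) * (\<sigma>\<^sub>J * u))"
  proof (rule fresh_batch_tail_matrix[OF fresh H, where \<Phi> = "\<lambda>\<xi> x. Jc \<xi> x - g' x"])
    show "integrable D (\<lambda>\<xi>. Jc \<xi> x - g' x)" "(\<integral>\<xi>. Jc \<xi> x - g' x \<partial>D) = 0" for x
      by (simp_all add: g'_mean(1) g'_mean(2)[symmetric] D.prob_space)
    show "AE \<xi> in D. continuous_on UNIV (\<lambda>x. Jc \<xi> x - g' x)"
      using AE_continuous_on_Jc by eventually_elim (intro continuous_intros continuous_on_g')
    show "AE \<xi> in D. opnorm (Jc \<xi> x - g' x) \<le> \<sigma>\<^sub>J" for x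
      using jacobian_dev by eventually_elim blast
  qed (use u sigma_nonneg in auto)
  then show ?thesis unfolding average_diff_const[OF u(2)] .
qed

lemma linearisation_batch_dev:
  fixes P :: "'w measure" and X0 X :: "'w \<Rightarrow> real^'n"
  assumes "prob_space P" and fresh: "fresh_batch P H D N S"
    and H: "space H = space P" "X0 \<in> borel_measurable H" "X \<in> borel_measurable H"
    and u: "u \<ge> 0" "N > 0"
  shows "\<exists>B\<in>sets P. measure P B \<le> real CARD('m) * (2 * exp (- (real N * u\<^sup>2 / 2))) \<and>
    (\<forall>\<omega>\<in>space P - B. norm ((1 / real N) *\<^sub>R (\<Sum>j<N. linearisation_dev (S j \<omega>) (X0 \<omega>, X \<omega>)))
      \<le> real CARD('m) * ((L\<^sub>c + L\<^sub>g) * (norm (X \<omega> - X0 \<omega>))\<^sup>2 * u))"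
proof -
  interpret prob_space P by fact
  have "(\<lambda>\<omega>. (X0 \<omega>, X \<omega>)) \<in> borel_measurable H" using H by (intro borel_measurable_Pair)
  moreover have "continuous_on UNIV (\<lambda>z::(real^'n) \<times> (real^'n). (L\<^sub>c + L\<^sub>g) * (norm (snd z - fst z))\<^sup>2)"
    by (intro continuous_intros)
  ultimately show ?thesis
    using fresh_batch_tail_vector[OF fresh H(1) _ linearisation_dev, of "\<lambda>\<omega>. (X0 \<omega>, X \<omega>)" u]
      u Lc_nonneg Lg_pos by simp
qed

lemma jacobian_diff_batch_dev:
  fixes P :: "'w measure" and X0 X :: "'w \<Rightarrow> real^'n"
  assumes "prob_space P" and fresh: "fresh_batch P H D N S"
    and H: "space H = space P" "X0 \<in> borel_measurable H" "X \<in> borel_measurable H"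
    and u: "u \<ge> 0" "N > 0"
  shows "\<exists>B\<in>sets P. measure P B \<le> real CARD('m) * real CARD('n) * (2 * exp (- (real N * u\<^sup>2 / 2))) \<and>
    (\<forall>\<omega>\<in>space P - B. opnorm ((1 / real N) *\<^sub>R (\<Sum>j<N. jacobian_diff_dev (S j \<omega>) (X0 \<omega>, X \<omega>)))
      \<le> real CARD('m) * real CARD('n) * ((L\<^sub>c + L\<^sub>g) * norm (X \<omega> - X0 \<omega>) * u))"
proof -
  interpret prob_space P by fact
  have "(\<lambda>\<omega>. (X0 \<omega>, X \<omega>)) \<in> borel_measurable H" using H by (intro borel_measurable_Pair)
  moreover have "continuous_on UNIV (\<lambda>z::(real^'n) \<times> (real^'n). (L\<^sub>c + L\<^sub>g) * norm (snd z - fst z))"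
    by (intro continuous_intros)
  ultimately show ?thesis
    using fresh_batch_tail_matrix[OF fresh H(1) _ jacobian_diff_dev, of "\<lambda>\<omega>. (X0 \<omega>, X \<omega>)" u]
      u Lc_nonneg Lg_pos by simp
qed

section \<open>From estimation errors to the stationarity bound\<close>

text \<open>The error at \<open>x\<close> splits exactly into the deviation of the small batch and
  the errors of the large batches transported linearly from \<open>x0\<close> to \<open>x\<close>.
  For \<open>i = 0\<close> the points coincide and the extra terms are only nonnegative
  slack.\<close>

lemma estimator2_error:
  fixes x0 x :: "real^'n"
  defines "d \<equiv> norm (x - x0)"
  assumes N: "a > 0" "b > 0"
    and G0: "norm ((1 / real A) *\<^sub>R (\<Sum>j<A. gc (SA k 0 j) x0) - g x0) \<le> e\<^sub>A"
    and J0: "opnorm ((1 / real B) *\<^sub>R (\<Sum>j<B. Jc (SB k 0 j) x0) - g' x0) \<le> e\<^sub>B"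
    and start: "i = 0 \<Longrightarrow> x = x0"
    and G: "i > 0 \<Longrightarrow> norm ((1 / real a) *\<^sub>R (\<Sum>j<a. linearisation_dev (SA k i j) (x0, x))) \<le> e\<^sub>a"
    and J: "i > 0 \<Longrightarrow> opnorm ((1 / real b) *\<^sub>R (\<Sum>j<b. jacobian_diff_dev (SB k i j) (x0, x))) \<le> e\<^sub>b"
    and nonneg: "e\<^sub>a \<ge> 0" "e\<^sub>b \<ge> 0"
  shows "norm (fst (estimator2 gc Jc A B a b SA SB k i x0 x) - g x) \<le> e\<^sub>A + e\<^sub>B * d + e\<^sub>a"
    and "opnorm (snd (estimator2 gc Jc A B a b SA SB k i x0 x) - g' x) \<le> e\<^sub>B + e\<^sub>b"
proof -
  define G0 where "G0 = (1 / real A) *\<^sub>R (\<Sum>j<A. gc (SA k 0 j) x0)"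
  define J0 where "J0 = (1 / real B) *\<^sub>R (\<Sum>j<B. Jc (SB k 0 j) x0)"
  have "norm (fst (estimator2 gc Jc A B a b SA SB k i x0 x) - g x) \<le> e\<^sub>A + e\<^sub>B * d + e\<^sub>a \<and>
    opnorm (snd (estimator2 gc Jc A B a b SA SB k i x0 x) - g' x) \<le> e\<^sub>B + e\<^sub>b"
  proof (cases "i = 0")
    case True
    with start have "x = x0" by simp
    with True assms show ?thesis by (simp add: estimator2_def Let_def)
  next
    case False
    let ?\<Psi> = "(1 / real a) *\<^sub>R (\<Sum>j<a. linearisation_dev (SA k i j) (x0, x))"
    let ?\<Omega> = "(1 / real b) *\<^sub>R (\<Sum>j<b. jacobian_diff_dev (SB k i j) (x0, x))"
    have "fst (estimator2 gc Jc A B a b SA SB k i x0 x) - g x = ?\<Psi> + (G0 - g x0) + (J0 - g' x0) *v (x - x0)"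
      using False N by (simp add: estimator2_def Let_def G0_def[symmetric] J0_def[symmetric]
          linearisation_dev_def average_diff_const matrix_vector_mult_diff_rdistrib)
    also have "norm \<dots> \<le> e\<^sub>a + e\<^sub>A + e\<^sub>B * d"
      using False G G0 J0 unfolding G0_def J0_def d_def
      by (intro order_trans[OF norm_triangle_ineq] add_mono
          order_trans[OF norm_matrix_vector_le_opnorm] mult_right_mono) auto
    finally have 1: "norm (fst (estimator2 gc Jc A B a b SA SB k i x0 x) - g x) \<le> e\<^sub>A + e\<^sub>B * d + e\<^sub>a"
      by simp
    have "snd (estimator2 gc Jc A B a b SA SB k i x0 x) - g' x = ?\<Omega> + (J0 - g' x0)"
      using False N by (simp add: estimator2_def Let_def J0_def[symmetric]
          jacobian_diff_dev_def average_diff_const)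
    also have "opnorm \<dots> \<le> e\<^sub>b + e\<^sub>B"
      using False J J0 unfolding J0_def by (intro order_trans[OF opnorm_triangle] add_mono) auto
    finally show ?thesis using 1 by simp
  qed
  then show "norm (fst (estimator2 gc Jc A B a b SA SB k i x0 x) - g x) \<le> e\<^sub>A + e\<^sub>B * d + e\<^sub>a"
    and "opnorm (snd (estimator2 gc Jc A B a b SA SB k i x0 x) - g' x) \<le> e\<^sub>B + e\<^sub>b" by auto
qed

text \<open>Every iteration may fail with probability \<open>\<Delta> / (K * \<tau>)\<close>: half
  goes to the solver and a quarter to each of its two batches. Outside the union of these failures
  the deterministic descent applies. The numbers \<open>u\<close> link both sides:
  \<open>tails\<close> makes the deviations unlikely, \<open>errs\<close> makes them small.\<close>

lemma run_average_grad_map_bound: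
  fixes P :: "'w measure" and SA SB :: "nat \<Rightarrow> nat \<Rightarrow> nat \<Rightarrow> 'w \<Rightarrow> 'x"
    and slv :: "nat \<Rightarrow> nat \<Rightarrow> 'w \<Rightarrow> (real^'n \<Rightarrow> ereal) \<Rightarrow> real \<Rightarrow> real \<Rightarrow> real^'n" and K \<tau> A B a b :: nat and \<epsilon>b \<delta>b :: real and x00 :: "real^'n"
  defines "X \<equiv> run_iterate f h gc Jc x00 M (\<lambda>_. \<tau>) A B a b \<epsilon>b \<delta>b SA SB slv"
    and "m \<equiv> real CARD('m)" and "n \<equiv> real CARD('n)"
  assumes run: "is_run f h gc Jc D x00 M K (\<lambda>_. \<tau>) A B a b \<epsilon>b \<delta>b P SA SB slv"
    and succ: "solver_succeeds f h gc Jc x00 M K (\<lambda>_. \<tau>) A B a b \<epsilon>b \<delta>b P SA SB slv"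
    and \<epsilon>b: "\<epsilon>b = \<epsilon> / (5 * 30 * M)" and \<delta>b: "\<delta>b = \<Delta> / (2 * real K * real \<tau>)"
    and \<Delta>: "0 < \<Delta>" "\<Delta> < 1" and pos: "K > 0" "\<tau> > 0" "A > 0" "B > 0" "a > 0" "b > 0"
    and u: "u\<^sub>A \<ge> 0" "u\<^sub>B \<ge> 0" "u\<^sub>a \<ge> 0" "u\<^sub>b \<ge> 0"
    and tails: "m * (2 * exp (- (real A * u\<^sub>A\<^sup>2 / 2))) \<le> \<Delta> / (4 * real K * real \<tau>)"
      "m * n * (2 * exp (- (real B * u\<^sub>B\<^sup>2 / 2))) \<le> \<Delta> / (4 * real K * real \<tau>)"
      "m * (2 * exp (- (real a * u\<^sub>a\<^sup>2 / 2))) \<le> \<Delta> / (4 * real K * real \<tau>)"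
      "m * n * (2 * exp (- (real b * u\<^sub>b\<^sup>2 / 2))) \<le> \<Delta> / (4 * real K * real \<tau>)"
    and errs: "m * (\<sigma>\<^sub>g * u\<^sub>A) \<le> \<alpha> * \<epsilon>" "m * n * (\<sigma>\<^sub>J * u\<^sub>B) \<le> \<beta> * sqrt \<epsilon> / real \<tau>"
      "m * ((L\<^sub>c + L\<^sub>g) * u\<^sub>a) \<le> \<gamma> / (real \<tau>)\<^sup>2" "m * n * ((L\<^sub>c + L\<^sub>g) * u\<^sub>b) \<le> \<eta> / real \<tau>"
    and nonneg: "\<epsilon> > 0" "\<beta> \<ge> 0" "\<gamma> \<ge> 0" "\<eta> \<ge> 0"
    and small: "l\<^sub>f * \<beta> + 2 * l\<^sub>f * \<gamma> + 12 * l\<^sub>f\<^sup>2 * \<eta>\<^sup>2 / M \<le> M / 4"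
    and small': "2 * l\<^sub>f * \<alpha> + l\<^sub>f * \<beta> + 12 * l\<^sub>f\<^sup>2 * \<beta>\<^sup>2 / M \<le> 1 / (8 * M)"
    and level: "level x00 \<phi>"
    and K\<tau>: "real K * real \<tau> \<ge> C / \<epsilon>" and C: "C \<ge> 16 * M * (\<phi> - inf_value)" "C > 0"
  shows "1 - \<Delta> \<le> measure P {\<omega> \<in> space P. 1 / (real K * real \<tau>) *
    (\<Sum>k<K. \<Sum>i<\<tau>. (norm (grad_map f g g' h M (X k i \<omega>)))\<^sup>2) \<le> \<epsilon>}"
proof -
  interpret P: prob_space P using run by (simp add: is_run_def)
  define NA where "NA = (\<lambda>i::nat. if i = 0 then A else a)"
  define NB where "NB = (\<lambda>i::nat. if i = 0 then B else b)"
  define H where "H = past P D (\<lambda>_. \<tau>) NA NB SA SB X"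
  define sub where "sub = run_subproblem f h gc Jc x00 M (\<lambda>_. \<tau>) A B a b \<epsilon>b \<delta>b SA SB slv"
  define near where "near k i \<omega> \<longleftrightarrow> sub k i \<omega> (slv k i \<omega> (sub k i \<omega>) \<epsilon>b \<delta>b) \<le> (INF y. sub k i \<omega> y) + ereal \<epsilon>b" for k i \<omega>
  define d where "d k i \<omega> = norm (X k i \<omega> - X k 0 \<omega>)" for k i \<omega>
  define good_G where "good_G k i \<omega> \<longleftrightarrow> (if i = 0
      then norm ((1 / real A) *\<^sub>R (\<Sum>j<A. gc (SA k 0 j \<omega>) (X k 0 \<omega>)) - g (X k 0 \<omega>)) \<le> m * (\<sigma>\<^sub>g * u\<^sub>A)
      else norm ((1 / real a) *\<^sub>R (\<Sum>j<a. linearisation_dev (SA k i j \<omega>) (X k 0 \<omega>, X k i \<omega>)))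
        \<le> m * ((L\<^sub>c + L\<^sub>g) * (d k i \<omega>)\<^sup>2 * u\<^sub>a))" for k i \<omega>
  define good_J where "good_J k i \<omega> \<longleftrightarrow> (if i = 0
      then opnorm ((1 / real B) *\<^sub>R (\<Sum>j<B. Jc (SB k 0 j \<omega>) (X k 0 \<omega>)) - g' (X k 0 \<omega>)) \<le> m * n * (\<sigma>\<^sub>J * u\<^sub>B)
      else opnorm ((1 / real b) *\<^sub>R (\<Sum>j<b. jacobian_diff_dev (SB k i j \<omega>) (X k 0 \<omega>, X k i \<omega>)))
        \<le> m * n * ((L\<^sub>c + L\<^sub>g) * d k i \<omega> * u\<^sub>b))" for k i \<omega>
  have X_meas: "X k i \<in> borel_measurable P" if "k < K" "i \<le> \<tau>" for k i
    using run that by (auto simp: is_run_def X_def)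
  have fresh: "fresh_batch P (H k i) D (NA i) (SA k i)" "fresh_batch P (H k i) D (NB i) (SB k i)"
    if "k < K" "i < \<tau>" for k i
    using run that by (auto simp: is_run_def Let_def X_def H_def NA_def NB_def)
  have H: "space (H k i) = space P" "X k 0 \<in> borel_measurable (H k i)" "X k i \<in> borel_measurable (H k i)" for k i
    unfolding H_def by (rule space_past borel_measurable_past; simp)+
  have bad: "\<exists>W\<in>sets P. measure P W \<le> \<Delta> / (real K * real \<tau>) \<and>
      (\<forall>\<omega>\<in>space P - W. near k i \<omega> \<and> good_G k i \<omega> \<and> good_J k i \<omega>)" if ki: "k < K" "i < \<tau>" for k i
  proof -
    let ?q = "\<Delta> / (4 * real K * real \<tau>)"
    obtain W1 where W1: "W1 \<in> sets P" "measure P W1 \<le> ?q" "\<And>\<omega>. \<omega> \<in> space P - W1 \<Longrightarrow> good_G k i \<omega>"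
    proof (cases "i = 0")
      case True
      with fresh(1)[OF ki] have "fresh_batch P (H k i) D A (SA k 0)" by (simp add: NA_def)
      from value_batch_dev[OF P.prob_space_axioms this H(1,2) u(1) pos(3)] tails(1) that True show ?thesis
        by (auto simp: good_G_def m_def)
    next
      case False
      with fresh(1)[OF ki] have "fresh_batch P (H k i) D a (SA k i)" by (simp add: NA_def)
      from linearisation_batch_dev[OF P.prob_space_axioms this H u(3) pos(5)] tails(3) that False show ?thesis
        by (auto simp: good_G_def m_def d_def)
    qed
    obtain W2 where W2: "W2 \<in> sets P" "measure P W2 \<le> ?q" "\<And>\<omega>. \<omega> \<in> space P - W2 \<Longrightarrow> good_J k i \<omega>"
    proof (cases "i = 0")
      case True
      with fresh(2)[OF ki] have "fresh_batch P (H k i) D B (SB k 0)" by (simp add: NB_def)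
      from jacobian_batch_dev[OF P.prob_space_axioms this H(1,2) u(2) pos(4)] tails(2) that True show ?thesis
        by (auto simp: good_J_def m_def n_def)
    next
      case False
      with fresh(2)[OF ki] have "fresh_batch P (H k i) D b (SB k i)" by (simp add: NB_def)
      from jacobian_diff_batch_dev[OF P.prob_space_axioms this H u(4) pos(6)] tails(4) that False show ?thesis
        by (auto simp: good_J_def m_def n_def d_def)
    qed
    let ?E = "{\<omega> \<in> space P. near k i \<omega>}"
    have E: "measure P ?E \<ge> 1 - \<delta>b"
      using succ ki by (auto simp: solver_succeeds_def near_def sub_def)
    \<comment> \<open>A set outside the sigma-algebra has measure 0, so a success probability of at
      least \<open>1 - \<delta>b > 0\<close> forces the success event to be measurable, and its
      complement can be used.\<close>
    have "1 \<le> real K * real \<tau>" using pos(1,2) mult_mono[of 1 "real K" 1 "real \<tau>"] by simp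
    then have "\<delta>b < 1" unfolding \<delta>b using \<Delta> by (simp add: divide_less_eq)
    with E have "measure P ?E > 0" by linarith
    then have Es: "?E \<in> sets P" using measure_notin_sets by fastforce
    have W3: "measure P (space P - ?E) \<le> \<delta>b" using P.prob_compl[OF Es] E by linarith
    let ?W = "W1 \<union> W2 \<union> (space P - ?E)"
    have "measure P ?W \<le> measure P W1 + measure P W2 + measure P (space P - ?E)"
      using W1(1) W2(1) Es by (intro order_trans[OF measure_Un_le] add_right_mono measure_Un_le) auto
    also have "\<dots> \<le> ?q + ?q + \<delta>b" by (intro add_mono W1 W2 W3)
    also have "\<dots> = \<Delta> / (real K * real \<tau>)" using pos by (simp add: \<delta>b field_simps)
    finally have "measure P ?W \<le> \<Delta> / (real K * real \<tau>)" .
    moreover have "?W \<in> sets P" using W1(1) W2(1) Es by auto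
    ultimately show ?thesis using W1(3) W2(3) by (intro bexI[of _ ?W]) auto
  qed
  define I where "I = {..<K} \<times> {..<\<tau>}"
  have "\<forall>q\<in>I. \<exists>W. W \<in> sets P \<and> measure P W \<le> \<Delta> / (real K * real \<tau>) \<and>
      (\<forall>\<omega>\<in>space P - W. near (fst q) (snd q) \<omega> \<and> good_G (fst q) (snd q) \<omega> \<and> good_J (fst q) (snd q) \<omega>)"
    using bad by (auto simp: I_def Bex_def)
  then obtain W where W: "\<And>q. q \<in> I \<Longrightarrow> W q \<in> sets P" "\<And>q. q \<in> I \<Longrightarrow> measure P (W q) \<le> \<Delta> / (real K * real \<tau>)"
    "\<And>q \<omega>. q \<in> I \<Longrightarrow> \<omega> \<in> space P - W q \<Longrightarrow> near (fst q) (snd q) \<omega> \<and> good_G (fst q) (snd q) \<omega> \<and> good_J (fst q) (snd q) \<omega>"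
    by (subst (asm) bchoice_iff) blast
  have finI: "finite I" by (simp add: I_def)
  let ?U = "\<Union>q\<in>I. W q"
  have U: "?U \<in> sets P" using W(1) finI by auto
  have "measure P ?U \<le> (\<Sum>q\<in>I. measure P (W q))"
    using W(1) finI by (intro P.finite_measure_subadditive_finite) auto
  also have "\<dots> \<le> (\<Sum>q\<in>I. \<Delta> / (real K * real \<tau>))" by (intro sum_mono W(2))
  also have "\<dots> = \<Delta>" using pos by (simp add: I_def)
  finally have "measure P ?U \<le> \<Delta>" .
  then have good: "1 - \<Delta> \<le> measure P (space P - ?U)" using P.prob_compl[OF U] by simp
  let ?T = "{\<omega> \<in> space P. 1 / (real K * real \<tau>) * (\<Sum>k<K. \<Sum>i<\<tau>. (norm (grad_map f g g' h M (X k i \<omega>)))\<^sup>2) \<le> \<epsilon>}"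
  \<comment> \<open>Monotonicity of the measure needs \<open>?T\<close> to be an event; here
    continuity of the proximal map enters.\<close>
  have "(\<lambda>\<omega>. grad_map f g g' h M (X k i \<omega>)) \<in> borel_measurable P" if "k < K" "i < \<tau>" for k i
    using X_meas[of k i] that by (intro measurable_compose[OF _ borel_measurable_grad_map]) auto
  then have "(\<lambda>\<omega>. 1 / (real K * real \<tau>) * (\<Sum>k<K. \<Sum>i<\<tau>. (norm (grad_map f g g' h M (X k i \<omega>)))\<^sup>2)) \<in> borel_measurable P"
    by (intro borel_measurable_times borel_measurable_const borel_measurable_sum borel_measurable_power
        borel_measurable_norm) auto
  then have T: "?T \<in> sets P" by measurable
  have "space P - ?U \<subseteq> ?T"
  proof
    fix \<omega> assume \<omega>: "\<omega> \<in> space P - ?U"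
    have good: "near k i \<omega>" "good_G k i \<omega>" "good_J k i \<omega>" if "k < K" "i < \<tau>" for k i
      using W(3)[of "(k, i)" \<omega>] that \<omega> by (auto simp: I_def)
    define est where "est k i = estimator2 gc Jc A B a b (\<lambda>k i j. SA k i j \<omega>) (\<lambda>k i j. SB k i j \<omega>) k i (X k 0 \<omega>) (X k i \<omega>)" for k i
    have sub_eq: "sub k i \<omega> = prox_model f h M (fst (est k i)) (snd (est k i)) (X k i \<omega>)" for k i
      by (simp add: sub_def run_subproblem_def subproblem_def est_def X_def estimator2_at_def)
    have next_iterate: "X k (Suc i) \<omega> = slv k i \<omega> (sub k i \<omega>) \<epsilon>b \<delta>b" for k i
      by (simp add: X_def sub_def run_iterate_def iterate_def run_subproblem_def)
    have dev: "norm (fst (est k i) - g (X k i \<omega>)) \<le> \<alpha> * \<epsilon> + \<beta> * sqrt \<epsilon> / \<tau> * d k i \<omega> + \<gamma> * (d k i \<omega>)\<^sup>2 / (real \<tau>)\<^sup>2"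
      "opnorm (snd (est k i) - g' (X k i \<omega>)) \<le> \<beta> * sqrt \<epsilon> / \<tau> + \<eta> * d k i \<omega> / \<tau>" if ki: "k < K" "i < \<tau>" for k i
    proof -
      have d0: "d k i \<omega> \<ge> 0" by (simp add: d_def)
      have "m * ((L\<^sub>c + L\<^sub>g) * u\<^sub>a) * (d k i \<omega>)\<^sup>2 \<le> \<gamma> / (real \<tau>)\<^sup>2 * (d k i \<omega>)\<^sup>2"
        by (intro mult_right_mono errs) simp
      then have ea: "m * ((L\<^sub>c + L\<^sub>g) * (d k i \<omega>)\<^sup>2 * u\<^sub>a) \<le> \<gamma> * (d k i \<omega>)\<^sup>2 / (real \<tau>)\<^sup>2"
        by (simp add: mult_ac)
      have "m * n * ((L\<^sub>c + L\<^sub>g) * u\<^sub>b) * d k i \<omega> \<le> \<eta> / real \<tau> * d k i \<omega>"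
        by (intro mult_right_mono errs d0)
      then have eb: "m * n * ((L\<^sub>c + L\<^sub>g) * d k i \<omega> * u\<^sub>b) \<le> \<eta> * d k i \<omega> / real \<tau>"
        by (simp add: mult_ac)
      show "norm (fst (est k i) - g (X k i \<omega>)) \<le> \<alpha> * \<epsilon> + \<beta> * sqrt \<epsilon> / \<tau> * d k i \<omega> + \<gamma> * (d k i \<omega>)\<^sup>2 / (real \<tau>)\<^sup>2"
        "opnorm (snd (est k i) - g' (X k i \<omega>)) \<le> \<beta> * sqrt \<epsilon> / \<tau> + \<eta> * d k i \<omega> / \<tau>"
        unfolding est_def d_def
        \<comment> \<open>The large batches belong to iteration \<open>(k, 0)\<close> and the small
          ones to \<open>(k, i)\<close>, so the good events of both iterations are needed.\<close>
        by (rule estimator2_error[where e\<^sub>A = "\<alpha> * \<epsilon>" and e\<^sub>B = "\<beta> * sqrt \<epsilon> / \<tau>"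
              and e\<^sub>a = "\<gamma> * (norm (X k i \<omega> - X k 0 \<omega>))\<^sup>2 / (real \<tau>)\<^sup>2"
              and e\<^sub>b = "\<eta> * norm (X k i \<omega> - X k 0 \<omega>) / \<tau>"]; (use good[of k 0] good[OF ki] ki pos errs ea eb nonneg d0 in
            \<open>auto simp: good_G_def good_J_def d_def split: if_splits\<close>))+
    qed
    have "1 / (real K * real \<tau>) * (\<Sum>k<K. \<Sum>i<\<tau>. (norm (grad_map f g g' h M (X k i \<omega>)))\<^sup>2) \<le> \<epsilon>"
    proof (rule average_grad_map_bound[where x = "\<lambda>k i. X k i \<omega>", OF _ _ _ dev[unfolded d_def] nonneg(1,2) small small' K\<tau> C])
      show "level (X 0 0 \<omega>) \<phi>" using level by (simp add: X_def run_iterate_def iterate_def)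
      show "X (Suc k) 0 \<omega> = X k \<tau> \<omega>" for k by (simp add: X_def run_iterate_def iterate_def)
      show "prox_model f h M (fst (est k i)) (snd (est k i)) (X k i \<omega>) (X k (Suc i) \<omega>)
          \<le> (INF y. prox_model f h M (fst (est k i)) (snd (est k i)) (X k i \<omega>) y) + ereal (\<epsilon> / (5 * 30 * M))"
        if "k < K" "i < \<tau>" for k i
        using good(1)[OF that] unfolding near_def next_iterate sub_eq[symmetric] \<epsilon>b .
    qed
    with \<omega> show "\<omega> \<in> ?T" by simp
  qed
  from good P.finite_measure_mono[OF this T] show ?thesis by linarith
qed

end

section \<open>Batch sizes and oracle complexity\<close>

lemma real_nat_ceiling_le: "x \<ge> 0 \<Longrightarrow> real (nat \<lceil>x\<rceil>) \<le> x + 1"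
  by linarith

text \<open>A single logarithmic factor is enough, so the exponent \<open>p\<close> is 1.\<close>

lemma at_most_soft_thetaI:
  assumes "c > 0" "\<forall>\<^sub>F \<epsilon> in at_right 0. N \<epsilon> \<le> c * (Q \<epsilon> * ln (1 / \<epsilon>))"
  shows "at_most_soft_theta N Q"
  unfolding at_most_soft_theta_def soft_theta_def
proof (intro bexI CollectI)
  show "\<forall>\<^sub>F \<epsilon> in at_right 0. N \<epsilon> \<le> c * (Q \<epsilon> * ln (1 / \<epsilon>))" by fact
  show "\<exists>p. (\<lambda>\<epsilon>. c * (Q \<epsilon> * ln (1 / \<epsilon>))) \<in> \<Theta>[at_right 0](\<lambda>\<epsilon>. Q \<epsilon> * ln (1 / \<epsilon>) ^ p)"
    by (rule exI[of _ 1]) (use assms(1) in simp)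
qed

lemma sum_first_rest_le: "(\<Sum>i<t. if i = 0 then x else y) \<le> x + t * y" for t x y :: nat
proof (cases t)
  case (Suc s)
  have "(\<Sum>i<Suc s. if i = 0 then x else y) = x + s * y"
    by (subst sum.lessThan_Suc_shift) simp
  then show ?thesis by (simp add: Suc)
qed simp

lemma ln_mult3: "x > 0 \<Longrightarrow> y > 0 \<Longrightarrow> z > 0 \<Longrightarrow> ln (x * y * z) = ln x + ln y + ln z" for x y z :: real
  by (simp add: ln_mult)

lemma one_le_mult_of_nat: "K > 0 \<Longrightarrow> t > 0 \<Longrightarrow> 1 \<le> real K * real t"
  using mult_mono[of 1 "real K" 1 "real t"] by simp

text \<open>A sum of logarithms is bounded by a product: eventually
  \<open>ln (1 / \<epsilon>)\<close> is at least 1, and \<open>ln (1 / \<Delta>)\<close> stays above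
  \<open>ln (1 / \<Delta>\<^sub>0) > 0\<close>. The quantifiers over \<open>k\<close>,
  \<open>t\<close>, \<open>\<Delta>\<close> and \<open>s\<close> stand inside
  \<open>eventually\<close> because all these quantities may vary with
  \<open>\<epsilon>\<close>.\<close>

lemma batch_size_upper:
  fixes c c' T \<Delta>\<^sub>0 :: real
  assumes c: "c > 0" "c' > 0" "T > 0" "\<Delta>\<^sub>0 > 0" "\<Delta>\<^sub>0 < 1"
  shows "\<exists>Q>0. \<forall>\<^sub>F \<epsilon> in at_right 0. \<forall>k t \<Delta> s. 0 < \<Delta> \<and> \<Delta> \<le> \<Delta>\<^sub>0 \<and> 0 < k \<and> 0 < t \<and> k * t \<le> T / \<epsilon> \<and> 1 \<le> s \<longrightarrow>
    real (nat \<lceil>c * (s * ln (c' * k * t / \<Delta>))\<rceil>) \<le> Q * (s * (ln (1 / \<epsilon>) * ln (1 / \<Delta>)))"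
proof -
  define ld where "ld = ln (1 / \<Delta>\<^sub>0)"
  have ld: "ld > 0" using c by (simp add: ld_def)
  \<comment> \<open>The 2 counts \<open>ln (c' * T)\<close> and \<open>ln (1 / \<epsilon>)\<close>,
    each at most \<open>l\<close>; the 1 is for \<open>ln (1 / \<Delta>)\<close>.\<close>
  define q where "q = 2 / ld + 1"
  have q: "q > 0" using ld by (simp add: q_def add_pos_pos)
  have "filterlim (\<lambda>\<epsilon>::real. ln (1 / \<epsilon>)) at_top (at_right 0)" by real_asymp
  then have "\<forall>\<^sub>F \<epsilon> in at_right 0. ln (1 / \<epsilon>) \<ge> max 1 (ln (c' * T))"
    unfolding filterlim_at_top by blast
  moreover have "\<forall>\<^sub>F \<epsilon>::real in at_right 0. \<epsilon> > 0" by (rule eventually_at_right_less)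
  ultimately have "\<forall>\<^sub>F \<epsilon> in at_right 0. \<forall>k t \<Delta> s. 0 < \<Delta> \<and> \<Delta> \<le> \<Delta>\<^sub>0 \<and> 0 < k \<and> 0 < t \<and> k * t \<le> T / \<epsilon> \<and> 1 \<le> s \<longrightarrow>
    real (nat \<lceil>c * (s * ln (c' * k * t / \<Delta>))\<rceil>) \<le> (c * q + 1 / ld) * (s * (ln (1 / \<epsilon>) * ln (1 / \<Delta>)))"
  proof eventually_elim
    case (elim \<epsilon>)
    show ?case
    proof (intro allI impI)
      fix k t \<Delta> s :: real
      assume a: "0 < \<Delta> \<and> \<Delta> \<le> \<Delta>\<^sub>0 \<and> 0 < k \<and> 0 < t \<and> k * t \<le> T / \<epsilon> \<and> 1 \<le> s"
      define l where "l = ln (1 / \<epsilon>)"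
      define D where "D = ln (1 / \<Delta>)"
      have l: "l \<ge> 1" "l \<ge> ln (c' * T)" using elim by (auto simp: l_def)
      have D: "D \<ge> ld" unfolding D_def ld_def using a c by (simp add: frac_le)
      have "ld \<le> l * D" using mult_mono[of 1 l ld D] l D ld by simp
      then have one: "1 \<le> 1 / ld * (l * D)" using ld by (simp add: field_simps)
      have "l * ld \<le> l * D" using l D by (intro mult_left_mono) auto
      then have l': "l \<le> 1 / ld * (l * D)" using ld by (simp add: field_simps)
      have D': "D \<le> l * D" using l D ld by simp
      have "c' * k * t / \<Delta> = c' * (k * t) * (1 / \<Delta>)" by simp
      also have "\<dots> \<le> c' * (T / \<epsilon>) * (1 / \<Delta>)" using a c by (intro mult_left_mono mult_right_mono) auto
      finally have "ln (c' * k * t / \<Delta>) \<le> ln (c' * (T / \<epsilon>) * (1 / \<Delta>))"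
        using a c elim by (subst ln_le_cancel_iff) auto
      also have "c' * (T / \<epsilon>) * (1 / \<Delta>) = (c' * T) * (1 / \<epsilon>) * (1 / \<Delta>)" by simp
      also have "ln \<dots> = ln (c' * T) + l + D"
        unfolding l_def D_def using a c elim by (intro ln_mult3) auto
      also have "\<dots> \<le> 2 * (1 / ld * (l * D)) + l * D" using l l' D' by linarith
      also have "\<dots> = q * (l * D)" by (simp add: q_def distrib_right)
      finally have L: "ln (c' * k * t / \<Delta>) \<le> q * (l * D)" .
      have "c * (s * ln (c' * k * t / \<Delta>)) \<le> c * (s * (q * (l * D)))"
        using a c by (intro mult_left_mono L) auto
      then have "real (nat \<lceil>c * (s * ln (c' * k * t / \<Delta>))\<rceil>) \<le> real (nat \<lceil>c * (s * (q * (l * D)))\<rceil>)"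
        by (intro of_nat_mono nat_mono ceiling_mono)
      also have "\<dots> \<le> c * (s * (q * (l * D))) + 1"
        using a c q l D ld by (intro real_nat_ceiling_le mult_nonneg_nonneg) auto
      \<comment> \<open>The 1 added by the ceiling is absorbed here, with the help of
        \<open>s \<ge> 1\<close>.\<close>
      also have "1 \<le> 1 / ld * (s * (l * D))"
      proof -
        have "1 * (1 / ld * (l * D)) \<le> s * (1 / ld * (l * D))"
          using a one by (intro mult_right_mono) auto
        with one show ?thesis by (simp add: mult_ac)
      qed
      finally show "real (nat \<lceil>c * (s * ln (c' * k * t / \<Delta>))\<rceil>) \<le> (c * q + 1 / ld) * (s * (ln (1 / \<epsilon>) * ln (1 / \<Delta>)))"
        unfolding l_def[symmetric] D_def[symmetric] by (simp add: algebra_simps)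
    qed
  qed
  moreover have "c * q + 1 / ld > 0" using c q ld by (intro add_pos_pos mult_pos_pos) auto
  ultimately show ?thesis by blast
qed

text \<open>Rounding up can add a whole inner loop of \<open>t\<close> iterations. The bound
  \<open>T / \<epsilon>\<close> on \<open>t\<close> keeps the total number of iterations of order
  \<open>1 / \<epsilon>\<close>; this is the purpose of
  \<open>\<tau> = O(1 / \<epsilon>)\<close>.\<close>

lemma outer_iterations_le:
  fixes C T \<epsilon> :: real and t :: nat
  assumes "C > 0" "\<epsilon> > 0" "t > 0" "real t \<le> T / \<epsilon>"
  shows "real (nat \<lceil>C * (1 / \<epsilon>) / real t\<rceil>) * real t \<le> (C + T) / \<epsilon>"
    and "real (nat \<lceil>C * (1 / \<epsilon>) / real t\<rceil>) > 0"
proof -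
  have "real (nat \<lceil>C * (1 / \<epsilon>) / real t\<rceil>) \<le> C * (1 / \<epsilon>) / real t + 1"
    using assms by (intro real_nat_ceiling_le) auto
  then have "real (nat \<lceil>C * (1 / \<epsilon>) / real t\<rceil>) * real t \<le> (C * (1 / \<epsilon>) / real t + 1) * real t"
    by (intro mult_right_mono) auto
  also have "\<dots> = C / \<epsilon> + real t" using assms by (simp add: field_simps)
  finally show "real (nat \<lceil>C * (1 / \<epsilon>) / real t\<rceil>) * real t \<le> (C + T) / \<epsilon>"
    using assms by (simp add: add_divide_distrib)
  have "C * (1 / \<epsilon>) / real t > 0" using assms by simp
  then show "real (nat \<lceil>C * (1 / \<epsilon>) / real t\<rceil>) > 0" by simp
qed

text \<open>A large batch is paid once per \<open>t\<close> iterations, hence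
  \<open>s\<^sub>0 / t\<close> per iteration; \<open>W\<close> is the common logarithmic
  factor.\<close>

lemma total_cost_le:
  fixes \<epsilon> T W q r s\<^sub>0 s\<^sub>1 :: real and t K N\<^sub>0 N\<^sub>1 :: nat
  assumes "0 < \<epsilon>" "t > 0" "real K * real t \<le> T / \<epsilon>" "T > 0" "W \<ge> 0"
    and "real N\<^sub>0 \<le> q * (s\<^sub>0 * W)" "real N\<^sub>1 \<le> r * (s\<^sub>1 * W)" "q > 0" "r > 0" "s\<^sub>0 \<ge> 0" "s\<^sub>1 \<ge> 0"
  shows "real (\<Sum>k<K. \<Sum>i<t. if i = 0 then N\<^sub>0 else N\<^sub>1)
    \<le> T * (q + r) * ((1 / \<epsilon> * (s\<^sub>0 / t) + 1 / \<epsilon> * s\<^sub>1) * W)"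
proof -
  have "real (\<Sum>i<t. if i = 0 then N\<^sub>0 else N\<^sub>1) \<le> real (N\<^sub>0 + t * N\<^sub>1)"
    by (intro of_nat_mono sum_first_rest_le)
  then have "real (\<Sum>k<K. \<Sum>i<t. if i = 0 then N\<^sub>0 else N\<^sub>1) \<le> real K * real (N\<^sub>0 + t * N\<^sub>1)"
    by (simp add: mult_left_mono del: of_nat_sum of_nat_add)
  also have "\<dots> = (real K * real t) * (real N\<^sub>0 / t + real N\<^sub>1)"
    using assms by (simp add: field_simps)
  also have "\<dots> \<le> (T / \<epsilon>) * ((q + r) * ((s\<^sub>0 / t + s\<^sub>1) * W))"
  proof (intro mult_mono)
    have "real N\<^sub>0 / t + real N\<^sub>1 \<le> q * (s\<^sub>0 * W) / t + r * (s\<^sub>1 * W)"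
      using assms by (intro add_mono divide_right_mono) auto
    also have "\<dots> = q * (s\<^sub>0 / t * W) + r * (s\<^sub>1 * W)" by simp
    also have "\<dots> \<le> (q + r) * (s\<^sub>0 / t * W) + (q + r) * (s\<^sub>1 * W)"
      using assms by (intro add_mono mult_right_mono) auto
    finally show "real N\<^sub>0 / t + real N\<^sub>1 \<le> (q + r) * ((s\<^sub>0 / t + s\<^sub>1) * W)"
      by (simp add: algebra_simps)
  qed (use assms in auto)
  also have "\<dots> = T * (q + r) * ((1 / \<epsilon> * (s\<^sub>0 / t) + 1 / \<epsilon> * s\<^sub>1) * W)"
    using assms by (simp add: field_simps)
  finally show ?thesis .
qed

section \<open>Oracle complexities as the tolerance tends to 0\<close>

text \<open>The failure probability may vary with \<open>\<epsilon>\<close>. Keeping it below a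
  fixed \<open>\<Delta>\<^sub>0 < 1\<close> bounds \<open>ln (1 / \<Delta>)\<close> away from 0, so
  that a product of logarithms dominates constants and ceilings.\<close>

locale complexity_setting =
  fixes C :: real and \<tau> :: "real \<Rightarrow> nat" and \<Delta> :: "real \<Rightarrow> real" and \<Delta>\<^sub>0 :: real
  assumes C: "C > 0"
    and \<tau>_pos: "\<And>\<epsilon>. \<tau> \<epsilon> > 0" and \<tau>_bigo: "(\<lambda>\<epsilon>. real (\<tau> \<epsilon>)) \<in> O[at_right 0](\<lambda>\<epsilon>. 1 / \<epsilon>)"
    and \<Delta>: "\<And>\<epsilon>. 0 < \<Delta> \<epsilon>" "\<And>\<epsilon>. \<Delta> \<epsilon> \<le> \<Delta>\<^sub>0" and \<Delta>\<^sub>0: "\<Delta>\<^sub>0 < 1"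
begin

definition outer :: "real \<Rightarrow> real" where
  "outer \<epsilon> = real (nat \<lceil>C * (1 / \<epsilon>) / real (\<tau> \<epsilon>)\<rceil>)"

lemma outer_upper:
  "\<exists>T>0. \<forall>\<^sub>F \<epsilon> in at_right 0. 0 < \<epsilon> \<and> \<epsilon> < 1 \<and> 0 < outer \<epsilon> \<and> outer \<epsilon> * real (\<tau> \<epsilon>) \<le> T / \<epsilon>"
proof -
  obtain t where t: "t > 0" and ev: "\<forall>\<^sub>F \<epsilon> in at_right 0. norm (real (\<tau> \<epsilon>)) \<le> t * norm (1 / \<epsilon>)"
    using landau_o.bigE[OF \<tau>_bigo] by blast
  have "\<forall>\<^sub>F \<epsilon>::real in at_right 0. 0 < \<epsilon> \<and> \<epsilon> < 1"
    unfolding eventually_at_right_field by (rule exI[of _ 1]) auto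
  with ev have "\<forall>\<^sub>F \<epsilon> in at_right 0. 0 < \<epsilon> \<and> \<epsilon> < 1 \<and> 0 < outer \<epsilon> \<and> outer \<epsilon> * real (\<tau> \<epsilon>) \<le> (C + t) / \<epsilon>"
  proof eventually_elim
    case (elim \<epsilon>)
    then have "real (\<tau> \<epsilon>) \<le> t / \<epsilon>" by simp
    from outer_iterations_le[OF C _ \<tau>_pos this] elim show ?case by (simp add: outer_def)
  qed
  then show ?thesis using C t by (intro exI[of _ "C + t"]) auto
qed

lemma batch_upper:
  assumes c: "c > 0" "c' > 0" and s: "\<And>\<epsilon>. 0 < \<epsilon> \<Longrightarrow> \<epsilon> < 1 \<Longrightarrow> s \<epsilon> \<ge> 1"
  shows "\<exists>Q>0. \<forall>\<^sub>F \<epsilon> in at_right 0. real (nat \<lceil>c * (s \<epsilon> * ln (c' * outer \<epsilon> * real (\<tau> \<epsilon>) / \<Delta> \<epsilon>))\<rceil>)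
    \<le> Q * (s \<epsilon> * (ln (1 / \<epsilon>) * ln (1 / \<Delta> \<epsilon>)))"
proof -
  obtain T where T: "T > 0"
    "\<forall>\<^sub>F \<epsilon> in at_right 0. 0 < \<epsilon> \<and> \<epsilon> < 1 \<and> 0 < outer \<epsilon> \<and> outer \<epsilon> * real (\<tau> \<epsilon>) \<le> T / \<epsilon>"
    using outer_upper by blast
  have "\<Delta>\<^sub>0 > 0" using \<Delta>[of 0] by linarith
  from batch_size_upper[OF c T(1) this \<Delta>\<^sub>0] obtain Q where Q: "Q > 0"
    "\<forall>\<^sub>F \<epsilon> in at_right 0. \<forall>k t \<Delta> s. 0 < \<Delta> \<and> \<Delta> \<le> \<Delta>\<^sub>0 \<and> 0 < k \<and> 0 < t \<and> k * t \<le> T / \<epsilon> \<and> 1 \<le> s \<longrightarrow>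
    real (nat \<lceil>c * (s * ln (c' * k * t / \<Delta>))\<rceil>) \<le> Q * (s * (ln (1 / \<epsilon>) * ln (1 / \<Delta>)))" by blast
  from T(2) Q(2) have "\<forall>\<^sub>F \<epsilon> in at_right 0. real (nat \<lceil>c * (s \<epsilon> * ln (c' * outer \<epsilon> * real (\<tau> \<epsilon>) / \<Delta> \<epsilon>))\<rceil>)
    \<le> Q * (s \<epsilon> * (ln (1 / \<epsilon>) * ln (1 / \<Delta> \<epsilon>)))"
    by eventually_elim (use \<tau>_pos \<Delta> s in auto)
  with Q(1) show ?thesis by blast
qed

lemma value_evals_soft_theta:
  assumes c: "c\<^sub>A > 0" "c\<^sub>a > 0" "c' > 0"
  defines "log_factor \<equiv> \<lambda>\<epsilon>. ln (c' * outer \<epsilon> * real (\<tau> \<epsilon>) / \<Delta> \<epsilon>)"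
  shows "at_most_soft_theta
    (\<lambda>\<epsilon>. real (value_evals (nat \<lceil>C * (1 / \<epsilon>) / real (\<tau> \<epsilon>)\<rceil>) (\<lambda>_. \<tau> \<epsilon>)
      (nat \<lceil>c\<^sub>A * (1 / \<epsilon>\<^sup>2) * log_factor \<epsilon>\<rceil>) (nat \<lceil>c\<^sub>a * real (\<tau> \<epsilon>) ^ 4 * log_factor \<epsilon>\<rceil>)))
    (\<lambda>\<epsilon>. (1 / \<epsilon> ^ 3 * (1 / real (\<tau> \<epsilon>)) + 1 / \<epsilon> * real (\<tau> \<epsilon>) ^ 4) * ln (1 / \<Delta> \<epsilon>))"
proof -
  obtain T where T: "T > 0"
    "\<forall>\<^sub>F \<epsilon> in at_right 0. 0 < \<epsilon> \<and> \<epsilon> < 1 \<and> 0 < outer \<epsilon> \<and> outer \<epsilon> * real (\<tau> \<epsilon>) \<le> T / \<epsilon>"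
    using outer_upper by blast
  have "1 \<le> 1 / \<epsilon>\<^sup>2" if "0 < \<epsilon>" "\<epsilon> < 1" for \<epsilon> :: real
    using that by (simp add: power_le_one)
  then have "\<exists>q>0. \<forall>\<^sub>F \<epsilon> in at_right 0.
      real (nat \<lceil>c\<^sub>A * (1 / \<epsilon>\<^sup>2 * log_factor \<epsilon>)\<rceil>) \<le> q * (1 / \<epsilon>\<^sup>2 * (ln (1 / \<epsilon>) * ln (1 / \<Delta> \<epsilon>)))"
    unfolding log_factor_def by (rule batch_upper[OF c(1,3)])
  then obtain q where q: "q > 0" "\<forall>\<^sub>F \<epsilon> in at_right 0.
      real (nat \<lceil>c\<^sub>A * (1 / \<epsilon>\<^sup>2 * log_factor \<epsilon>)\<rceil>) \<le> q * (1 / \<epsilon>\<^sup>2 * (ln (1 / \<epsilon>) * ln (1 / \<Delta> \<epsilon>)))"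
    by blast
  have \<tau>4: "1 \<le> real (\<tau> \<epsilon>) ^ 4" for \<epsilon> using \<tau>_pos[of \<epsilon>] by (intro one_le_power) simp
  have "\<exists>r>0. \<forall>\<^sub>F \<epsilon> in at_right 0.
      real (nat \<lceil>c\<^sub>a * (real (\<tau> \<epsilon>) ^ 4 * log_factor \<epsilon>)\<rceil>) \<le> r * (real (\<tau> \<epsilon>) ^ 4 * (ln (1 / \<epsilon>) * ln (1 / \<Delta> \<epsilon>)))"
    unfolding log_factor_def by (rule batch_upper[OF c(2,3) \<tau>4])
  then obtain r where r: "r > 0" "\<forall>\<^sub>F \<epsilon> in at_right 0.
      real (nat \<lceil>c\<^sub>a * (real (\<tau> \<epsilon>) ^ 4 * log_factor \<epsilon>)\<rceil>) \<le> r * (real (\<tau> \<epsilon>) ^ 4 * (ln (1 / \<epsilon>) * ln (1 / \<Delta> \<epsilon>)))"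
    by blast
  show ?thesis
  proof (rule at_most_soft_thetaI[of "T * (q + 2 * r)"])
    show "T * (q + 2 * r) > 0" using T(1) q(1) r(1) by simp
    from T(2) q(2) r(2)
    show "\<forall>\<^sub>F \<epsilon> in at_right 0. real (value_evals (nat \<lceil>C * (1 / \<epsilon>) / real (\<tau> \<epsilon>)\<rceil>) (\<lambda>_. \<tau> \<epsilon>)
        (nat \<lceil>c\<^sub>A * (1 / \<epsilon>\<^sup>2) * log_factor \<epsilon>\<rceil>) (nat \<lceil>c\<^sub>a * real (\<tau> \<epsilon>) ^ 4 * log_factor \<epsilon>\<rceil>))
      \<le> T * (q + 2 * r) * ((1 / \<epsilon> ^ 3 * (1 / real (\<tau> \<epsilon>)) + 1 / \<epsilon> * real (\<tau> \<epsilon>) ^ 4) * ln (1 / \<Delta> \<epsilon>) * ln (1 / \<epsilon>))"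
    proof eventually_elim
      case (elim \<epsilon>)
      define W where "W = ln (1 / \<epsilon>) * ln (1 / \<Delta> \<epsilon>)"
      have W: "W \<ge> 0"
        unfolding W_def using elim(1) \<Delta>[of \<epsilon>] \<Delta>\<^sub>0 by (intro mult_nonneg_nonneg) auto
      have K: "real (nat \<lceil>C * (1 / \<epsilon>) / real (\<tau> \<epsilon>)\<rceil>) * real (\<tau> \<epsilon>) \<le> T / \<epsilon>"
        using elim(1) unfolding outer_def by blast
      have N\<^sub>0: "real (nat \<lceil>c\<^sub>A * (1 / \<epsilon>\<^sup>2) * log_factor \<epsilon>\<rceil>) \<le> q * (1 / \<epsilon>\<^sup>2 * W)"
        using elim(2) unfolding W_def mult.assoc[of c\<^sub>A] .
      have N\<^sub>1: "real (2 * nat \<lceil>c\<^sub>a * real (\<tau> \<epsilon>) ^ 4 * log_factor \<epsilon>\<rceil>) \<le> 2 * r * (real (\<tau> \<epsilon>) ^ 4 * W)"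
        using elim(3) unfolding W_def mult.assoc[of c\<^sub>a] by simp
      have "real (value_evals (nat \<lceil>C * (1 / \<epsilon>) / real (\<tau> \<epsilon>)\<rceil>) (\<lambda>_. \<tau> \<epsilon>)
          (nat \<lceil>c\<^sub>A * (1 / \<epsilon>\<^sup>2) * log_factor \<epsilon>\<rceil>) (nat \<lceil>c\<^sub>a * real (\<tau> \<epsilon>) ^ 4 * log_factor \<epsilon>\<rceil>))
        \<le> T * (q + 2 * r) * ((1 / \<epsilon> * (1 / \<epsilon>\<^sup>2 / real (\<tau> \<epsilon>)) + 1 / \<epsilon> * real (\<tau> \<epsilon>) ^ 4) * W)"
        unfolding value_evals_def
        by (rule total_cost_le[OF _ \<tau>_pos K T(1) W N\<^sub>0 N\<^sub>1]) (use elim q(1) r(1) in simp_all)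
      also have "1 / \<epsilon> * (1 / \<epsilon>\<^sup>2 / real (\<tau> \<epsilon>)) = 1 / \<epsilon> ^ 3 * (1 / real (\<tau> \<epsilon>))"
        by (simp add: power2_eq_square power3_eq_cube)
      finally show ?case by (simp only: W_def mult_ac)
    qed
  qed
qed

lemma jacobian_evals_soft_theta:
  assumes c: "c\<^sub>B > 0" "c\<^sub>a > 0" "c\<^sub>b > 0" "c' > 0" "c'' > 0"
  defines "log_factor \<equiv> \<lambda>c \<epsilon>. ln (c * outer \<epsilon> * real (\<tau> \<epsilon>) / \<Delta> \<epsilon>)"
  shows "at_most_soft_theta
    (\<lambda>\<epsilon>. real (jacobian_evals (nat \<lceil>C * (1 / \<epsilon>) / real (\<tau> \<epsilon>)\<rceil>) (\<lambda>_. \<tau> \<epsilon>)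
      (nat \<lceil>c\<^sub>B * (real (\<tau> \<epsilon>))\<^sup>2 * (1 / \<epsilon>) * log_factor c'' \<epsilon>\<rceil>)
      (nat \<lceil>c\<^sub>a * real (\<tau> \<epsilon>) ^ 4 * log_factor c' \<epsilon>\<rceil>)
      (nat \<lceil>c\<^sub>b * (real (\<tau> \<epsilon>))\<^sup>2 * log_factor c'' \<epsilon>\<rceil>)))
    (\<lambda>\<epsilon>. (1 / \<epsilon>\<^sup>2 * real (\<tau> \<epsilon>) + 1 / \<epsilon> * real (\<tau> \<epsilon>) ^ 4) * ln (1 / \<Delta> \<epsilon>))"
proof -
  obtain T where T: "T > 0"
    "\<forall>\<^sub>F \<epsilon> in at_right 0. 0 < \<epsilon> \<and> \<epsilon> < 1 \<and> 0 < outer \<epsilon> \<and> outer \<epsilon> * real (\<tau> \<epsilon>) \<le> T / \<epsilon>"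
    using outer_upper by blast
  have \<tau>1: "1 \<le> real (\<tau> \<epsilon>) ^ p" for \<epsilon> p using \<tau>_pos[of \<epsilon>] by (intro one_le_power) simp
  have "1 \<le> (real (\<tau> \<epsilon>))\<^sup>2 * (1 / \<epsilon>)" if "0 < \<epsilon>" "\<epsilon> < 1" for \<epsilon>
    using mult_mono[of 1 "(real (\<tau> \<epsilon>))\<^sup>2" 1 "1 / \<epsilon>"] \<tau>1[of \<epsilon> 2] that by simp
  then have "\<exists>q>0. \<forall>\<^sub>F \<epsilon> in at_right 0.
      real (nat \<lceil>c\<^sub>B * ((real (\<tau> \<epsilon>))\<^sup>2 * (1 / \<epsilon>) * log_factor c'' \<epsilon>)\<rceil>)
        \<le> q * ((real (\<tau> \<epsilon>))\<^sup>2 * (1 / \<epsilon>) * (ln (1 / \<epsilon>) * ln (1 / \<Delta> \<epsilon>)))"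
    unfolding log_factor_def by (rule batch_upper[OF c(1,5)])
  then obtain q where q: "q > 0" "\<forall>\<^sub>F \<epsilon> in at_right 0.
      real (nat \<lceil>c\<^sub>B * ((real (\<tau> \<epsilon>))\<^sup>2 * (1 / \<epsilon>) * log_factor c'' \<epsilon>)\<rceil>)
        \<le> q * ((real (\<tau> \<epsilon>))\<^sup>2 * (1 / \<epsilon>) * (ln (1 / \<epsilon>) * ln (1 / \<Delta> \<epsilon>)))"
    by blast
  have "\<exists>r>0. \<forall>\<^sub>F \<epsilon> in at_right 0.
      real (nat \<lceil>c\<^sub>a * (real (\<tau> \<epsilon>) ^ 4 * log_factor c' \<epsilon>)\<rceil>) \<le> r * (real (\<tau> \<epsilon>) ^ 4 * (ln (1 / \<epsilon>) * ln (1 / \<Delta> \<epsilon>)))"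
    unfolding log_factor_def by (rule batch_upper[OF c(2,4) \<tau>1[of _ 4]])
  then obtain r where r: "r > 0" "\<forall>\<^sub>F \<epsilon> in at_right 0.
      real (nat \<lceil>c\<^sub>a * (real (\<tau> \<epsilon>) ^ 4 * log_factor c' \<epsilon>)\<rceil>) \<le> r * (real (\<tau> \<epsilon>) ^ 4 * (ln (1 / \<epsilon>) * ln (1 / \<Delta> \<epsilon>)))"
    by blast
  have "\<exists>s>0. \<forall>\<^sub>F \<epsilon> in at_right 0.
      real (nat \<lceil>c\<^sub>b * ((real (\<tau> \<epsilon>))\<^sup>2 * log_factor c'' \<epsilon>)\<rceil>) \<le> s * ((real (\<tau> \<epsilon>))\<^sup>2 * (ln (1 / \<epsilon>) * ln (1 / \<Delta> \<epsilon>)))"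
    unfolding log_factor_def by (rule batch_upper[OF c(3,5) \<tau>1[of _ 2]])
  then obtain s where s: "s > 0" "\<forall>\<^sub>F \<epsilon> in at_right 0.
      real (nat \<lceil>c\<^sub>b * ((real (\<tau> \<epsilon>))\<^sup>2 * log_factor c'' \<epsilon>)\<rceil>) \<le> s * ((real (\<tau> \<epsilon>))\<^sup>2 * (ln (1 / \<epsilon>) * ln (1 / \<Delta> \<epsilon>)))"
    by blast
  show ?thesis
  proof (rule at_most_soft_thetaI[of "T * (q + (r + 2 * s))"])
    show "T * (q + (r + 2 * s)) > 0" using T(1) q(1) r(1) s(1) by simp
    from T(2) q(2) r(2) s(2)
    show "\<forall>\<^sub>F \<epsilon> in at_right 0. real (jacobian_evals (nat \<lceil>C * (1 / \<epsilon>) / real (\<tau> \<epsilon>)\<rceil>) (\<lambda>_. \<tau> \<epsilon>)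
        (nat \<lceil>c\<^sub>B * (real (\<tau> \<epsilon>))\<^sup>2 * (1 / \<epsilon>) * log_factor c'' \<epsilon>\<rceil>)
        (nat \<lceil>c\<^sub>a * real (\<tau> \<epsilon>) ^ 4 * log_factor c' \<epsilon>\<rceil>)
        (nat \<lceil>c\<^sub>b * (real (\<tau> \<epsilon>))\<^sup>2 * log_factor c'' \<epsilon>\<rceil>))
      \<le> T * (q + (r + 2 * s)) * ((1 / \<epsilon>\<^sup>2 * real (\<tau> \<epsilon>) + 1 / \<epsilon> * real (\<tau> \<epsilon>) ^ 4) * ln (1 / \<Delta> \<epsilon>) * ln (1 / \<epsilon>))"
    proof eventually_elim
      case (elim \<epsilon>)
      define W where "W = ln (1 / \<epsilon>) * ln (1 / \<Delta> \<epsilon>)"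
      have W: "W \<ge> 0"
        unfolding W_def using elim(1) \<Delta>[of \<epsilon>] \<Delta>\<^sub>0 by (intro mult_nonneg_nonneg) auto
      have K: "real (nat \<lceil>C * (1 / \<epsilon>) / real (\<tau> \<epsilon>)\<rceil>) * real (\<tau> \<epsilon>) \<le> T / \<epsilon>"
        using elim(1) unfolding outer_def by blast
      have N\<^sub>0: "real (nat \<lceil>c\<^sub>B * (real (\<tau> \<epsilon>))\<^sup>2 * (1 / \<epsilon>) * log_factor c'' \<epsilon>\<rceil>)
          \<le> q * ((real (\<tau> \<epsilon>))\<^sup>2 * (1 / \<epsilon>) * W)"
        using elim(2) unfolding W_def by (simp only: mult.assoc)
      \<comment> \<open>The cost of the batches of size \<open>b\<close> is of lower order: the
        Jacobians at \<open>x_0\<close> required by the batches of size \<open>a\<close>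
        dominate.\<close>
      have "(real (\<tau> \<epsilon>))\<^sup>2 \<le> real (\<tau> \<epsilon>) ^ 4"
        using \<tau>_pos[of \<epsilon>] by (intro power_increasing) auto
      then have "s * ((real (\<tau> \<epsilon>))\<^sup>2 * W) \<le> s * (real (\<tau> \<epsilon>) ^ 4 * W)"
        using W s(1) by (intro mult_left_mono mult_right_mono) auto
      then have N\<^sub>1: "real (nat \<lceil>c\<^sub>a * real (\<tau> \<epsilon>) ^ 4 * log_factor c' \<epsilon>\<rceil>
          + 2 * nat \<lceil>c\<^sub>b * (real (\<tau> \<epsilon>))\<^sup>2 * log_factor c'' \<epsilon>\<rceil>) \<le> (r + 2 * s) * (real (\<tau> \<epsilon>) ^ 4 * W)"
        using elim(3,4) unfolding W_def[symmetric] mult.assoc[of c\<^sub>a] mult.assoc[of c\<^sub>b]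
        by (simp add: distrib_right)
      have "real (jacobian_evals (nat \<lceil>C * (1 / \<epsilon>) / real (\<tau> \<epsilon>)\<rceil>) (\<lambda>_. \<tau> \<epsilon>)
          (nat \<lceil>c\<^sub>B * (real (\<tau> \<epsilon>))\<^sup>2 * (1 / \<epsilon>) * log_factor c'' \<epsilon>\<rceil>)
          (nat \<lceil>c\<^sub>a * real (\<tau> \<epsilon>) ^ 4 * log_factor c' \<epsilon>\<rceil>)
          (nat \<lceil>c\<^sub>b * (real (\<tau> \<epsilon>))\<^sup>2 * log_factor c'' \<epsilon>\<rceil>))
        \<le> T * (q + (r + 2 * s)) *
          ((1 / \<epsilon> * ((real (\<tau> \<epsilon>))\<^sup>2 * (1 / \<epsilon>) / real (\<tau> \<epsilon>)) + 1 / \<epsilon> * real (\<tau> \<epsilon>) ^ 4) * W)"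
        unfolding jacobian_evals_def
        by (rule total_cost_le[OF _ \<tau>_pos K T(1) W N\<^sub>0 N\<^sub>1]) (use elim q(1) r(1) s(1) in simp_all)
      also have "1 / \<epsilon> * ((real (\<tau> \<epsilon>))\<^sup>2 * (1 / \<epsilon>) / real (\<tau> \<epsilon>)) = 1 / \<epsilon>\<^sup>2 * real (\<tau> \<epsilon>)"
        using \<tau>_pos[of \<epsilon>] by (simp add: power2_eq_square)
      finally show ?case by (simp only: W_def mult_ac)
    qed
  qed
qed

end

section \<open>Batch sizes that meet the failure budget, and the choice of constants\<close>

text \<open>With \<open>y\<close> the argument of the logarithm, the batch size makes the exponential at most \<open>1 / y\<^sup>2\<close>: one
  factor \<open>1 / y\<close> yields the failure probability, the other absorbs the number \<open>w\<close> of entries in the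
  union bound.\<close>

lemma hoeffding_batch_size:
  fixes v u S w c \<Delta> :: real and K \<tau> N :: nat
  assumes N: "real N \<ge> 4 / v\<^sup>2 * S * ln (4 * c * real K * real \<tau> / \<Delta>)"
    and u: "u\<^sup>2 * S = v\<^sup>2" and v: "v > 0"
    and c: "c \<ge> 1" "0 \<le> w" "w \<le> c\<^sup>2" and \<Delta>: "0 < \<Delta>" "\<Delta> < 1" and K\<tau>: "K > 0" "\<tau> > 0"
  shows "w * (2 * exp (- (real N * u\<^sup>2 / 2))) \<le> \<Delta> / (4 * real K * real \<tau>)"
proof -
  define y where "y = 4 * c * real K * real \<tau> / \<Delta>"
  have "4 * c * 1 \<le> 4 * c * (real K * real \<tau>)"
    using K\<tau> c by (intro mult_left_mono one_le_mult_of_nat) auto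
  moreover have "4 * c * (real K * real \<tau>) * \<Delta> \<le> 4 * c * (real K * real \<tau>)"
    using c \<Delta> by (intro mult_left_le mult_nonneg_nonneg) auto
  then have "4 * c * (real K * real \<tau>) \<le> y"
    using \<Delta> by (simp add: y_def pos_le_divide_eq mult.assoc)
  ultimately have y: "4 * c \<le> y" by linarith
  have y0: "y > 0" using y c by linarith
  have "2 * ln y * v\<^sup>2 = u\<^sup>2 / 2 * (4 * S * ln y)" unfolding u[symmetric] by simp
  also have "\<dots> = u\<^sup>2 / 2 * (4 / v\<^sup>2 * S * ln y) * v\<^sup>2" using v by simp
  also have "\<dots> \<le> u\<^sup>2 / 2 * real N * v\<^sup>2"
    using N by (intro mult_right_mono mult_left_mono) (auto simp: y_def)
  finally have "2 * ln y \<le> real N * u\<^sup>2 / 2" using v by (simp add: mult.commute)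
  then have "exp (- (real N * u\<^sup>2 / 2)) \<le> exp (- (ln y + ln y))" by simp
  also have "\<dots> = 1 / (y * y)" using y0 unfolding exp_minus exp_add by (simp add: divide_inverse)
  finally have "w * (2 * exp (- (real N * u\<^sup>2 / 2))) \<le> w * (2 * (1 / (y * y)))"
    using c by (intro mult_left_mono) auto
  also have "\<dots> \<le> c / y"
  proof -
    have "w * 2 \<le> c * (4 * c)" using c by (simp add: power2_eq_square)
    also have "\<dots> \<le> c * y" using y c by (intro mult_left_mono) auto
    finally show ?thesis using y0 by (simp add: field_simps)
  qed
  also have "\<dots> = \<Delta> / (4 * real K * real \<tau>)" using c \<Delta> by (simp add: y_def)
  finally show ?thesis .
qed

lemma batch_size_pos:
  fixes C S c \<Delta> :: real and K \<tau> :: nat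
  assumes "C > 0" "S > 0" "c \<ge> 1" "0 < \<Delta>" "\<Delta> < 1" "K > 0" "\<tau> > 0"
  shows "nat \<lceil>C * S * ln (4 * c * real K * real \<tau> / \<Delta>)\<rceil> > 0"
proof -
  have "1 \<le> real K * real \<tau>" using assms by (intro one_le_mult_of_nat)
  then have "1 * 1 \<le> c * (real K * real \<tau>)" using assms by (intro mult_mono) auto
  then have "\<Delta> < 4 * (c * (real K * real \<tau>))" using assms by linarith
  then have "4 * c * real K * real \<tau> / \<Delta> > 1" using assms by (simp add: less_divide_eq mult.assoc)
  then have "C * S * ln (4 * c * real K * real \<tau> / \<Delta>) > 0" using assms by simp
  then show ?thesis by simp
qed

theorem corollary3p10:
  fixes f :: "real^'m \<Rightarrow> real" and g :: "real^'n \<Rightarrow> real^'m" and g' :: "real^'n \<Rightarrow> real^'n^'m"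
    and h :: "real^'n \<Rightarrow> ereal"
    and D :: "'x measure"
    and gc :: "'x \<Rightarrow> real^'n \<Rightarrow> real^'m" and Jc :: "'x \<Rightarrow> real^'n \<Rightarrow> real^'n^'m"
    and l\<^sub>f l\<^sub>g L\<^sub>g \<sigma>\<^sub>g \<sigma>\<^sub>J l\<^sub>c L\<^sub>c M :: real
    and x00 :: "real^'n"
  assumes f_convex: "convex_on UNIV f"
    and f_lipschitz: "l\<^sub>f-lipschitz_on UNIV f"
    and g_lipschitz: "l\<^sub>g-lipschitz_on UNIV g"
    and g_deriv: "\<And>x. (g has_derivative (\<lambda>v. g' x *v v)) (at x)"
    and g_smooth: "\<And>x y. opnorm (g' x - g' y) \<le> L\<^sub>g * norm (x - y)"
    and pos: "l\<^sub>f > 0" "L\<^sub>g > 0"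
    and h: "closed_convex_proper h"
    and D: "prob_space D"
    and gc_deriv: "\<And>\<xi> x. \<xi> \<in> space D \<Longrightarrow> (gc \<xi> has_derivative (\<lambda>v. Jc \<xi> x *v v)) (at x)"
    and g_mean: "\<And>x. integrable D (\<lambda>\<xi>. gc \<xi> x)" "\<And>x. g x = (\<integral>\<xi>. gc \<xi> x \<partial>D)"
    and g'_mean: "\<And>x. integrable D (\<lambda>\<xi>. Jc \<xi> x)" "\<And>x. g' x = (\<integral>\<xi>. Jc \<xi> x \<partial>D)"
    and V: "AE \<xi> in D. \<forall>x. norm (gc \<xi> x - g x) \<le> \<sigma>\<^sub>g \<and> opnorm (Jc \<xi> x - g' x) \<le> \<sigma>\<^sub>J"
    and UL: "AE \<xi> in D. \<forall>x y. norm (gc \<xi> x - gc \<xi> y) \<le> l\<^sub>c * norm (x - y) \<and>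
               opnorm (Jc \<xi> x - Jc \<xi> y) \<le> L\<^sub>c * norm (x - y)"
    and bounded_below: "(INF x. objective f g h x) > - \<infinity>"
    and M: "M > 5 * l\<^sub>f * L\<^sub>g"
  shows "\<exists>C\<^sub>\<Sigma> C\<^sub>A C\<^sub>B C\<^sub>a C\<^sub>b :: real.
    C\<^sub>\<Sigma> > 0 \<and> C\<^sub>A > 0 \<and> C\<^sub>B > 0 \<and> C\<^sub>a > 0 \<and> C\<^sub>b > 0 \<and>
    (let m = real CARD('m); n = real CARD('n);
         K = (\<lambda>(\<epsilon>::real) (\<tau>::nat). nat \<lceil>C\<^sub>\<Sigma> * (1 / \<epsilon>) / real \<tau>\<rceil>);
         A = (\<lambda>\<epsilon> \<tau> (\<Delta>::real).
                nat \<lceil>C\<^sub>A * (1 / \<epsilon>^2) * ln (4 * (m + 1) * real (K \<epsilon> \<tau>) * real \<tau> / \<Delta>)\<rceil>);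
         B = (\<lambda>\<epsilon> \<tau> (\<Delta>::real).
                nat \<lceil>C\<^sub>B * real \<tau>^2 * (1 / \<epsilon>) * ln (4 * (m + n) * real (K \<epsilon> \<tau>) * real \<tau> / \<Delta>)\<rceil>);
         a = (\<lambda>\<epsilon> \<tau> (\<Delta>::real).
                nat \<lceil>C\<^sub>a * real \<tau>^4 * ln (4 * (m + 1) * real (K \<epsilon> \<tau>) * real \<tau> / \<Delta>)\<rceil>);
         b = (\<lambda>\<epsilon> \<tau> (\<Delta>::real).
                nat \<lceil>C\<^sub>b * real \<tau>^2 * ln (4 * (m + n) * real (K \<epsilon> \<tau>) * real \<tau> / \<Delta>)\<rceil>);
         \<delta>b = (\<lambda>\<epsilon> \<tau> \<Delta>. \<Delta> / (2 * real (K \<epsilon> \<tau>) * real \<tau>));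
         \<epsilon>b = (\<lambda>\<epsilon>. \<epsilon> / (5 * 30 * M))
     in
      (\<exists>\<epsilon>\<^sub>0 > 0. \<forall>\<Delta> \<tau> \<epsilon>. 0 < \<Delta> \<and> \<Delta> < 1 \<and> \<tau> > 0 \<and> 0 < \<epsilon> \<and> \<epsilon> < \<epsilon>\<^sub>0 \<longrightarrow>
        (\<forall>(P :: 'w measure) SA SB slv.
          is_run f h gc Jc D x00 M (K \<epsilon> \<tau>) (\<lambda>_. \<tau>) (A \<epsilon> \<tau> \<Delta>) (B \<epsilon> \<tau> \<Delta>) (a \<epsilon> \<tau> \<Delta>) (b \<epsilon> \<tau> \<Delta>)
            (\<epsilon>b \<epsilon>) (\<delta>b \<epsilon> \<tau> \<Delta>) P SA SB slv \<and>
          solver_succeeds f h gc Jc x00 M (K \<epsilon> \<tau>) (\<lambda>_. \<tau>) (A \<epsilon> \<tau> \<Delta>) (B \<epsilon> \<tau> \<Delta>) (a \<epsilon> \<tau> \<Delta>) (b \<epsilon> \<tau> \<Delta>)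
            (\<epsilon>b \<epsilon>) (\<delta>b \<epsilon> \<tau> \<Delta>) P SA SB slv \<longrightarrow>
          measure P {\<omega> \<in> space P.
            1 / (real (K \<epsilon> \<tau>) * real \<tau>) *
              (\<Sum>k<K \<epsilon> \<tau>. \<Sum>i<\<tau>.
                 (norm (grad_map f g g' h M
                   (run_iterate f h gc Jc x00 M (\<lambda>_. \<tau>) (A \<epsilon> \<tau> \<Delta>) (B \<epsilon> \<tau> \<Delta>) (a \<epsilon> \<tau> \<Delta>) (b \<epsilon> \<tau> \<Delta>)
                      (\<epsilon>b \<epsilon>) (\<delta>b \<epsilon> \<tau> \<Delta>) SA SB slv k i \<omega>)))\<^sup>2) \<le> \<epsilon>} \<ge> 1 - \<Delta>)) \<and>
      (\<forall>(\<tau> :: real \<Rightarrow> nat) (\<Delta> :: real \<Rightarrow> real) \<Delta>\<^sub>0.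
        (\<forall>\<epsilon>. \<tau> \<epsilon> > 0) \<and> (\<lambda>\<epsilon>. real (\<tau> \<epsilon>)) \<in> O[at_right 0](\<lambda>\<epsilon>. 1 / \<epsilon>) \<and>
        (\<forall>\<epsilon>. 0 < \<Delta> \<epsilon> \<and> \<Delta> \<epsilon> \<le> \<Delta>\<^sub>0) \<and> \<Delta>\<^sub>0 < 1 \<longrightarrow>
        at_most_soft_theta
          (\<lambda>\<epsilon>. real (value_evals (K \<epsilon> (\<tau> \<epsilon>)) (\<lambda>_. \<tau> \<epsilon>) (A \<epsilon> (\<tau> \<epsilon>) (\<Delta> \<epsilon>)) (a \<epsilon> (\<tau> \<epsilon>) (\<Delta> \<epsilon>))))
          (\<lambda>\<epsilon>. (1 / \<epsilon>^3 * (1 / real (\<tau> \<epsilon>)) + 1 / \<epsilon> * real (\<tau> \<epsilon>)^4) * ln (1 / \<Delta> \<epsilon>)) \<and>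
        at_most_soft_theta
          (\<lambda>\<epsilon>. real (jacobian_evals (K \<epsilon> (\<tau> \<epsilon>)) (\<lambda>_. \<tau> \<epsilon>)
                        (B \<epsilon> (\<tau> \<epsilon>) (\<Delta> \<epsilon>)) (a \<epsilon> (\<tau> \<epsilon>) (\<Delta> \<epsilon>)) (b \<epsilon> (\<tau> \<epsilon>) (\<Delta> \<epsilon>))))
          (\<lambda>\<epsilon>. (1 / \<epsilon>^2 * real (\<tau> \<epsilon>) + 1 / \<epsilon> * real (\<tau> \<epsilon>)^4) * ln (1 / \<Delta> \<epsilon>))))"
proof -
  interpret stochastic_composite_problem f g g' h l\<^sub>f L\<^sub>g M D gc Jc \<sigma>\<^sub>g \<sigma>\<^sub>J L\<^sub>c
  proof (intro stochastic_composite_problem.intro composite_problem.intro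
      stochastic_composite_problem_axioms.intro)
    show "AE \<xi> in D. \<forall>x. norm (gc \<xi> x - g x) \<le> \<sigma>\<^sub>g" using V by eventually_elim blast
    show "AE \<xi> in D. \<forall>x. opnorm (Jc \<xi> x - g' x) \<le> \<sigma>\<^sub>J" using V by eventually_elim blast
    show "AE \<xi> in D. \<forall>x y. opnorm (Jc \<xi> x - Jc \<xi> y) \<le> L\<^sub>c * norm (x - y)" using UL by eventually_elim blast
  qed (fact f_convex f_lipschitz g_deriv g_smooth pos h bounded_below M D gc_deriv g_mean g'_mean)+
  \<comment> \<open>Such a level exists even if \<open>h x00\<close> is infinite, and it depends
    only on the starting point and the problem data.\<close>
  obtain \<phi> where \<phi>: "level x00 \<phi>" using level_exists by blast
  \<comment> \<open>The initial gap may be 0; the maximum with 1 keeps the constant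
    positive.\<close>
  define C\<^sub>\<Sigma> where "C\<^sub>\<Sigma> = max 1 (16 * M * (\<phi> - inf_value))"
  define m where "m = real CARD('m)"
  define n where "n = real CARD('n)"
  have m: "m \<ge> 1" and n: "n \<ge> 1"
    unfolding m_def n_def by (simp_all add: Suc_le_eq flip: of_nat_Suc)
  \<comment> \<open>The three terms of \<open>small\<close> are to be at most \<open>M / 16\<close>
    each, where 14 works since \<open>12 / 196 < 1 / 16\<close>. The three terms of
    \<open>small'\<close> are to be at most \<open>1 / (32 * M)\<close> each, where
    \<open>1 / 20\<close> works since \<open>12 / 400 < 1 / 32\<close>.\<close>
  define \<alpha> where "\<alpha> = 1 / (64 * l\<^sub>f * M)"
  define \<beta> where "\<beta> = min (M / 16) (min (1 / (32 * M)) (1 / 20)) / l\<^sub>f"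
  define \<gamma> where "\<gamma> = M / (32 * l\<^sub>f)"
  define \<eta> where "\<eta> = M / (14 * l\<^sub>f)"
  have consts_pos: "\<alpha> > 0" "\<beta> > 0" "\<gamma> > 0" "\<eta> > 0"
    using lf_pos M_pos by (auto simp: \<alpha>_def \<beta>_def \<gamma>_def \<eta>_def)
  have l\<beta>: "l\<^sub>f * \<beta> \<le> M / 16" "l\<^sub>f * \<beta> \<le> 1 / (32 * M)" "l\<^sub>f * \<beta> \<le> 1 / 20"
    using lf_pos by (auto simp: \<beta>_def)
  have small: "l\<^sub>f * \<beta> + 2 * l\<^sub>f * \<gamma> + 12 * l\<^sub>f\<^sup>2 * \<eta>\<^sup>2 / M \<le> M / 4"
  proof -
    have "2 * l\<^sub>f * \<gamma> = M / 16" "12 * l\<^sub>f\<^sup>2 * \<eta>\<^sup>2 / M = 12 * M / 196"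
      using lf_pos M_pos by (simp_all add: \<gamma>_def \<eta>_def power2_eq_square)
    with l\<beta>(1) M_pos show ?thesis by simp
  qed
  have small': "2 * l\<^sub>f * \<alpha> + l\<^sub>f * \<beta> + 12 * l\<^sub>f\<^sup>2 * \<beta>\<^sup>2 / M \<le> 1 / (8 * M)"
  proof -
    have "2 * l\<^sub>f * \<alpha> = 1 / (32 * M)" using lf_pos by (simp add: \<alpha>_def)
    moreover have "(l\<^sub>f * \<beta>)\<^sup>2 \<le> (1 / 20)\<^sup>2"
      using l\<beta>(3) lf_pos consts_pos by (intro power_mono) auto
    then have "12 * (l\<^sub>f * \<beta>)\<^sup>2 / M \<le> (1 / 32) / M"
      using M_pos by (intro divide_right_mono) (auto simp: power2_eq_square)
    then have "12 * l\<^sub>f\<^sup>2 * \<beta>\<^sup>2 / M \<le> 1 / (32 * M)" by (simp add: power_mult_distrib)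
    moreover have "1 / (32 * M) + 1 / (32 * M) + 1 / (32 * M) \<le> 1 / (8 * M)"
      using M_pos by (simp add: field_simps)
    ultimately show ?thesis using l\<beta>(2) by linarith
  qed
  \<comment> \<open>The bounds in \<open>errs\<close> solved for the deviation, without the powers
    of \<open>\<epsilon>\<close> and \<open>\<tau>\<close>. The \<open>+ 1\<close> avoids a division
    by zero when the bound in (V) is 0; the sum \<open>L\<^sub>c + L\<^sub>g\<close> is already
    positive.\<close>
  define v\<^sub>A where "v\<^sub>A = \<alpha> / (m * (\<sigma>\<^sub>g + 1))"
  define v\<^sub>B where "v\<^sub>B = \<beta> / (m * n * (\<sigma>\<^sub>J + 1))"
  define v\<^sub>a where "v\<^sub>a = \<gamma> / (m * (L\<^sub>c + L\<^sub>g))"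
  define v\<^sub>b where "v\<^sub>b = \<eta> / (m * n * (L\<^sub>c + L\<^sub>g))"
  have v_pos: "v\<^sub>A > 0" "v\<^sub>B > 0" "v\<^sub>a > 0" "v\<^sub>b > 0"
    unfolding v\<^sub>A_def v\<^sub>B_def v\<^sub>a_def v\<^sub>b_def using consts_pos m n sigma_nonneg Lc_nonneg Lg_pos
    by (auto intro!: divide_pos_pos mult_pos_pos)
  have C_pos: "4 / v\<^sub>A\<^sup>2 > 0" "4 / v\<^sub>B\<^sup>2 > 0" "4 / v\<^sub>a\<^sup>2 > 0" "4 / v\<^sub>b\<^sup>2 > 0" "C\<^sub>\<Sigma> > 0"
    using v_pos by (auto simp: C\<^sub>\<Sigma>_def)
  have errs: "m * (\<sigma>\<^sub>g * v\<^sub>A) \<le> \<alpha>" "m * n * (\<sigma>\<^sub>J * v\<^sub>B) \<le> \<beta>"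
    "m * ((L\<^sub>c + L\<^sub>g) * v\<^sub>a) = \<gamma>" "m * n * ((L\<^sub>c + L\<^sub>g) * v\<^sub>b) = \<eta>"
    unfolding v\<^sub>A_def v\<^sub>B_def v\<^sub>a_def v\<^sub>b_def using consts_pos m n sigma_nonneg Lc_nonneg Lg_pos
    by (auto simp: divide_simps mult_le_cancel_left)
  have mean_square: "1 - \<Delta> \<le> measure P {\<omega> \<in> space P. 1 / (real K * real \<tau>) *
      (\<Sum>k<K. \<Sum>i<\<tau>. (norm (grad_map f g g' h M
        (run_iterate f h gc Jc x00 M (\<lambda>_. \<tau>) A B a b \<epsilon>b \<delta>b SA SB slv k i \<omega>)))\<^sup>2) \<le> \<epsilon>}"
    if \<Delta>: "0 < \<Delta>" "\<Delta> < 1" and \<tau>: "\<tau> > 0" and \<epsilon>: "0 < \<epsilon>"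
      and run: "is_run f h gc Jc D x00 M K (\<lambda>_. \<tau>) A B a b \<epsilon>b \<delta>b P SA SB slv"
      and succ: "solver_succeeds f h gc Jc x00 M K (\<lambda>_. \<tau>) A B a b \<epsilon>b \<delta>b P SA SB slv"
      and \<delta>b: "\<delta>b = \<Delta> / (2 * real K * real \<tau>)" and \<epsilon>b: "\<epsilon>b = \<epsilon> / (5 * 30 * M)"
      and K: "K = nat \<lceil>C\<^sub>\<Sigma> * (1 / \<epsilon>) / real \<tau>\<rceil>"
      and A: "A = nat \<lceil>4 / v\<^sub>A\<^sup>2 * (1 / \<epsilon>\<^sup>2) * ln (4 * (m + 1) * real K * real \<tau> / \<Delta>)\<rceil>"
      and B: "B = nat \<lceil>4 / v\<^sub>B\<^sup>2 * (real \<tau>)\<^sup>2 * (1 / \<epsilon>) * ln (4 * (m + n) * real K * real \<tau> / \<Delta>)\<rceil>"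
      and a: "a = nat \<lceil>4 / v\<^sub>a\<^sup>2 * real \<tau> ^ 4 * ln (4 * (m + 1) * real K * real \<tau> / \<Delta>)\<rceil>"
      and b: "b = nat \<lceil>4 / v\<^sub>b\<^sup>2 * (real \<tau>)\<^sup>2 * ln (4 * (m + n) * real K * real \<tau> / \<Delta>)\<rceil>"
    for \<Delta> \<epsilon> \<epsilon>b \<delta>b :: real and \<tau> K A B a b :: nat and P :: "'w measure" and SA SB slv
  proof -
    have "C\<^sub>\<Sigma> * (1 / \<epsilon>) / real \<tau> > 0" using C_pos \<epsilon> \<tau> by simp
    then have K_pos: "K > 0" unfolding K by simp
    have "C\<^sub>\<Sigma> * (1 / \<epsilon>) / real \<tau> \<le> real K" unfolding K by linarith
    then have K\<tau>: "C\<^sub>\<Sigma> / \<epsilon> \<le> real K * real \<tau>" using \<tau> by (subst (asm) pos_divide_le_eq) auto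
    have B': "B = nat \<lceil>4 / v\<^sub>B\<^sup>2 * ((real \<tau>)\<^sup>2 * (1 / \<epsilon>)) * ln (4 * (m + n) * real K * real \<tau> / \<Delta>)\<rceil>"
      unfolding B by (simp only: mult.assoc)
    have c: "m + 1 \<ge> 1" "m + n \<ge> 1" "0 \<le> m" "0 \<le> m * n" using m n by auto
    \<comment> \<open>The entrywise union bound counts \<open>m\<close> or \<open>m * n\<close>
      events, while the logarithms contain only \<open>m + 1\<close> and \<open>m + n\<close>; the
      squares bridge the difference.\<close>
    have w: "m \<le> (m + 1)\<^sup>2" "m * n \<le> (m + n)\<^sup>2" using m n by (auto simp: power2_eq_square algebra_simps)
    note pos = batch_size_pos[OF _ _ _ \<Delta> K_pos \<tau>]
    note tail = hoeffding_batch_size[OF real_nat_ceiling_ge _ _ _ _ _ \<Delta> K_pos \<tau>]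
    \<comment> \<open>Each \<open>u\<close> is \<open>v\<close> times the accuracy that the descent
      argument asks for, and this accuracy squared is the reciprocal of the scale in the batch size.
      Hence \<open>u^2 * S = v^2\<close>, and \<open>4 / v^2\<close> serves as the constant.\<close>
    let ?u\<^sub>A = "v\<^sub>A * \<epsilon>" and ?u\<^sub>B = "v\<^sub>B * (sqrt \<epsilon> / real \<tau>)"
    let ?u\<^sub>a = "v\<^sub>a / (real \<tau>)\<^sup>2" and ?u\<^sub>b = "v\<^sub>b / real \<tau>"
    show ?thesis
    proof (rule run_average_grad_map_bound[OF run succ \<epsilon>b \<delta>b \<Delta> K_pos \<tau>, where \<phi> = \<phi> and C = C\<^sub>\<Sigma>
          and u\<^sub>A = ?u\<^sub>A and u\<^sub>B = ?u\<^sub>B and u\<^sub>a = ?u\<^sub>a and u\<^sub>b = ?u\<^sub>b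
          and \<alpha> = \<alpha> and \<beta> = \<beta> and \<gamma> = \<gamma> and \<eta> = \<eta>, folded m_def n_def])
      show "A > 0" unfolding A by (rule pos) (use C_pos c \<epsilon> in auto)
      show "B > 0" unfolding B' by (rule pos) (use C_pos c \<epsilon> \<tau> in auto)
      show "a > 0" unfolding a by (rule pos) (use C_pos c \<tau> in auto)
      show "b > 0" unfolding b by (rule pos) (use C_pos c \<tau> in auto)
      show "0 \<le> ?u\<^sub>A" "0 \<le> ?u\<^sub>B" "0 \<le> ?u\<^sub>a" "0 \<le> ?u\<^sub>b" using v_pos \<epsilon> by auto
      show "m * (2 * exp (- (real A * ?u\<^sub>A\<^sup>2 / 2))) \<le> \<Delta> / (4 * real K * real \<tau>)"
        unfolding A by (rule tail[OF _ v_pos(1) c(1,3) w(1)]) (use \<epsilon> in \<open>simp add: power_mult_distrib\<close>)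
      show "m * n * (2 * exp (- (real B * ?u\<^sub>B\<^sup>2 / 2))) \<le> \<Delta> / (4 * real K * real \<tau>)"
        unfolding B' by (rule tail[OF _ v_pos(2) c(2,4) w(2)])
          (use \<epsilon> \<tau> in \<open>simp add: power_mult_distrib power_divide\<close>)
      show "m * (2 * exp (- (real a * ?u\<^sub>a\<^sup>2 / 2))) \<le> \<Delta> / (4 * real K * real \<tau>)"
        unfolding a by (rule tail[OF _ v_pos(3) c(1,3) w(1)]) (use \<tau> in \<open>simp add: power_divide\<close>)
      show "m * n * (2 * exp (- (real b * ?u\<^sub>b\<^sup>2 / 2))) \<le> \<Delta> / (4 * real K * real \<tau>)"
        unfolding b by (rule tail[OF _ v_pos(4) c(2,4) w(2)]) (use \<tau> in \<open>simp add: power_divide\<close>)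
      show "m * (\<sigma>\<^sub>g * ?u\<^sub>A) \<le> \<alpha> * \<epsilon>"
        using mult_right_mono[OF errs(1), of \<epsilon>] \<epsilon> by (simp add: mult.assoc)
      show "m * n * (\<sigma>\<^sub>J * ?u\<^sub>B) \<le> \<beta> * sqrt \<epsilon> / real \<tau>"
        using mult_right_mono[OF errs(2), of "sqrt \<epsilon> / real \<tau>"] \<epsilon> by (simp add: mult.assoc)
      show "m * ((L\<^sub>c + L\<^sub>g) * ?u\<^sub>a) \<le> \<gamma> / (real \<tau>)\<^sup>2"
        unfolding errs(3)[symmetric] by simp
      show "m * n * ((L\<^sub>c + L\<^sub>g) * ?u\<^sub>b) \<le> \<eta> / real \<tau>"
        unfolding errs(4)[symmetric] by simp
      show "16 * M * (\<phi> - inf_value) \<le> C\<^sub>\<Sigma>" by (simp add: C\<^sub>\<Sigma>_def)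
    qed (use \<epsilon> consts_pos small small' \<phi> K\<tau> C_pos in auto)
  qed
  show ?thesis
    unfolding Let_def
  proof (rule exI[of _ C\<^sub>\<Sigma>], rule exI[of _ "4 / v\<^sub>A\<^sup>2"], rule exI[of _ "4 / v\<^sub>B\<^sup>2"],
      rule exI[of _ "4 / v\<^sub>a\<^sup>2"], rule exI[of _ "4 / v\<^sub>b\<^sup>2"], intro conjI, goal_cases)
    case 6
    show ?case
    \<comment> \<open>The bound \<open>mean_square\<close> holds for every positive
      \<open>\<epsilon>\<close>, so any threshold serves.\<close>
    proof (rule exI[of _ 1], intro conjI allI impI, goal_cases)
      case (2 \<Delta> \<tau> \<epsilon> P SA SB slv)
      then show ?case
        by (elim conjE) (rule mean_square[unfolded m_def n_def]; (assumption | rule refl))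
    qed simp
  next
    case 7
    show ?case
    proof (intro allI impI, goal_cases)
      case (1 \<tau> \<Delta> \<Delta>\<^sub>0)
      interpret complexity_setting C\<^sub>\<Sigma> \<tau> \<Delta> \<Delta>\<^sub>0
        by unfold_locales (use 1 C_pos in auto)
      have c: "4 * (real CARD('m) + 1) > 0" "4 * (real CARD('m) + real CARD('n)) > 0"
        by (intro mult_pos_pos add_pos_pos; simp)+
      show ?case
        by (rule conjI[OF value_evals_soft_theta[OF C_pos(1,3) c(1), unfolded outer_def]
              jacobian_evals_soft_theta[OF C_pos(2,3,4) c, unfolded outer_def]])
    qed
  qed fact+
qed

end
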